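(* Let $1/2<m<\infty$ and $b>0$ be fixed. Let $\Phi(\tau)=\Phi(\tau,b)$, with $a=a(m,b)>0$, be the unique solution on $\mathbb R$ of $$(\Phi''+\Phi\Phi')'=\frac{2m-1}{m}(\Phi')^2,\qquad \lim_{\tau\to-\infty}e^{-\varepsilon\tau}\{\Phi(\tau)+a,\Phi'(\tau),\Phi''(\tau)\}=\{0,0,0\}\ \ \forall\varepsilon\in(0,a),$$ $$\Phi(0)=0,\qquad \lim_{\tau\to\infty}\Phi(\tau)/\tau^m=b,$$ and let $f_m(\Phi)=f_m(\Phi(\tau))$ be the solution, with this $a$, of the singular Cauchy problem $$\frac{d}{d\Phi}\big(f\dot f+\Phi f\big)=\frac{2m-1}{m}f,\ \ \Phi>-a,\qquad \lim_{\Phi\to-a+0}f(\Phi)=0,\quad\lim_{\Phi\to-a+0}\dot f(\Phi)=a,$$ so that $f_m(\Phi(\tau))=\Phi'(\tau)$ along the trajectory. Then: (i) $(a^2-\Phi^2)/2<f_m(\Phi)<a(\Phi+a)$ for $-a<\Phi\le a$, and $0<f_m(\Phi)<a(\Phi+a)$ for $\Phi>a$; (ii) for finite $\Phi$: $f_m$ is holomorphic at $\Phi=-a$, with $f_m(\Phi)=a(\Phi+a)\big[1+\sum_{k\ge1}\chi_{m,k}(\Phi+a)^k/a^k\big]$, where $\chi_{m,1}=-1/(4m)$ and $\chi_{m,k}=(k+1)^{-2}\big\{-\chi_{m,k-1}\frac{1+m(k-1)}{m}-\sum_{l=1}^{k-1}[l(k+3)+1]\chi_{m,l}\chi_{m,k-l}\big\}$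 for $k\ge2$; moreover $f_m$ exists globally and is positive on $(-a,\infty)$; (iii) for large positive $\Phi$, with $B=m\,b^{1/m}$ and some constant $D=D_m$, $$f_m(\Phi)=B\,\Phi^{(m-1)/m}\Big\{1+\theta\big(\Phi^{(m+1)/m},m,B\big)+D\,\Phi^{\varkappa_1}\exp\Big(-\frac{m}{B(m+1)}\Phi^{(m+1)/m}\Big)[1+o(1)]\Big\},\quad\Phi\to\infty,$$ where $\varkappa_1=-(2m^2+4m-4)/[m(m+1)]$ and $\theta$ is as in the context.
   Context: A prime denotes $d/d\tau$ on functions of $\tau$; a dot denotes $d/d\Phi$. The function $\theta(x,m,B)$ is a (fixed) solution, for large $x$, of $$\widetilde Z''+\widetilde Z'\Big[\tfrac{m}{B(m+1)}+\tfrac{4m-3}{x(m+1)}\Big]+\widetilde Z\tfrac{(m-1)(m-2)}{(m+1)^2x^2}+\tfrac{m}{B(m+1)}\widetilde Z'[(1+\widetilde Z)^{-1}-1]+\tfrac{\widetilde Z'^2}{1+\widetilde Z}+\tfrac{(m-1)(m-2)}{(m+1)^2x^2}=0$$ (prime $=d/dx$) with $\widetilde Z,\widetilde Z'\to0$ as $x\to\infty$, having as asymptotic expansion for large $x$ the formal power series solution $\sum_{k\ge1}\theta_kx^{-k}$, with $\theta_1=B(m-1)(m-2)/[m(m+1)]$ and the other coefficients determined by formal substitution. (This equation is the ODE for $f$ rewritten via $f=B\Phi^{(m-1)/m}[1+\widetilde Z(x)]$, $x=\Phi^{(m+1)/m}$; for $m=1,2$ one takes $\theta\equiv0$.)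
   Formalization: In (iii) the term DΦ^{ϰ₁}exp(…)[1+o(1)] is added outside the braces, not multiplied by BΦ^{(m−1)/m}: the printed ϰ₁ is the exponent of the absolute correction to f, and the printed formula fails, e.g. for m=2. *)

theory Defs
  imports
    "HOL-Analysis.Analysis"
    "HOL-Computational_Algebra.Formal_Power_Series"
    "HOL-Library.Landau_Symbols"
begin

text \<open>
  The only third-order information required of \<open>\<Phi>\<close> and the only second-order information
  required of \<open>f\<close> below is the differentiability of the bracketed expressions in the equations.
\<close>

definition trajectory_solution :: "real \<Rightarrow> real \<Rightarrow> real \<Rightarrow> (real \<Rightarrow> real) \<Rightarrow> bool" where
  "trajectory_solution m b a \<Phi> \<longleftrightarrow>
     (\<forall>\<tau>. \<Phi> differentiable (at \<tau>) \<and> deriv \<Phi> differentiable (at \<tau>) \<and>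
        ((\<lambda>t. deriv (deriv \<Phi>) t + \<Phi> t * deriv \<Phi> t)
           has_real_derivative (2 * m - 1) / m * (deriv \<Phi> \<tau>)\<^sup>2) (at \<tau>)) \<and>
     (\<forall>\<epsilon>. 0 < \<epsilon> \<and> \<epsilon> < a \<longrightarrow>
        ((\<lambda>\<tau>. exp (- \<epsilon> * \<tau>) * (\<Phi> \<tau> + a)) \<longlongrightarrow> 0) at_bot \<and>
        ((\<lambda>\<tau>. exp (- \<epsilon> * \<tau>) * deriv \<Phi> \<tau>) \<longlongrightarrow> 0) at_bot \<and>
        ((\<lambda>\<tau>. exp (- \<epsilon> * \<tau>) * deriv (deriv \<Phi>) \<tau>) \<longlongrightarrow> 0) at_bot) \<and>
     \<Phi> 0 = 0 \<and>
     ((\<lambda>\<tau>. \<Phi> \<tau> / \<tau> powr m) \<longlongrightarrow> b) at_top"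

text \<open>
  \<open>f\<close> solves the singular Cauchy problem on \<open>(-a, R)\<close>; \<open>R = \<infinity>\<close> gives a global solution.
\<close>

definition cauchy_solution :: "real \<Rightarrow> real \<Rightarrow> ereal \<Rightarrow> (real \<Rightarrow> real) \<Rightarrow> bool" where
  "cauchy_solution m a R f \<longleftrightarrow>
     ereal (- a) < R \<and>
     (\<forall>y. - a < y \<and> ereal y < R \<longrightarrow>
        f differentiable (at y) \<and>
        ((\<lambda>s. f s * deriv f s + s * f s) has_real_derivative (2 * m - 1) / m * f y) (at y)) \<and>
     (f \<longlongrightarrow> 0) (at_right (- a)) \<and>
     (deriv f \<longlongrightarrow> a) (at_right (- a))"

text \<open>Only the indices \<open>k \<ge> 1\<close> are meaningful; the value at \<open>0\<close> is a dummy.\<close>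

function chi :: "real \<Rightarrow> nat \<Rightarrow> real" where
  "chi m k =
     (if k = 0 then 0
      else if k = 1 then - 1 / (4 * m)
      else (- chi m (k - 1) * ((1 + m * (real k - 1)) / m)
            - (\<Sum>l\<in>{1..k-1}. (real l * (real k + 3) + 1) * chi m l * chi m (k - l)))
           / (real k + 1)\<^sup>2)"
  by pat_completeness auto
termination
  by (relation "Wellfounded.measure snd") auto

declare chi.simps [simp del]

definition theta_equation_at :: "real \<Rightarrow> real \<Rightarrow> (real \<Rightarrow> real) \<Rightarrow> real \<Rightarrow> bool" where
  "theta_equation_at m B Z x \<longleftrightarrow>
     deriv (deriv Z) x
     + deriv Z x * (m / (B * (m + 1)) + (4 * m - 3) / (x * (m + 1)))
     + Z x * ((m - 1) * (m - 2) / ((m + 1)\<^sup>2 * x\<^sup>2))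
     + m / (B * (m + 1)) * deriv Z x * (inverse (1 + Z x) - 1)
     + (deriv Z x)\<^sup>2 / (1 + Z x)
     + (m - 1) * (m - 2) / ((m + 1)\<^sup>2 * x\<^sup>2) = 0"

text \<open>
  Formal series in \<open>1/x\<close> are power series in \<open>X = 1/x\<close>, on which \<open>d/dx\<close> acts as \<open>- X\<^sup>2 d/dX\<close>.
\<close>

definition fps_ddx :: "real fps \<Rightarrow> real fps" where
  "fps_ddx c = - (fps_X\<^sup>2 * fps_deriv c)"

definition theta_formal_solution :: "real \<Rightarrow> real \<Rightarrow> real fps \<Rightarrow> bool" where
  "theta_formal_solution m B c \<longleftrightarrow>
     fps_nth c 0 = 0 \<and>
     fps_nth c 1 = B * (m - 1) * (m - 2) / (m * (m + 1)) \<and>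
     fps_ddx (fps_ddx c)
     + fps_ddx c * (fps_const (m / (B * (m + 1))) + fps_const ((4 * m - 3) / (m + 1)) * fps_X)
     + c * (fps_const ((m - 1) * (m - 2) / (m + 1)\<^sup>2) * fps_X\<^sup>2)
     + fps_const (m / (B * (m + 1))) * fps_ddx c * (inverse (1 + c) - 1)
     + (fps_ddx c)\<^sup>2 * inverse (1 + c)
     + fps_const ((m - 1) * (m - 2) / (m + 1)\<^sup>2) * fps_X\<^sup>2 = 0"

text \<open>
  The admissible choices of \<open>x \<mapsto> \<theta>(x, m, B)\<close>. The formal series does not determine \<open>\<theta>\<close>:
  different choices differ by exponentially small terms.
\<close>

definition theta_function :: "real \<Rightarrow> real \<Rightarrow> (real \<Rightarrow> real) \<Rightarrow> bool" where
  "theta_function m B \<theta> \<longleftrightarrow>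
     (\<forall>\<^sub>F x in at_top. \<theta> differentiable (at x) \<and> deriv \<theta> differentiable (at x) \<and>
        theta_equation_at m B \<theta> x) \<and>
     (\<theta> \<longlongrightarrow> 0) at_top \<and> (deriv \<theta> \<longlongrightarrow> 0) at_top \<and>
     (\<exists>c. theta_formal_solution m B c \<and>
        (\<forall>N. (\<lambda>x. \<theta> x - (\<Sum>k=1..N. fps_nth c k / x ^ k)) \<in> o[at_top](\<lambda>x. 1 / x ^ N))) \<and>
     (m = 1 \<or> m = 2 \<longrightarrow> (\<forall>x. \<theta> x = 0))"

text \<open>
  Linearising \<open>d/d\<Phi> (f f' + \<Phi> f) = (2m-1)/m f\<close> about \<open>B \<Phi>\<^bsup>(m-1)/m\<^esup> (1 + \<theta>)\<close> gives the
  decaying perturbation \<open>w \<sim> D \<Phi>\<^bsup>\<kappa>\<^esup> exp (- m/(B(m+1)) \<Phi>\<^bsup>(m+1)/m\<^esup>)\<close> of \<open>f\<close> with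
  \<open>\<kappa> = (m-1)(m-2)/(m(m+1)) - 1 - 2(m-1)/m\<close>, which is the number below. So \<open>\<kappa>\<close> is the exponent
  of the absolute correction to \<open>f\<close>; the correction relative to \<open>B \<Phi>\<^bsup>(m-1)/m\<^esup>\<close> has the
  exponent \<open>\<kappa> - (m-1)/m\<close>.
\<close>

definition kappa1 :: "real \<Rightarrow> real" where
  "kappa1 m = - (2 * m\<^sup>2 + 4 * m - 4) / (m * (m + 1))"

end

theory Submission
  imports Defs "HOL-Real_Asymp.Real_Asymp"
begin

text \<open>
  Put \<open>h = \<Phi>'\<close>, \<open>V = h' + \<Phi> h\<close>, \<open>P' = \<Phi>\<close>. Then \<open>V' = (2 m - 1) / m h\<^sup>2\<close> gives \<open>V > 0\<close>, so
  \<open>h exp P\<close> is increasing. A negative value of \<open>h\<close> would persist for ever, and a Gronwall estimate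
  keeps \<open>h exp P\<close> away from \<open>0\<close> at \<open>- \<infinity>\<close>; hence \<open>h > 0\<close> and \<open>h' / h \<rightarrow> a\<close>, and
  \<open>f = h \<circ> \<Phi>\<^bsup>-1\<^esup>\<close> is a global solution of the Cauchy problem.
  The singular Cauchy problem has a unique solution by a contraction at \<open>- a\<close>, so the convergent power
  series, whose coefficients satisfy the recursion of \<open>\<chi>\<close>, is \<open>f\<close>.
  For large \<open>\<Phi>\<close> the difference of the squares of \<open>f\<close> and of
  \<open>B \<Phi>\<^bsup>(m-1)/m\<^esup> (1 + \<theta>)\<close> solves a linear second-order equation with an algebraic and an exponentially
  decaying mode. The first one would change the leading coefficient \<open>B\<close>, so only the second one is present, and
  its logarithmic derivative is known up to \<open>O(1 / \<Phi>\<^sup>2)\<close>.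
\<close>

section \<open>The trajectory\<close>

text \<open>Squares are compared because \<open>f f'\<close> is the derivative of half the square of
  \<open>f\<close>. With \<open>u\<close> half the difference of the squares of two solutions,
  \<open>W\<close> the difference itself and \<open>Q\<close> the difference of the brackets, one
  has exactly \<open>u' = Q - y W\<close> and \<open>Q' = c W\<close> with
  \<open>c = (2 m - 1) / m\<close>; nonlinearity survives only in the factor of
  \<open>u = W (f + g) / 2\<close>. These identities serve both at the singular point and at
  infinity. The decay hypotheses hold for each \<epsilon> below \<open>a\<close>, so on their face
  they allow \<open>h\<close> to be far smaller than \<open>exp (a t)\<close>, while the proof that
  \<open>h1 / h\<close> tends to \<open>a\<close> divides by that size; hence the lower bound on
  \<open>h exp P\<close>. At infinity \<open>Q'\<close> contains the fast rate \<mu>; passing to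
  \<open>R = Q + c u / y\<close> removes it. The exponent of the correction comes from the first
  coefficient \<open>T\<close> of \<theta>: it shifts the rate by a multiple of
  \<open>1 / y\<close>, which integrates to a power of \<open>y\<close>.\<close>

text \<open>The limit along \<open>F\<close> plays the part of an initial value, so no integrability
  has to be shown. \<open>F\<close> and \<open>A\<close> stay general: \<open>at_bot\<close> with
  \<open>UNIV\<close> serves the trajectory, \<open>at_right \<alpha>\<close> with
  \<open>{\<alpha><..}\<close> the singular endpoint.\<close>

lemma limit_le_of_deriv_nonneg:
  fixes g g' :: "real \<Rightarrow> real"
  assumes lim: "(g \<longlongrightarrow> l) F" and F: "F \<noteq> bot" and ev: "\<forall>\<^sub>F s in F. s \<in> A \<and> s < T"
    and A: "is_interval A" "T \<in> A"
    and der: "\<And>s. s \<in> A \<Longrightarrow> s \<le> T \<Longrightarrow> (g has_real_derivative g' s) (at s)"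
    and nonneg: "\<And>s. s \<in> A \<Longrightarrow> s < T \<Longrightarrow> 0 \<le> g' s"
  shows "l \<le> g T"
proof -
  have "g s \<le> g T" if s: "s \<in> A" "s < T" for s
  proof (rule DERIV_nonneg_imp_increasing_open[OF less_imp_le[OF s(2)]])
    have in_A: "x \<in> A" if "s \<le> x" "x \<le> T" for x
      by (rule mem_is_interval_1_I[OF A(1) s(1) A(2) that])
    show "\<exists>y. DERIV g x :> y \<and> 0 \<le> y" if "s < x" "x < T" for x
      using der[OF in_A] nonneg[OF in_A] that by (intro exI[of _ "g' x"]) simp
    show "continuous_on {s..T} g"
      using DERIV_isCont[OF der[OF in_A]] by (intro continuous_at_imp_continuous_on) simp
  qed
  then have "\<forall>\<^sub>F s in F. g s \<le> g T" using ev by (auto elim: eventually_mono)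
  then show ?thesis by (rule tendsto_upperbound[OF lim _ F])
qed

text \<open>A limit preserves only weak inequalities; strictness is gained on a last piece,
  \<open>l \<le> g S < g T\<close>.\<close>

lemma limit_less_of_deriv_pos:
  fixes g g' :: "real \<Rightarrow> real"
  assumes lim: "(g \<longlongrightarrow> l) F" and F: "F \<noteq> bot" and ev: "\<And>S. S \<in> A \<Longrightarrow> \<forall>\<^sub>F s in F. s \<in> A \<and> s < S"
    and A: "is_interval A" "T \<in> A"
    and der: "\<And>s. s \<in> A \<Longrightarrow> s \<le> T \<Longrightarrow> (g has_real_derivative g' s) (at s)"
    and pos: "\<And>s. s \<in> A \<Longrightarrow> s < T \<Longrightarrow> 0 < g' s"
  shows "l < g T"
proof -
  obtain S where S: "S \<in> A" "S < T"
    using eventually_happens'[OF F ev[OF A(2)]] by blast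
  have "l \<le> g S"
  proof (rule limit_le_of_deriv_nonneg[OF lim F ev[OF S(1)] A(1) S(1), of g'])
    fix s assume s: "s \<in> A"
    show "(g has_real_derivative g' s) (at s)" if "s \<le> S" using der[OF s] S(2) that by simp
    show "0 \<le> g' s" if "s < S" using pos[OF s] S(2) that by simp
  qed
  also have "g S < g T"
  proof (rule DERIV_pos_imp_increasing_open[OF S(2)])
    have in_A: "x \<in> A" if "S \<le> x" "x \<le> T" for x
      by (rule mem_is_interval_1_I[OF A(1) S(1) A(2) that])
    show "\<exists>y. DERIV g x :> y \<and> 0 < y" if "S < x" "x < T" for x
      using der[OF in_A] pos[OF in_A] that by (intro exI[of _ "g' x"]) simp
    show "continuous_on {S..T} g"
      using DERIV_isCont[OF der[OF in_A]] by (intro continuous_at_imp_continuous_on) simp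
  qed
  finally show ?thesis .
qed

lemmas at_bot_le = limit_le_of_deriv_nonneg[where F = at_bot and A = UNIV, simplified]
lemmas at_bot_less = limit_less_of_deriv_pos[where F = at_bot and A = UNIV, simplified]

lemma at_bot_greater:
  fixes g g' :: "real \<Rightarrow> real"
  assumes "(g \<longlongrightarrow> l) at_bot" "\<And>s. s \<le> T \<Longrightarrow> (g has_real_derivative g' s) (at s)" "\<And>s. s < T \<Longrightarrow> g' s < 0"
  shows "g T < l"
  using at_bot_less[of "\<lambda>s. - g s" "- l" T "\<lambda>s. - g' s"] assms by (auto intro: tendsto_minus DERIV_minus)

text \<open>Continuous induction: the infimum of the closed set where \<open>0 \<le> g\<close> would
  be a first exit time. In \<open>step\<close> the whole past of \<open>T\<close> is available, so
  that integrations from - \<infinity> can be carried out there.\<close>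

lemma first_exit:
  fixes g :: "real \<Rightarrow> real"
  assumes cont: "continuous_on UNIV g" and neg: "\<And>s. s \<le> T0 \<Longrightarrow> g s < 0"
    and step: "\<And>T. T0 < T \<Longrightarrow> (\<And>s. s < T \<Longrightarrow> g s < 0) \<Longrightarrow> g T < 0"
  shows "g t < 0"
proof (rule ccontr)
  assume t: "\<not> g t < 0"
  let ?S = "{s. 0 \<le> g s}"
  have cl: "closed ?S" using cont by (intro closed_Collect_le) auto
  have bb: "bdd_below ?S"
    by (rule bdd_belowI[of _ T0]) (metis linorder_not_le mem_Collect_eq neg order.asym not_le)
  have ne: "?S \<noteq> {}" using t by (auto simp: not_less)
  have I: "Inf ?S \<in> ?S" using closed_contains_Inf[OF ne bb cl] .
  have less: "g s < 0" if "s < Inf ?S" for s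
    using cInf_lower[OF _ bb, of s] that by (force simp: not_less)
  have "T0 < Inf ?S" using I neg[of "Inf ?S"] by (force simp: not_less)
  from step[OF this less] I show False by auto
qed

lemma exp_times_at_bot: "0 < e \<Longrightarrow> ((\<lambda>t::real. exp (e * t)) \<longlongrightarrow> 0) at_bot"
  by (rule filterlim_compose[OF exp_at_bot]) (simp add: filterlim_tendsto_pos_mult_at_bot[OF tendsto_const _ filterlim_ident])

section \<open>The trajectory near - \<infinity>: decay rates and the integrating factor\<close>

locale trajectory =
  fixes m b a :: real and \<Phi> :: "real \<Rightarrow> real"
  assumes m: "1 / 2 < m" and b: "0 < b" and a: "0 < a" and sol: "trajectory_solution m b a \<Phi>"
begin

text \<open>Both the exponent in the growth of \<open>f\<close> and the coefficient in
  \<open>h1' = \<beta> h^2 - \<Phi> h1\<close>. The hypothesis on \<open>m\<close> gives - 1 <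
  \<beta> < 1: positivity of \<open>1 + \<beta>\<close> drives \<open>V\<close>, positivity of
  \<open>1 - \<beta>\<close> the sign arguments.\<close>

definition \<beta> :: real where "\<beta> = (m - 1) / m"

definition h :: "real \<Rightarrow> real" where "h = deriv \<Phi>"

definition h1 :: "real \<Rightarrow> real" where "h1 = deriv h"

definition V :: "real \<Rightarrow> real" where "V t = h1 t + \<Phi> t * h t"

lemma m_pos: "0 < m" using m by simp

lemma beta: "\<beta> < 1" "- 1 < \<beta>" "(2 * m - 1) / m = 1 + \<beta>" "1 / m = 1 - \<beta>" "(m + 1) / m = 2 - \<beta>"
  using m by (auto simp: \<beta>_def field_simps)

lemma Phi_0: "\<Phi> 0 = 0"
  using sol unfolding trajectory_solution_def by blast

lemma dPhi [derivative_intros]: "(\<Phi> has_real_derivative h t) (at t)"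
  using sol unfolding trajectory_solution_def h_def by (metis DERIV_deriv_iff_real_differentiable)

lemma dh [derivative_intros]: "(h has_real_derivative h1 t) (at t)"
  using sol unfolding trajectory_solution_def h_def h1_def by (metis DERIV_deriv_iff_real_differentiable)

lemma dV [derivative_intros]: "(V has_real_derivative (1 + \<beta>) * (h t)\<^sup>2) (at t)"
proof -
  have "V = (\<lambda>t. deriv (deriv \<Phi>) t + \<Phi> t * deriv \<Phi> t)" by (auto simp: V_def h1_def h_def)
  then show ?thesis using sol unfolding trajectory_solution_def by (simp add: beta h_def)
qed

lemma dh1 [derivative_intros]: "(h1 has_real_derivative \<beta> * (h t)\<^sup>2 - \<Phi> t * h1 t) (at t)"
proof -
  have eq: "h1 = (\<lambda>t. V t - \<Phi> t * h t)" by (auto simp: V_def)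
  have "((\<lambda>t. V t - \<Phi> t * h t) has_real_derivative (1 + \<beta>) * (h t)\<^sup>2 - (h t * h t + h1 t * \<Phi> t)) (at t)"
    by (auto intro!: derivative_eq_intros)
  then show ?thesis by (simp add: eq[symmetric] algebra_simps power2_eq_square)
qed

lemma continuous [continuous_intros]:
  "continuous_on A \<Phi>" "continuous_on A h" "continuous_on A h1" "continuous_on A V"
  by (meson DERIV_continuous_on has_field_derivative_at_within dPhi dh dh1 dV)+

lemma decay:
  assumes "0 < e" "e < a"
  shows "((\<lambda>t. exp (- e * t) * (\<Phi> t + a)) \<longlongrightarrow> 0) at_bot"
    "((\<lambda>t. exp (- e * t) * h t) \<longlongrightarrow> 0) at_bot"
    "((\<lambda>t. exp (- e * t) * h1 t) \<longlongrightarrow> 0) at_bot"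
  using sol assms unfolding trajectory_solution_def h_def h1_def by blast+

text \<open>The rate \<open>3 * a / 4\<close> lies below \<open>a\<close>, so that the decay
  hypothesis applies, and above \<open>a / 2\<close>, so that the square of \<open>h\<close> decays
  faster than \<open>exp (a t)\<close>, the size that \<open>h\<close> itself turns out to
  have.\<close>

lemma decay_bound:
  obtains T where "\<And>t. t \<le> T \<Longrightarrow> \<bar>\<Phi> t + a\<bar> \<le> exp (3 * a / 4 * t)"
    "\<And>t. t \<le> T \<Longrightarrow> \<bar>h t\<bar> \<le> exp (3 * a / 4 * t)"
proof -
  have e: "0 < 3 * a / 4" "3 * a / 4 < a" using a by auto
  have *: "\<bar>x\<bar> \<le> exp (3 * a / 4 * t)" if "\<bar>exp (- (3 * a / 4) * t) * x\<bar> < 1" for x t :: real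
    using that by (simp add: abs_mult exp_minus field_simps)
  have "\<forall>\<^sub>F t in at_bot. \<bar>exp (- (3 * a / 4) * t) * (\<Phi> t + a)\<bar> < 1 \<and> \<bar>exp (- (3 * a / 4) * t) * h t\<bar> < 1"
    using decay[OF e, THEN tendstoD, of 1] by (auto simp: dist_real_def intro!: eventually_conj)
  then obtain T where "\<And>t. t \<le> T \<Longrightarrow> \<bar>exp (- (3 * a / 4) * t) * (\<Phi> t + a)\<bar> < 1 \<and> \<bar>exp (- (3 * a / 4) * t) * h t\<bar> < 1" by (auto simp: eventually_at_bot_linorder)
  then show ?thesis using * that by meson
qed

lemma lims_at_bot: "(\<Phi> \<longlongrightarrow> - a) at_bot" "(h \<longlongrightarrow> 0) at_bot" "(h1 \<longlongrightarrow> 0) at_bot" "(V \<longlongrightarrow> 0) at_bot"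
proof -
  have e: "0 < a / 2" "a / 2 < a" using a by auto
  have *: "exp (a / 2 * t) * (exp (- (a / 2) * t) * x) = x" for t x :: real
    by (simp add: exp_minus)
  note l = decay[OF e, THEN tendsto_mult[OF exp_times_at_bot[OF e(1)]], unfolded *]
  show 1: "(\<Phi> \<longlongrightarrow> - a) at_bot" using tendsto_diff[OF l(1) tendsto_const[of a]] by simp
  show 2: "(h \<longlongrightarrow> 0) at_bot" and 3: "(h1 \<longlongrightarrow> 0) at_bot" using l by auto
  show "(V \<longlongrightarrow> 0) at_bot" unfolding V_def using tendsto_add[OF 3 tendsto_mult[OF 1 2]] by simp
qed

lemma V_nonneg: "0 \<le> V t"
  by (rule at_bot_le[OF lims_at_bot(4) dV]) (use beta in auto)

text \<open>The constant of integration is left open: changing it multiplies \<open>k\<close> by a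
  positive factor, which affects no sign or limit argument.\<close>

definition P :: "real \<Rightarrow> real" where "P = (SOME P. \<forall>t. (P has_real_derivative \<Phi> t) (at t))"

lemma dP [derivative_intros]: "(P has_real_derivative \<Phi> t) (at t)"
proof -
  have "\<exists>P. \<forall>t::real. -\<infinity> < ereal t \<longrightarrow> t < \<infinity> \<longrightarrow> (P has_vector_derivative \<Phi> t) (at t)"
    by (rule einterval_antiderivative) (auto intro: DERIV_isCont[OF dPhi])
  then have "\<exists>P. \<forall>t. (P has_real_derivative \<Phi> t) (at t)"
    by (auto simp: has_real_derivative_iff_has_vector_derivative)
  from someI_ex[OF this] show ?thesis unfolding P_def by blast
qed

text \<open>The derivative \<Phi> + a is integrable at - \<infinity>: \<open>?e\<close> is the
  integral of its majorant, and \<open>?e + ?g\<close> and \<open>?e - ?g\<close> are nondecreasing.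
  Hence \<open>exp P\<close> may be replaced by \<open>exp (- a t)\<close> up to constants.\<close>

lemma P_bound:
  obtains C where "\<And>t. t \<le> T \<Longrightarrow> \<bar>P t + a * t\<bar> \<le> C"
proof -
  obtain T1 where T1: "\<And>t. t \<le> T1 \<Longrightarrow> \<bar>\<Phi> t + a\<bar> \<le> exp (3 * a / 4 * t)" by (rule decay_bound) blast
  let ?g = "\<lambda>t. P t + a * t" and ?e = "\<lambda>t. 4 / (3 * a) * exp (3 * a / 4 * t)"
  have bd: "\<bar>?g t\<bar> \<le> \<bar>?g T1\<bar> + ?e T1" if t: "t \<le> T1" for t
  proof -
    have "?g t + ?e t \<le> ?g T1 + ?e T1"
      by (rule DERIV_nonneg_imp_nondecreasing[OF t])
         (use T1 a in \<open>force intro!: derivative_eq_intros exI simp: abs_le_iff\<close>)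
    moreover have "?e t - ?g t \<le> ?e T1 - ?g T1"
      by (rule DERIV_nonneg_imp_nondecreasing[OF t])
         (use T1 a in \<open>force intro!: derivative_eq_intros exI simp: abs_le_iff\<close>)
    moreover have "0 \<le> ?e t" using a by auto
    ultimately show ?thesis by linarith
  qed
  have "continuous_on {T1..T} ?g"
    by (rule DERIV_continuous_on[where D = "\<lambda>t. \<Phi> t + a"]) (auto intro!: derivative_eq_intros has_field_derivative_at_within[OF dP])
  then have "bounded (?g ` {T1..T})" by (intro compact_imp_bounded compact_continuous_image) auto
  then obtain D where D: "\<And>t. T1 \<le> t \<Longrightarrow> t \<le> T \<Longrightarrow> \<bar>?g t\<bar> \<le> D" by (force simp: bounded_iff)
  show ?thesis
    by (rule that[of "max (\<bar>?g T1\<bar> + ?e T1) D"]) (metis D bd le_max_iff_disj linear)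
qed

text \<open>Integrating \<open>V' = (1 + \<beta>) h^2\<close> from - \<infinity> doubles the rate of
  \<open>h\<close> and so passes \<open>a\<close>; this makes \<open>V\<close> negligible against
  \<open>h\<close>.\<close>

lemma V_bound:
  obtains K T where "\<And>t. t \<le> T \<Longrightarrow> V t \<le> K * exp (3 / 2 * a * t)"
proof -
  obtain T where T: "\<And>t. t \<le> T \<Longrightarrow> \<bar>h t\<bar> \<le> exp (3 * a / 4 * t)" by (rule decay_bound) blast
  let ?K = "(1 + \<beta>) * (2 / (3 * a))"
  have "V t \<le> ?K * exp (3 / 2 * a * t)" if t: "t \<le> T" for t
  proof -
    have "0 \<le> ?K * exp (3 / 2 * a * t) - V t"
    proof (rule at_bot_le[where g = "\<lambda>t. ?K * exp (3 / 2 * a * t) - V t"])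
      show "((\<lambda>t. ?K * exp (3 / 2 * a * t) - V t) \<longlongrightarrow> 0) at_bot"
        using tendsto_diff[OF tendsto_mult[OF tendsto_const[of ?K] exp_times_at_bot[of "3 / 2 * a"]] lims_at_bot(4)] a by simp
      show "((\<lambda>t. ?K * exp (3 / 2 * a * t) - V t) has_real_derivative
          (1 + \<beta>) * (exp (3 / 2 * a * s) - (h s)\<^sup>2)) (at s)" for s
        using a by (auto intro!: derivative_eq_intros simp: field_simps)
      show "0 \<le> (1 + \<beta>) * (exp (3 / 2 * a * s) - (h s)\<^sup>2)" if "s < t" for s
      proof -
        have "(h s)\<^sup>2 \<le> (exp (3 * a / 4 * s))\<^sup>2" using T[of s] that t abs_le_square_iff by fastforce
        also have "\<dots> = exp (3 / 2 * a * s)" by (simp flip: exp_double)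
        finally show ?thesis using beta by simp
      qed
    qed
    then show ?thesis by simp
  qed
  then show ?thesis using that by blast
qed

definition k :: "real \<Rightarrow> real" where "k t = h t * exp (P t)"

lemma dk: "(k has_real_derivative V t * exp (P t)) (at t)"
proof -
  have eq: "k = (\<lambda>t. h t * exp (P t))" by (auto simp: k_def)
  show ?thesis by (subst eq) (auto intro!: derivative_eq_intros simp: V_def algebra_simps)
qed

lemma k_mono: "s \<le> t \<Longrightarrow> k s \<le> k t"
  by (rule DERIV_nonneg_imp_nondecreasing) (use dk V_nonneg in \<open>auto intro!: exI\<close>)

lemma h_k: "h t = k t * exp (- P t)" by (simp add: k_def exp_minus)

lemma exp_P_lower:
  obtains C where "0 < C" "\<And>t. t \<le> T \<Longrightarrow> C * exp (a * t) \<le> exp (- P t)"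
    "\<And>t. t \<le> T \<Longrightarrow> exp (- P t) \<le> exp (a * t) / C" "\<And>t. t \<le> T \<Longrightarrow> exp (P t) \<le> exp (- a * t) / C"
proof -
  obtain C where C: "\<And>t. t \<le> T \<Longrightarrow> \<bar>P t + a * t\<bar> \<le> C" by (rule P_bound[of T]) blast
  show ?thesis
  proof (rule that[of "exp (- C)"])
    fix t assume "t \<le> T"
    from C[OF this] show "exp (- C) * exp (a * t) \<le> exp (- P t)"
      "exp (- P t) \<le> exp (a * t) / exp (- C)" "exp (P t) \<le> exp (- a * t) / exp (- C)"
      by (auto simp flip: exp_add exp_diff)
  qed auto
qed

text \<open>\<open>h1 / h = V / h - \<Phi>\<close>, and the numerator \<open>V\<close> has rate
  \<open>3 / 2 * a\<close> while \<open>h\<close> is at least of order \<open>exp (a t)\<close>. The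
  hypothesis bounds the absolute value of \<open>k\<close>, because the lemma is applied to a
  hypothetical negative \<open>h\<close> as well as to the positive one.\<close>

lemma ratio_limit:
  assumes d: "0 < d" and T: "\<And>t. t \<le> T \<Longrightarrow> d \<le> \<bar>k t\<bar>"
  shows "((\<lambda>t. h1 t / h t) \<longlongrightarrow> a) at_bot"
proof -
  obtain K T1 where K: "\<And>t. t \<le> T1 \<Longrightarrow> V t \<le> K * exp (3 / 2 * a * t)" by (rule V_bound) blast
  obtain C where C: "0 < C" "\<And>t. t \<le> T \<Longrightarrow> C * exp (a * t) \<le> exp (- P t)" by (rule exp_P_lower[of T]) blast
  have lower: "d * C * exp (a * t) \<le> \<bar>h t\<bar>" if "t \<le> T" for t
    unfolding h_k abs_mult using mult_mono[OF T[OF that] C(2)[OF that]] d C by (auto simp: mult.assoc)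
  have h0: "h t \<noteq> 0" if "t \<le> T" for t
    using lower[OF that] C(1) d by (metis abs_zero exp_gt_zero linorder_not_le mult_pos_pos)
  have "((\<lambda>t. V t / h t) \<longlongrightarrow> 0) at_bot"
  proof (rule Lim_null_comparison)
    show "((\<lambda>t. K / (d * C) * exp (a / 2 * t)) \<longlongrightarrow> 0) at_bot"
      using tendsto_mult[OF tendsto_const exp_times_at_bot, of "a / 2" "K / (d * C)"] a by simp
    have "norm (V t / h t) \<le> K / (d * C) * exp (a / 2 * t)" if t: "t \<le> T" "t \<le> T1" for t
    proof -
      have "norm (V t / h t) = V t / \<bar>h t\<bar>" using V_nonneg by simp
      also have "\<dots> \<le> K * exp (3 / 2 * a * t) / (d * C * exp (a * t))"
        by (rule frac_le) (use K lower V_nonneg d C t order_trans[OF V_nonneg K[OF t(2)]] in auto)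
      also have "exp (3 / 2 * a * t) = exp (a / 2 * t) * exp (a * t)"
        by (simp add: field_simps flip: exp_add)
      also have "K * (exp (a / 2 * t) * exp (a * t)) / (d * C * exp (a * t)) = K / (d * C) * exp (a / 2 * t)"
        by simp
      finally show ?thesis .
    qed
    then show "\<forall>\<^sub>F t in at_bot. norm (V t / h t) \<le> K / (d * C) * exp (a / 2 * t)"
      unfolding eventually_at_bot_linorder by (metis min.bounded_iff)
  qed
  then have "((\<lambda>t. V t / h t - \<Phi> t) \<longlongrightarrow> a) at_bot" using tendsto_diff[OF _ lims_at_bot(1)] by force
  moreover have "\<forall>\<^sub>F t in at_bot. V t / h t - \<Phi> t = h1 t / h t"
    unfolding eventually_at_bot_linorder V_def using h0 by (intro exI[of _ T]) (simp add: field_simps)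
  ultimately show ?thesis by (rule Lim_transform_eventually)
qed

text \<open>A trajectory leaving \<open>- a\<close> downwards would be decreasing for ever: \<open>N / h\<^sup>2\<close> is the derivative
  of \<open>h1 / h\<close>, and \<open>N exp P\<close> increases from \<open>0\<close> as long as \<open>h1 < 0\<close>.\<close>

lemma k_nonneg: "0 \<le> k t"
proof (rule ccontr)
  assume "\<not> 0 \<le> k t"
  then have kt: "k t < 0" by simp
  have ks: "- k t \<le> \<bar>k s\<bar>" if "s \<le> t" for s using k_mono[OF that] kt by auto
  have hneg: "h s < 0" if "s \<le> t" for s
    unfolding h_k using k_mono[OF that] kt by (auto simp: mult_less_0_iff)
  have "\<forall>\<^sub>F s in at_bot. 0 < h1 s / h s"
    by (rule order_tendstoD(1)[OF ratio_limit[of "- k t" t]]) (use kt ks a in auto)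
  then obtain T0 where T0: "\<And>s. s \<le> T0 \<Longrightarrow> 0 < h1 s / h s" by (auto simp: eventually_at_bot_linorder)
  define T1 where "T1 = min t T0"
  have start: "h1 s < 0" if "s \<le> T1" for s
    using T0[of s] hneg[of s] that by (auto simp: T1_def zero_less_divide_iff)
  let ?h2 = "\<lambda>t. \<beta> * (h t)\<^sup>2 - \<Phi> t * h1 t"
  define N where "N = (\<lambda>t. h t * ?h2 t - (h1 t)\<^sup>2)"
  have dN: "((\<lambda>t. N t * exp (P t)) has_real_derivative - (1 - \<beta>) * (h t)\<^sup>2 * h1 t * exp (P t)) (at t)" for t
    unfolding N_def
    by (auto intro!: derivative_eq_intros) (simp add: algebra_simps power2_eq_square power3_eq_cube)
  have limN: "((\<lambda>t. N t * exp (P t)) \<longlongrightarrow> 0) at_bot"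
  proof -
    have e: "0 < a / 2" "a / 2 < a" using a by auto
    \<comment> \<open>\<open>exp P\<close> is comparable to \<open>exp (- a t)\<close>. As
      \<open>N\<close> is at least quadratic in \<open>h\<close> and \<open>h1\<close>, half of this
      weight can be attached to each of two factors.\<close>
    let ?u = "\<lambda>t. exp (- (a / 2) * t) * h t" and ?v = "\<lambda>t. exp (- (a / 2) * t) * h1 t"
    have "((\<lambda>t. ?u t * (\<beta> * (h t * ?u t) - \<Phi> t * ?v t) - (?v t)\<^sup>2) \<longlongrightarrow>
        0 * (\<beta> * (0 * 0) - (- a) * 0) - 0\<^sup>2) at_bot"
      by (intro tendsto_intros lims_at_bot decay[OF e])
    then have l: "((\<lambda>t. ?u t * (\<beta> * (h t * ?u t) - \<Phi> t * ?v t) - (?v t)\<^sup>2) \<longlongrightarrow> 0) at_bot" by simp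
    have eq: "?u t * (\<beta> * (h t * ?u t) - \<Phi> t * ?v t) - (?v t)\<^sup>2 = N t * exp (- a * t)" for t
    proof -
      have "exp (- a * t) = exp (- (a / 2) * t) * exp (- (a / 2) * t)" by (simp flip: exp_add)
      then show ?thesis unfolding N_def by (simp only:) (simp add: algebra_simps power2_eq_square)
    qed
    obtain C where C: "0 < C" "\<And>t. t \<le> 0 \<Longrightarrow> exp (P t) \<le> exp (- a * t) / C" by (rule exp_P_lower[of 0]) blast
    show ?thesis
    proof (rule Lim_null_comparison)
      show "((\<lambda>t. norm (N t * exp (- a * t)) / C) \<longlongrightarrow> 0) at_bot"
        using tendsto_divide[OF tendsto_norm_zero[OF l[unfolded eq]] tendsto_const[of C]] C by simp
      show "\<forall>\<^sub>F t in at_bot. norm (N t * exp (P t)) \<le> norm (N t * exp (- a * t)) / C"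
        unfolding eventually_at_bot_linorder
        by (intro exI[of _ 0]) (use mult_left_mono[OF C(2) abs_ge_zero] in \<open>auto simp: abs_mult\<close>)
    qed
  qed
  have h1neg: "h1 s < 0" for s
  proof (rule first_exit[OF _ start])
    show "continuous_on UNIV h1" by (rule continuous)
    \<comment> \<open>If \<open>h1\<close> is negative before \<open>T\<close>, then
      \<open>h\<close> is negative and \<open>N\<close> nonnegative up to \<open>T\<close>, so
      \<open>h1 / h\<close> cannot fall below its positive value at \<open>T1\<close>, and the sign
      of \<open>h1\<close> persists at \<open>T\<close>.\<close>
    fix T assume T: "T1 < T" and neg: "\<And>s. s < T \<Longrightarrow> h1 s < 0"
    have h: "h s < 0" if "s \<le> T" for s
      by (rule at_bot_greater[OF lims_at_bot(2) dh]) (use neg that in auto)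
    have "0 \<le> N s" if "s \<le> T" for s
    proof -
      have "0 \<le> N s * exp (P s)"
      proof (rule at_bot_le[OF limN dN])
        fix r assume "r < s"
        then have "0 \<le> (1 - \<beta>) * (h r)\<^sup>2 * (- h1 r) * exp (P r)"
          using neg[of r] that beta by (intro mult_nonneg_nonneg) auto
        then show "0 \<le> - (1 - \<beta>) * (h r)\<^sup>2 * h1 r * exp (P r)" by (simp add: algebra_simps)
      qed
      then show ?thesis by (simp add: zero_le_mult_iff)
    qed
    note N0 = this
    have "h1 T1 / h T1 \<le> h1 T / h T"
    proof (rule DERIV_nonneg_imp_nondecreasing[OF less_imp_le[OF T]])
      fix s assume s: "T1 \<le> s" "s \<le> T"
      have "((\<lambda>s. h1 s / h s) has_real_derivative N s / (h s)\<^sup>2) (at s)"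
        using h[OF s(2)] by (auto intro!: derivative_eq_intros simp: N_def power2_eq_square algebra_simps)
      then show "\<exists>y. ((\<lambda>s. h1 s / h s) has_real_derivative y) (at s) \<and> 0 \<le> y"
        using N0[OF s(2)] by auto
    qed
    moreover have "0 < h1 T1 / h T1" using start[of T1] h[of T1] T by (simp add: divide_neg_neg)
    ultimately have "0 < h1 T / h T" by simp
    then show "h1 T < 0" using h[of T] by (simp add: zero_less_divide_iff)
  qed
  have hn: "h s < 0" for s
    by (rule at_bot_greater[OF lims_at_bot(2) dh h1neg])
  \<comment> \<open>A decreasing \<Phi> that comes from - a stays below it, contrary to the
    normalisation at time 0.\<close>
  have "\<Phi> 0 < - a"
    by (rule at_bot_greater[OF lims_at_bot(1) dPhi hn])
  then show False using a by (simp add: Phi_0)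
qed

text \<open>Since \<open>k\<close> is monotone, \<open>h s \<le> k t * (exp (a * s) / C)\<close>
  before \<open>t\<close>, which bounds \<open>V t\<close> by a multiple of
  \<open>(k t)\<^sup>2 * exp (2 * a * t)\<close> and hence \<open>k'\<close> by
  \<open>K * exp (a * t) * k t\<close>. The coefficient is integrable at - \<infinity>, so going
  back from \<open>T\<close> the function \<open>k\<close> loses at most the factor built into
  \<open>G\<close>. A positive value of \<open>k\<close> exists, because otherwise \<Phi> would
  never rise above - a.\<close>

lemma k_bounded_below:
  obtains T d where "0 < d" "\<And>t. t \<le> T \<Longrightarrow> d \<le> k t"
proof -
  have "\<exists>T. 0 < k T"
  proof (rule ccontr)
    assume "\<not> ?thesis"
    then have "k t \<le> 0" for t by (meson not_less)
    then have h: "0 \<le> - h t" for t by (simp add: h_k mult_le_0_iff)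
    have "- (- a) \<le> - \<Phi> 0"
      by (rule at_bot_le[where g = "\<lambda>t. - \<Phi> t", OF tendsto_minus[OF lims_at_bot(1)] DERIV_minus[OF dPhi] h])
    then show False using a by (simp add: Phi_0)
  qed
  then obtain T where T: "0 < k T" by blast
  obtain C where C: "0 < C" "\<And>t. t \<le> T \<Longrightarrow> exp (- P t) \<le> exp (a * t) / C"
      "\<And>t. t \<le> T \<Longrightarrow> exp (P t) \<le> exp (- a * t) / C"
    by (rule exp_P_lower[of T]) blast
  define K0 where "K0 = (1 + \<beta>) / (2 * a * C\<^sup>2)"
  have K0: "0 < K0" using beta a C by (simp add: K0_def)
  have V: "V t \<le> K0 * (k t)\<^sup>2 * exp (2 * a * t)" if t: "t \<le> T" for t
  proof -
    let ?g = "\<lambda>s. K0 * (k t)\<^sup>2 * exp (2 * a * s) - V s"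
    have "0 \<le> ?g t"
    proof (rule at_bot_le[where g = ?g])
      show "(?g \<longlongrightarrow> 0) at_bot"
        using tendsto_diff[OF tendsto_mult[OF tendsto_const[of "K0 * (k t)\<^sup>2"] exp_times_at_bot[of "2 * a"]] lims_at_bot(4)] a
        by simp
      show "(?g has_real_derivative K0 * (k t)\<^sup>2 * (2 * a * exp (2 * a * s)) - (1 + \<beta>) * (h s)\<^sup>2) (at s)" for s
        by (auto intro!: derivative_eq_intros)
      show "0 \<le> K0 * (k t)\<^sup>2 * (2 * a * exp (2 * a * s)) - (1 + \<beta>) * (h s)\<^sup>2" if s: "s < t" for s
      proof -
        have "h s \<le> k t * (exp (a * s) / C)"
          unfolding h_k by (rule mult_mono) (use k_mono[of s t] k_nonneg C s t in auto)
        moreover have "0 \<le> h s" unfolding h_k using k_nonneg by simp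
        ultimately have "(h s)\<^sup>2 \<le> (k t * (exp (a * s) / C))\<^sup>2" by simp
        also have "\<dots> = (k t)\<^sup>2 * exp (2 * a * s) / C\<^sup>2"
          by (simp add: power_mult_distrib power_divide mult.assoc flip: exp_double)
        finally have "(1 + \<beta>) * (h s)\<^sup>2 \<le> (1 + \<beta>) * ((k t)\<^sup>2 * exp (2 * a * s) / C\<^sup>2)"
          using beta by (intro mult_left_mono) auto
        also have "\<dots> = K0 * (k t)\<^sup>2 * (2 * a * exp (2 * a * s))"
          using a C by (simp add: K0_def field_simps)
        finally show ?thesis by simp
      qed
    qed
    then show ?thesis by simp
  qed
  \<comment> \<open>The inequality for \<open>k'\<close> is quadratic in \<open>k\<close>; bounding
    one factor by \<open>k T\<close> makes it linear.\<close>
  define K where "K = K0 / C * k T"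
  have K: "0 < K" using K0 C T by (simp add: K_def)
  have k': "V t * exp (P t) \<le> K * exp (a * t) * k t" if t: "t \<le> T" for t
  proof -
    have "V t * exp (P t) \<le> K0 * (k t)\<^sup>2 * exp (2 * a * t) * (exp (- a * t) / C)"
      by (rule mult_mono[OF V[OF t] C(3)[OF t]]) (use K0 in auto)
    also have "\<dots> = K0 / C * k t * ((exp (2 * a * t) * exp (- a * t)) * k t)"
      by (simp add: power2_eq_square)
    also have "exp (2 * a * t) * exp (- a * t) = exp (a * t)"
      by (simp flip: exp_add)
    also have "K0 / C * k t * (exp (a * t) * k t) \<le> K * (exp (a * t) * k t)"
      unfolding K_def using k_mono[OF t] k_nonneg K0 C by (intro mult_right_mono mult_left_mono) auto
    finally show ?thesis by (simp add: mult.assoc)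
  qed
  define G where "G = (\<lambda>t. k t * exp (- (K / a) * exp (a * t)))"
  have dG: "(G has_real_derivative (V t * exp (P t) - K * exp (a * t) * k t) * exp (- (K / a) * exp (a * t))) (at t)" for t
    unfolding G_def using a by (auto intro!: derivative_eq_intros dk simp: algebra_simps)
  show ?thesis
  proof (rule that[of "G T" T])
    show "0 < G T" using T by (simp add: G_def)
    fix t assume t: "t \<le> T"
    have "G T \<le> G t"
    proof (rule DERIV_nonpos_imp_nonincreasing[OF t])
      show "\<exists>y. DERIV G x :> y \<and> y \<le> 0" if "x \<le> T" for x
        using dG[of x] k'[OF that] by (auto simp: mult_le_0_iff)
    qed
    also have "G t \<le> k t * 1"
      unfolding G_def using k_nonneg[of t] K a by (intro mult_left_mono) auto
    finally show "G T \<le> k t" by simp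
  qed
qed

section \<open>Positivity of \<open>h\<close> and its bounds in terms of \<Phi>\<close>

lemma h_pos: "0 < h t"
proof -
  obtain T d where T: "0 < d" "\<And>t. t \<le> T \<Longrightarrow> d \<le> k t" by (rule k_bounded_below) blast
  have "0 < k t" using T(2)[of "min t T"] k_mono[of "min t T" t] T(1) by simp
  then show ?thesis by (simp add: h_k)
qed

lemma h1_over_h: "((\<lambda>t. h1 t / h t) \<longlongrightarrow> a) at_bot"
proof -
  obtain T d where T: "0 < d" "\<And>t. t \<le> T \<Longrightarrow> d \<le> k t" by (rule k_bounded_below) blast
  then show ?thesis by (intro ratio_limit[of d T]) force+
qed

lemma Phi_greater: "- a < \<Phi> t"
  by (rule at_bot_less[OF lims_at_bot(1) dPhi h_pos])

lemma V_pos: "0 < V t"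
proof (rule at_bot_less[OF lims_at_bot(4) dV])
  show "0 < (1 + \<beta>) * (h s)\<^sup>2" for s using beta h_pos[of s] by simp
qed

text \<open>\<open>V\<close> is the derivative of \<open>h + \<Phi>^2 / 2\<close>, which starts from
  \<open>a^2 / 2\<close> at - \<infinity>.\<close>

lemma h_lower: "(a\<^sup>2 - (\<Phi> t)\<^sup>2) / 2 < h t"
proof -
  have "(- a)\<^sup>2 / 2 < h t + (\<Phi> t)\<^sup>2 / 2"
  proof (rule at_bot_less[where g = "\<lambda>t. h t + (\<Phi> t)\<^sup>2 / 2" and T = t])
    show "((\<lambda>t. h t + (\<Phi> t)\<^sup>2 / 2) \<longlongrightarrow> (- a)\<^sup>2 / 2) at_bot"
      by (auto intro!: tendsto_eq_intros lims_at_bot)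
    show "((\<lambda>t. h t + (\<Phi> t)\<^sup>2 / 2) has_real_derivative V s) (at s)" for s
      by (auto intro!: derivative_eq_intros simp: V_def)
    show "0 < V s" for s by (rule V_pos)
  qed
  then show ?thesis by (simp add: field_simps)
qed

text \<open>The bound follows from \<open>?z < 0\<close>, since \<open>- ?z\<close> is the
  derivative of \<open>a * (\<Phi> t + a) - h t\<close>. With the integrating factor
  \<open>exp (P t + a * t)\<close> the derivative of \<open>?z\<close> gets the sign of
  \<open>?g\<close>, and \<open>?g < 0\<close> follows in turn from the bound because \<beta> < 1.
  \<open>first_exit\<close> closes this circle.\<close>

lemma h_upper: "h t < a * (\<Phi> t + a)"
proof -
  let ?g = "\<lambda>t. \<beta> * h t - a * (\<Phi> t + a)"
  have g_neg: "?g t < 0" if "\<beta> > 0 \<longrightarrow> h t \<le> q * (\<Phi> t + a)" "\<beta> * q \<le> a" "\<beta> > 0 \<longrightarrow> \<beta> * q < a" for t q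
  proof (cases "\<beta> > 0")
    case True
    then have "\<beta> * h t \<le> \<beta> * q * (\<Phi> t + a)" using that by (simp add: mult.assoc)
    also have "\<dots> < a * (\<Phi> t + a)" using that True Phi_greater[of t] by (intro mult_strict_right_mono) auto
    finally show ?thesis by simp
  next
    case False
    then have "\<beta> * h t \<le> 0" using h_pos[of t] by (simp add: mult_le_0_iff)
    also have "0 < a * (\<Phi> t + a)" using a Phi_greater[of t] by simp
    finally show ?thesis by simp
  qed
  \<comment> \<open>To start the argument \<open>q\<close> must exceed the limit \<open>a\<close> of
    \<open>h1 / h\<close> and keep \<open>\<beta> * q\<close> below \<open>a\<close>; this value
    does both because \<beta> < 1.\<close>
  define q where "q = 2 * a / (1 + \<beta>)"
  have q: "a < q" "\<beta> * q < a" using beta a by (auto simp: q_def field_simps)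
  obtain T0 where T0: "\<And>s. s \<le> T0 \<Longrightarrow> h1 s / h s < q"
    using order_tendstoD(2)[OF h1_over_h q(1)] by (auto simp: eventually_at_bot_linorder)
  have start: "?g s < 0" if s: "s \<le> T0" for s
  proof (rule g_neg[of _ q])
    have "0 \<le> q * (\<Phi> s + a) - h s"
    proof (rule at_bot_le[where g = "\<lambda>s. q * (\<Phi> s + a) - h s"])
      show "((\<lambda>s. q * (\<Phi> s + a) - h s) \<longlongrightarrow> 0) at_bot"
        by (auto intro!: tendsto_eq_intros lims_at_bot)
      show "((\<lambda>s. q * (\<Phi> s + a) - h s) has_real_derivative q * h r - h1 r) (at r)" for r
        by (auto intro!: derivative_eq_intros)
      show "0 \<le> q * h r - h1 r" if "r < s" for r
        using T0[of r] h_pos[of r] s that by (simp add: field_simps)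
    qed
    then show "\<beta> > 0 \<longrightarrow> h s \<le> q * (\<Phi> s + a)" by simp
    show "\<beta> * q \<le> a" "\<beta> > 0 \<longrightarrow> \<beta> * q < a" using q by simp_all
  qed
  let ?z = "\<lambda>t. h1 t - a * h t"
  have dz: "((\<lambda>t. ?z t * exp (P t + a * t)) has_real_derivative h t * ?g t * exp (P t + a * t)) (at t)" for t
    by (auto intro!: derivative_eq_intros simp: algebra_simps power2_eq_square)
  have limz: "((\<lambda>t. ?z t * exp (P t + a * t)) \<longlongrightarrow> 0) at_bot"
  proof -
    obtain C where C: "\<And>t. t \<le> 0 \<Longrightarrow> \<bar>P t + a * t\<bar> \<le> C" by (rule P_bound[of 0]) blast
    show ?thesis
    proof (rule Lim_null_comparison)
      show "((\<lambda>t. \<bar>?z t\<bar> * exp C) \<longlongrightarrow> 0) at_bot"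
        by (auto intro!: tendsto_eq_intros lims_at_bot)
      show "\<forall>\<^sub>F t in at_bot. norm (?z t * exp (P t + a * t)) \<le> \<bar>?z t\<bar> * exp C"
        unfolding eventually_at_bot_linorder
        by (intro exI[of _ 0]) (use C in \<open>force simp: abs_mult intro!: mult_left_mono\<close>)
    qed
  qed
  have w: "h t < a * (\<Phi> t + a)" if neg: "\<And>s. s < t \<Longrightarrow> ?g s < 0" for t
  proof -
    have z: "?z s < 0" if "s < t" for s
    proof -
      have "?z s * exp (P s + a * s) < 0"
        by (rule at_bot_greater[OF limz dz]) (use neg that h_pos in \<open>auto simp: mult_less_0_iff\<close>)
      then show ?thesis by (simp add: mult_less_0_iff)
    qed
    have "0 < a * (\<Phi> t + a) - h t"
    proof (rule at_bot_less[where g = "\<lambda>t. a * (\<Phi> t + a) - h t"])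
      show "((\<lambda>t. a * (\<Phi> t + a) - h t) \<longlongrightarrow> 0) at_bot"
        by (auto intro!: tendsto_eq_intros lims_at_bot)
      show "((\<lambda>t. a * (\<Phi> t + a) - h t) has_real_derivative - ?z s) (at s)" for s
        by (auto intro!: derivative_eq_intros)
      show "0 < - ?z s" if "s < t" for s using z[OF that] by simp
    qed
    then show ?thesis by simp
  qed
  have g: "?g t < 0" for t
  proof (rule first_exit[OF _ start])
    show "continuous_on UNIV ?g" by (intro continuous_intros)
    fix T assume "\<And>s. s < T \<Longrightarrow> ?g s < 0"
    then have "h T < a * (\<Phi> T + a)" by (rule w)
    then show "?g T < 0" by (intro g_neg[of _ a]) (use a beta in auto)
  qed
  then show ?thesis by (intro w) auto
qed

section \<open>The inverse of the trajectory and \<open>f\<close> as a function of \<Phi>\<close>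

lemma Phi_strict_mono: "s < t \<Longrightarrow> \<Phi> s < \<Phi> t"
  by (rule DERIV_pos_imp_increasing) (use dPhi h_pos in auto)

lemma inj_Phi: "inj \<Phi>"
  using Phi_strict_mono by (intro linorder_injI) (force dest: less_imp_neq)

lemma Phi_asymp: "((\<lambda>t. \<Phi> t / t powr m) \<longlongrightarrow> b) at_top"
  using sol by (auto simp: trajectory_solution_def)

lemma Phi_at_top: "filterlim \<Phi> at_top at_top"
proof -
  have "filterlim (\<lambda>t. t powr m) at_top at_top" using m_pos by real_asymp
  then have "filterlim (\<lambda>t. \<Phi> t / t powr m * t powr m) at_top at_top"
    by (rule filterlim_tendsto_pos_mult_at_top[OF Phi_asymp b])
  moreover have "\<forall>\<^sub>F t in at_top. \<Phi> t / t powr m * t powr m = \<Phi> t"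
    using eventually_gt_at_top[of "0::real"] by eventually_elim auto
  ultimately show ?thesis by (simp only: filterlim_cong[OF refl refl])
qed

text \<open>\<open>inv\<close> is total, but \<open>\<tau> y\<close> is the time at which
  \<open>y\<close> is reached only on the range \<open>- a < y\<close>.\<close>

definition \<tau> :: "real \<Rightarrow> real" where "\<tau> = inv \<Phi>"

lemma tau_Phi [simp]: "\<tau> (\<Phi> t) = t"
  by (simp add: \<tau>_def inj_Phi)

lemma Phi_tau [simp]:
  assumes "- a < y"
  shows "\<Phi> (\<tau> y) = y"
proof -
  obtain s where s: "\<Phi> s < y"
    using eventually_happens'[OF trivial_limit_at_bot_linorder order_tendstoD(2)[OF lims_at_bot(1) assms]] by blast
  obtain t where t: "y < \<Phi> t"
    using eventually_happens'[OF trivial_limit_at_top_linorder Phi_at_top[unfolded filterlim_at_top_dense, rule_format, of y]]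
    by blast
  have "s \<le> t" using Phi_strict_mono[of t s] s t by force
  then obtain x where "\<Phi> x = y"
    using IVT[of \<Phi> s y t] s t DERIV_isCont[OF dPhi] by force
  then show ?thesis using tau_Phi[of x] by simp
qed

lemma Phi_less_iff: "\<Phi> s < \<Phi> t \<longleftrightarrow> s < t"
  using Phi_strict_mono[of s t] Phi_strict_mono[of t s] by (cases s t rule: linorder_cases) auto

lemma tau_less: "- a < y \<Longrightarrow> y < \<Phi> t \<Longrightarrow> \<tau> y < t"
  using Phi_less_iff[of "\<tau> y" t] by simp

lemma tau_greater: "- a < y \<Longrightarrow> \<Phi> t < y \<Longrightarrow> t < \<tau> y"
  using Phi_less_iff[of t "\<tau> y"] by simp

lemma dtau:
  assumes y: "- a < y"
  shows "(\<tau> has_real_derivative inverse (h (\<tau> y))) (at y)"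
proof (rule DERIV_inverse_function[where a = "- a" and b = "y + 1"])
  show "(\<Phi> has_real_derivative h (\<tau> y)) (at (\<tau> y))" by (rule dPhi)
  have "isCont \<tau> (\<Phi> (\<tau> y))"
    by (rule isCont_inverse_function[of 1]) (auto intro: DERIV_isCont[OF dPhi])
  then show "isCont \<tau> y" using y by simp
  show "h (\<tau> y) \<noteq> 0" using h_pos[of "\<tau> y"] by simp
  show "- a < y" "y < y + 1" using y by simp_all
  show "\<Phi> (\<tau> z) = z" if "- a < z" for z using that by simp
qed

lemma tau_at_bot: "filterlim \<tau> at_bot (at_right (- a))"
  unfolding filterlim_at_bot_dense
proof
  fix Z
  have "\<forall>\<^sub>F y in at_right (- a). - a < y \<and> y < \<Phi> Z"
    using eventually_at_right_real[OF Phi_greater[of Z]] by simp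
  then show "\<forall>\<^sub>F y in at_right (- a). \<tau> y < Z"
    by eventually_elim (auto intro: tau_less)
qed

lemma tau_at_top: "filterlim \<tau> at_top at_top"
  unfolding filterlim_at_top_dense
proof
  fix Z
  show "\<forall>\<^sub>F y in at_top. Z < \<tau> y"
    using eventually_gt_at_top[of "\<Phi> Z"] by eventually_elim (use Phi_greater[of Z] in \<open>auto intro: tau_greater\<close>)
qed

definition f :: "real \<Rightarrow> real" where "f y = h (\<tau> y)"

lemma f_Phi: "f (\<Phi> t) = deriv \<Phi> t"
  by (simp add: f_def h_def)

lemma f_pos: "0 < f y"
  by (simp add: f_def h_pos)

lemma f_less: "- a < y \<Longrightarrow> f y < a * (y + a)"
  using h_upper[of "\<tau> y"] by (simp add: f_def)

lemma f_greater: "- a < y \<Longrightarrow> (a\<^sup>2 - y\<^sup>2) / 2 < f y"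
  using h_lower[of "\<tau> y"] by (simp add: f_def)

lemma df:
  assumes "- a < y"
  shows "(f has_real_derivative h1 (\<tau> y) / h (\<tau> y)) (at y)"
proof -
  have "f = (\<lambda>y. h (\<tau> y))" by (auto simp: f_def)
  then show ?thesis using DERIV_chain2[OF dh dtau[OF assms]] by (simp add: divide_inverse)
qed

text \<open>The slope of \<open>f\<close> is \<open>h1 / h\<close> at time \<open>\<tau> y\<close>,
  so the bracket of the equation is \<open>V\<close> at that time, and the chain rule divides
  \<open>V'\<close> by \<open>h\<close>. The slope at - a is the limit of
  \<open>h1 / h\<close>.\<close>

lemma f_cauchy: "cauchy_solution m a \<infinity> f"
  unfolding cauchy_solution_def
proof (intro conjI allI impI)
  show "ereal (- a) < \<infinity>" by simp
  have ev: "\<forall>\<^sub>F y in at_right (- a). - a < y" by (simp add: eventually_at_right_less)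
  show "f differentiable at y" if "- a < y \<and> ereal y < \<infinity>" for y
    using df that by (metis real_differentiable_def)
  show "((\<lambda>s. f s * deriv f s + s * f s) has_real_derivative (2 * m - 1) / m * f y) (at y)"
    if "- a < y \<and> ereal y < \<infinity>" for y
  proof -
    have y: "- a < y" using that by simp
    have "((\<lambda>s. V (\<tau> s)) has_real_derivative (1 + \<beta>) * (h (\<tau> y))\<^sup>2 * inverse (h (\<tau> y))) (at y)"
      by (rule DERIV_chain2[OF dV dtau[OF y]])
    moreover have "(1 + \<beta>) * (h (\<tau> y))\<^sup>2 * inverse (h (\<tau> y)) = (2 * m - 1) / m * f y"
      using h_pos[of "\<tau> y"] by (simp add: beta f_def power2_eq_square)
    ultimately have d: "((\<lambda>s. V (\<tau> s)) has_real_derivative (2 * m - 1) / m * f y) (at y)" by metis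
    have eq: "V (\<tau> s) = f s * deriv f s + s * f s" if "s \<in> {- a<..}" for s
      using that h_pos[of "\<tau> s"] DERIV_imp_deriv[OF df[of s]] by (auto simp: V_def f_def)
    show ?thesis
      by (rule has_field_derivative_transform_within_open[OF d open_greaterThan[of "- a"] _ eq]) (use y in auto)
  qed
  show "(f \<longlongrightarrow> 0) (at_right (- a))"
    using filterlim_compose[OF lims_at_bot(2) tau_at_bot] unfolding f_def .
  have "((\<lambda>y. h1 (\<tau> y) / h (\<tau> y)) \<longlongrightarrow> a) (at_right (- a))"
    by (rule filterlim_compose[OF h1_over_h tau_at_bot])
  then show "(deriv f \<longlongrightarrow> a) (at_right (- a))"
    by (rule Lim_transform_eventually) (use ev in \<open>eventually_elim, simp add: DERIV_imp_deriv[OF df]\<close>)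
qed

end

section \<open>Uniqueness for the Cauchy problem\<close>

text \<open>Stands for the estimate of an integral by the integral of a majorant, from an endpoint
  where only one-sided limits are known: \<open>e - g\<close> and \<open>e + g\<close> are both
  nondecreasing from 0.\<close>

lemma abs_le_of_deriv_at_right:
  fixes g g' e e' :: "real \<Rightarrow> real"
  assumes lim: "(g \<longlongrightarrow> 0) (at_right \<alpha>)" "(e \<longlongrightarrow> 0) (at_right \<alpha>)" and T: "\<alpha> < T"
    and g: "\<And>s. \<alpha> < s \<Longrightarrow> s \<le> T \<Longrightarrow> (g has_real_derivative g' s) (at s)"
    and e: "\<And>s. \<alpha> < s \<Longrightarrow> s \<le> T \<Longrightarrow> (e has_real_derivative e' s) (at s)"
    and le: "\<And>s. \<alpha> < s \<Longrightarrow> s \<le> T \<Longrightarrow> \<bar>g' s\<bar> \<le> e' s"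
  shows "\<bar>g T\<bar> \<le> e T"
proof -
  have ev: "\<forall>\<^sub>F s in at_right \<alpha>. s \<in> {\<alpha><..} \<and> s < T"
    using eventually_at_right_real[OF T] by (auto elim: eventually_mono)
  have iv: "is_interval {\<alpha><..}" by (simp add: is_interval_oi)
  have "0 \<le> e T - g T"
  proof (rule limit_le_of_deriv_nonneg[where g = "\<lambda>t. e t - g t" and g' = "\<lambda>t. e' t - g' t", OF _ _ ev iv])
    show "((\<lambda>t. e t - g t) \<longlongrightarrow> 0) (at_right \<alpha>)" using tendsto_diff[OF lim(2,1)] by simp
    fix s assume s: "s \<in> {\<alpha><..}"
    show "((\<lambda>t. e t - g t) has_real_derivative e' s - g' s) (at s)" if "s \<le> T"
      using s that by (intro DERIV_diff e g) auto
    show "0 \<le> e' s - g' s" if "s < T" using le[of s] s that by simp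
  qed (use T in auto)
  moreover have "0 \<le> e T + g T"
  proof (rule limit_le_of_deriv_nonneg[where g = "\<lambda>t. e t + g t" and g' = "\<lambda>t. e' t + g' t", OF _ _ ev iv])
    show "((\<lambda>t. e t + g t) \<longlongrightarrow> 0) (at_right \<alpha>)" using tendsto_add[OF lim(2,1)] by simp
    fix s assume s: "s \<in> {\<alpha><..}"
    show "((\<lambda>t. e t + g t) has_real_derivative e' s + g' s) (at s)" if "s \<le> T"
      using s that by (intro DERIV_add e g) auto
    show "0 \<le> e' s + g' s" if "s < T" using le[of s] s that by simp
  qed (use T in auto)
  ultimately show ?thesis by linarith
qed

text \<open>The uniqueness half of the contraction principle: the bound with \<open>M\<close>
  improves to \<open>q * M\<close>, hence to \<open>q ^ n * M\<close> for all \<open>n\<close>. The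
  weight \<open>w\<close> carries the behaviour at the endpoint.\<close>

lemma zero_of_contraction:
  fixes W w :: "'a \<Rightarrow> real"
  assumes step: "\<And>M y. 0 \<le> M \<Longrightarrow> (\<And>y. y \<in> A \<Longrightarrow> \<bar>W y\<bar> \<le> M * w y) \<Longrightarrow> y \<in> A \<Longrightarrow> \<bar>W y\<bar> \<le> q * M * w y"
    and q: "0 \<le> q" "q < 1" and M: "0 \<le> M" "\<And>y. y \<in> A \<Longrightarrow> \<bar>W y\<bar> \<le> M * w y" and y: "y \<in> A"
  shows "W y = 0"
proof -
  have bound: "\<bar>W y\<bar> \<le> (q ^ n * M) * w y" if "y \<in> A" for n y
    using that
  proof (induction n arbitrary: y)
    case (Suc n)
    have "\<bar>W y\<bar> \<le> q * (q ^ n * M) * w y"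
      by (rule step) (use Suc q M in auto)
    then show ?case by (simp add: mult.assoc)
  qed (use M in simp)
  have "(\<lambda>n. (q ^ n * M) * w y) \<longlonglongrightarrow> 0"
    using q by (auto intro!: tendsto_eq_intros LIMSEQ_realpow_zero)
  then have "\<bar>W y\<bar> \<le> 0" by (rule LIMSEQ_le_const) (use bound[OF y] in auto)
  then show ?thesis by simp
qed

text \<open>The difference \<open>u\<close> of the halved squares of two solutions satisfies \<open>u' = Q - y W\<close>, \<open>Q' = c W\<close>.
  At \<open>- a\<close> the equation is singular, but \<open>u \<approx> a (y + a) W\<close> while \<open>\<integral> - y W\<close> is only about
  half of that, so that the contraction survives.\<close>

locale two_solutions =
  fixes m a :: real and R :: ereal and f g :: "real \<Rightarrow> real"
  assumes m: "1 / 2 < m" and a: "0 < a"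
    and f: "cauchy_solution m a R f" and g: "cauchy_solution m a R g"
    and pos: "\<And>y. - a < y \<Longrightarrow> ereal y < R \<Longrightarrow> 0 < f y"
begin

definition c :: real where "c = (2 * m - 1) / m"

definition "W y = f y - g y"

definition "u y = ((f y)\<^sup>2 - (g y)\<^sup>2) / 2"

definition "Q y = (f y * deriv f y + y * f y) - (g y * deriv g y + y * g y)"

lemma c: "0 < c" "c < 2"
  using m by (auto simp: c_def field_simps)

lemma df: "- a < y \<Longrightarrow> ereal y < R \<Longrightarrow> (f has_real_derivative deriv f y) (at y)"
  using f unfolding cauchy_solution_def by (metis DERIV_deriv_iff_real_differentiable)

lemma dg: "- a < y \<Longrightarrow> ereal y < R \<Longrightarrow> (g has_real_derivative deriv g y) (at y)"
  using g unfolding cauchy_solution_def by (metis DERIV_deriv_iff_real_differentiable)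

lemma dQ:
  assumes "- a < y" "ereal y < R"
  shows "(Q has_real_derivative c * W y) (at y)"
proof -
  have "((\<lambda>s. k s * deriv k s + s * k s) has_real_derivative c * k y) (at y)"
    if "cauchy_solution m a R k" for k
    using that assms unfolding cauchy_solution_def c_def by simp
  from DERIV_diff[OF this[OF f] this[OF g]] show ?thesis
    by (simp add: Q_def[abs_def] W_def right_diff_distrib)
qed

lemma du: "- a < y \<Longrightarrow> ereal y < R \<Longrightarrow> (u has_real_derivative Q y - y * W y) (at y)"
  unfolding u_def[abs_def] by (auto intro!: derivative_eq_intros df dg simp: Q_def W_def field_simps)

lemma lims: "(f \<longlongrightarrow> 0) (at_right (- a))" "(g \<longlongrightarrow> 0) (at_right (- a))"
    "(deriv f \<longlongrightarrow> a) (at_right (- a))" "(deriv g \<longlongrightarrow> a) (at_right (- a))"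
  using f g by (simp_all add: cauchy_solution_def)

lemma limQ: "(Q \<longlongrightarrow> 0) (at_right (- a))" and limu: "(u \<longlongrightarrow> 0) (at_right (- a))"
  unfolding Q_def[abs_def] u_def[abs_def] by (auto intro!: tendsto_eq_intros lims)

lemma R: "ereal (- a) < R"
  using f by (simp add: cauchy_solution_def)

lemma u_W: "\<bar>u y\<bar> = \<bar>W y\<bar> * \<bar>(f y + g y) / 2\<bar>"
  by (simp add: u_def W_def power2_eq_square algebra_simps flip: abs_mult)

text \<open>Both functions vanish linearly at - a, hence the weight \<open>y + a\<close>. If
  \<open>W\<close> is at most \<open>M * (y + a)\<close>, two integrations bound \<open>u\<close> by
  \<open>M * ((y + a) ^ 3 / 3 + a * (y + a)\<^sup>2 / 2)\<close>, which is at most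
  \<open>M * (y + a)\<^sup>2 * (7 / 12 * a)\<close> as \<open>y + a \<le> a / 4\<close>. Slopes
  within \<open>a / 4\<close> of \<open>a\<close> make the mean of \<open>f\<close> and
  \<open>g\<close> at least \<open>3 / 4 * a * (y + a)\<close>, and the quotient of the constants is
  7/9.\<close>

lemma near_singular:
  obtains d where "0 < d" "ereal (- a + d) < R" "\<And>y. - a < y \<Longrightarrow> y \<le> - a + d \<Longrightarrow> W y = 0"
proof -
  obtain r where r: "- a < r" "ereal r < R" using R ereal_dense2[OF R] by auto
  have "\<forall>\<^sub>F y in at_right (- a). \<bar>deriv f y - a\<bar> < a / 4 \<and> \<bar>deriv g y - a\<bar> < a / 4"
    using lims(3,4)[THEN tendstoD, of "a / 4"] a by (auto simp: dist_real_def intro: eventually_conj)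
  then obtain s where s: "- a < s" "\<And>y. - a < y \<Longrightarrow> y < s \<Longrightarrow> \<bar>deriv f y - a\<bar> < a / 4 \<and> \<bar>deriv g y - a\<bar> < a / 4"
    by (auto simp: eventually_at_right_field)
  define d where "d = min (a / 4) (min ((r + a) / 2) ((s + a) / 2))"
  have d: "0 < d" "d \<le> a / 4" "- a + d < r" "- a + d < s" using a r s by (auto simp: d_def min_def field_simps)
  have inR: "ereal y < R" if "y \<le> - a + d" for y
    using r(2) d(3) that by (meson ereal_less_eq(3) le_less_trans less_imp_le order_trans)
  have near: "\<bar>k y - a * (y + a)\<bar> \<le> a / 4 * (y + a)"
    if y: "- a < y" "y \<le> - a + d" and k: "(k \<longlongrightarrow> 0) (at_right (- a))"
      "\<And>y. - a < y \<Longrightarrow> ereal y < R \<Longrightarrow> (k has_real_derivative k' y) (at y)"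
      "\<And>y. - a < y \<Longrightarrow> y < s \<Longrightarrow> \<bar>k' y - a\<bar> < a / 4" for y k k'
  proof (rule abs_le_of_deriv_at_right[where \<alpha> = "- a" and g = "\<lambda>y. k y - a * (y + a)" and g' = "\<lambda>y. k' y - a"
        and T = y and e = "\<lambda>y. a / 4 * (y + a)" and e' = "\<lambda>y. a / 4"])
    show "((\<lambda>y. k y - a * (y + a)) \<longlongrightarrow> 0) (at_right (- a))"
      by (auto intro!: tendsto_eq_intros k)
    show "((\<lambda>y. a / 4 * (y + a)) \<longlongrightarrow> 0) (at_right (- a))" by (auto intro!: tendsto_eq_intros)
    fix t assume t: "- a < t" "t \<le> y"
    show "((\<lambda>y. k y - a * (y + a)) has_real_derivative k' t - a) (at t)"
      using t y by (auto intro!: derivative_eq_intros k inR)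
    show "((\<lambda>y. a / 4 * (y + a)) has_real_derivative a / 4) (at t)"
      by (auto intro!: derivative_eq_intros)
    show "\<bar>k' t - a\<bar> \<le> a / 4" using k(3)[of t] t y d by simp
  qed (use y in auto)
  let ?A = "{- a<..- a + d}"
  have f_near: "\<bar>f y - a * (y + a)\<bar> \<le> a / 4 * (y + a)" and g_near: "\<bar>g y - a * (y + a)\<bar> \<le> a / 4 * (y + a)"
    if "y \<in> ?A" for y
    using near[of y f "deriv f"] near[of y g "deriv g"] that lims df dg s(2) by auto
  have step: "\<bar>W y\<bar> \<le> 7 / 9 * M * (y + a)"
    if M: "0 \<le> M" "\<And>y. y \<in> ?A \<Longrightarrow> \<bar>W y\<bar> \<le> M * (y + a)" and y: "y \<in> ?A" for M y
  proof -
    have Q: "\<bar>Q t\<bar> \<le> M * (t + a)\<^sup>2" if t: "t \<in> ?A" for t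
    proof (rule abs_le_of_deriv_at_right[OF limQ, where g' = "\<lambda>y. c * W y" and T = t and e = "\<lambda>t. M * (t + a)\<^sup>2" and
          e' = "\<lambda>y. 2 * M * (y + a)"])
      show "((\<lambda>t. M * (t + a)\<^sup>2) \<longlongrightarrow> 0) (at_right (- a))" by (auto intro!: tendsto_eq_intros)
      fix s assume s: "- a < s" "s \<le> t"
      show "((\<lambda>t. M * (t + a)\<^sup>2) has_real_derivative 2 * M * (s + a)) (at s)"
        by (auto intro!: derivative_eq_intros)
      show "(Q has_real_derivative c * W s) (at s)" using s t by (intro dQ inR) auto
      have "\<bar>c * W s\<bar> \<le> 2 * (M * (s + a))"
        unfolding abs_mult by (rule mult_mono) (use c M(2)[of s] s t in auto)
      then show "\<bar>c * W s\<bar> \<le> 2 * M * (s + a)" by simp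
    qed (use t in auto)
    have "\<bar>u y\<bar> \<le> M * ((y + a) ^ 3 / 3 + a * (y + a)\<^sup>2 / 2)"
    proof (rule abs_le_of_deriv_at_right[OF limu, where g' = "\<lambda>y. Q y - y * W y"
          and T = y and e = "\<lambda>y. M * ((y + a) ^ 3 / 3 + a * (y + a)\<^sup>2 / 2)"
          and e' = "\<lambda>y. M * (y + a)\<^sup>2 + a * (M * (y + a))"])
      show "((\<lambda>y. M * ((y + a) ^ 3 / 3 + a * (y + a)\<^sup>2 / 2)) \<longlongrightarrow> 0) (at_right (- a))"
        by (auto intro!: tendsto_eq_intros)
      fix s assume s: "- a < s" "s \<le> y"
      show "((\<lambda>y. M * ((y + a) ^ 3 / 3 + a * (y + a)\<^sup>2 / 2)) has_real_derivative
          M * (s + a)\<^sup>2 + a * (M * (s + a))) (at s)"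
        by (auto intro!: derivative_eq_intros simp: algebra_simps)
      show "(u has_real_derivative Q s - s * W s) (at s)" using s y by (intro du inR) auto
      have "\<bar>s * W s\<bar> \<le> a * (M * (s + a))"
        unfolding abs_mult by (rule mult_mono) (use a d M(2)[of s] s y in auto)
      moreover have "\<bar>Q s\<bar> \<le> M * (s + a)\<^sup>2" using Q[of s] s y by auto
      ultimately show "\<bar>Q s - s * W s\<bar> \<le> M * (s + a)\<^sup>2 + a * (M * (s + a))" by linarith
    qed (use y in auto)
    also have "\<dots> = M * (y + a)\<^sup>2 * ((y + a) / 3 + a / 2)"
      by (simp add: field_simps power2_eq_square power3_eq_cube)
    also have "\<dots> \<le> M * (y + a)\<^sup>2 * (7 / 12 * a)"
      using M(1) y d by (intro mult_left_mono) auto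
    finally have 1: "\<bar>u y\<bar> \<le> M * (y + a)\<^sup>2 * (7 / 12 * a)" .
    have p: "3 / 4 * a * (y + a) \<le> (f y + g y) / 2"
      using abs_le_D2[OF f_near[OF y]] abs_le_D2[OF g_near[OF y]] by (simp add: field_simps)
    have ya: "0 < a * (y + a)" using y a by auto
    have "\<bar>W y\<bar> * (3 / 4 * a * (y + a)) \<le> \<bar>u y\<bar>"
      unfolding u_W using p ya by (intro mult_left_mono) auto
    with 1 have "\<bar>W y\<bar> * (3 / 4 * a * (y + a)) \<le> (7 / 9 * M * (y + a)) * (3 / 4 * a * (y + a))"
      by (simp add: power2_eq_square algebra_simps)
    then show ?thesis by (rule mult_right_le_imp_le) (use y a in auto)
  qed
  show ?thesis
  proof (rule that[OF d(1)])
    show "ereal (- a + d) < R" using inR by simp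
    fix y assume "- a < y" "y \<le> - a + d"
    then show "W y = 0"
    proof (intro zero_of_contraction[where W = W and A = ?A and w = "\<lambda>y. y + a" and q = "7 / 9" and M = "a / 2" and y = y])
      show "\<bar>W y\<bar> \<le> 7 / 9 * M * (y + a)"
        if "0 \<le> M" "\<And>y. y \<in> ?A \<Longrightarrow> \<bar>W y\<bar> \<le> M * (y + a)" "y \<in> ?A" for M y
        using that by (rule step)
      fix y assume "y \<in> ?A"
      then show "\<bar>W y\<bar> \<le> a / 2 * (y + a)"
        using f_near[of y] g_near[of y] unfolding W_def by linarith
    qed (use a in auto)
  qed
qed

text \<open>To the right of - a the equation is regular: the common positive value at
  \<open>y0\<close> keeps the mean of \<open>f\<close> and \<open>g\<close> above \<eta>, and
  \<open>Q\<close>, \<open>u\<close> start from 0, so a short interval already gives a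
  contraction.\<close>

lemma beyond:
  assumes y0: "- a < y0" "ereal y0 < R" and zero: "\<And>y. - a < y \<Longrightarrow> y \<le> y0 \<Longrightarrow> W y = 0"
  obtains d where "0 < d" "\<And>y. y0 \<le> y \<Longrightarrow> y \<le> y0 + d \<Longrightarrow> W y = 0"
proof -
  \<comment> \<open>Agreement of the functions has to be upgraded to agreement of the brackets:
    \<open>Q' = c W\<close> vanishes up to \<open>y0\<close>, and \<open>Q\<close> starts from 0 at
    - a.\<close>
  have "\<bar>Q y0\<bar> \<le> 0"
  proof (rule abs_le_of_deriv_at_right[OF limQ _ y0(1) dQ, where e = "\<lambda>_. 0" and e' = "\<lambda>_. 0"])
    show "ereal s < R" if "s \<le> y0" for s using that y0(2) by (meson ereal_less_eq(3) le_less_trans)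
  qed (use zero in auto)
  then have Q0: "Q y0 = 0" by simp
  have u0: "u y0 = 0" using zero[of y0] y0 by (simp add: u_def W_def)
  have at_y0: "(Q \<longlongrightarrow> 0) (at_right y0)" "(u \<longlongrightarrow> 0) (at_right y0)"
    using dQ[OF y0] du[OF y0] Q0 u0
    by (metis DERIV_isCont continuous_within filterlim_at_split isCont_def)+
  define \<eta> where "\<eta> = f y0 / 2"
  have \<eta>: "0 < \<eta>" "\<eta> < f y0" "g y0 = f y0" using pos[OF y0] zero[of y0] y0 by (auto simp: \<eta>_def W_def)
  have "\<forall>\<^sub>F y in at_right y0. \<eta> < f y" "\<forall>\<^sub>F y in at_right y0. \<eta> < g y"
    using df[OF y0] dg[OF y0] \<eta>
    by (metis DERIV_isCont filterlim_at_split isCont_def order_tendstoD(1))+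
  moreover obtain r where r: "y0 < r" "ereal r < R" using ereal_dense2[OF y0(2)] by auto
  ultimately have "\<forall>\<^sub>F y in at_right y0. \<eta> < f y \<and> \<eta> < g y \<and> y < r"
    using eventually_at_right_real[OF r(1)] by (auto elim: eventually_elim2 simp: eventually_conj_iff)
  then obtain s where s: "y0 < s" "\<And>y. y0 < y \<Longrightarrow> y < s \<Longrightarrow> \<eta> < f y \<and> \<eta> < g y \<and> y < r"
    by (auto simp: eventually_at_right_field)
  \<comment> \<open>\<open>Y * M\<close> bounds the derivative \<open>Q y - y * W y\<close> of
    \<open>u\<close>: \<open>\<bar>y0\<bar> + 1\<close> for the factor \<open>y\<close> and 2 for
    \<open>Q\<close>, on an interval of length at most 1.\<close>
  define Y where "Y = \<bar>y0\<bar> + 3"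
  have Y: "0 < Y" by (simp add: Y_def)
  define d where "d = min (\<eta> / (2 * Y)) (min 1 ((s - y0) / 2))"
  have d: "0 < d" "d \<le> 1" "d \<le> \<eta> / (2 * Y)" "y0 + d < s"
  proof -
    have "d \<le> (s - y0) / 2" unfolding d_def by linarith
    moreover have "0 < \<eta> / (2 * Y)" using \<eta> Y by simp
    ultimately show "0 < d" "d \<le> 1" "d \<le> \<eta> / (2 * Y)" "y0 + d < s" using s by (simp_all add: d_def)
  qed
  have Yd: "Y * d \<le> \<eta> / 2" using d(3) Y by (simp add: field_simps)
  let ?A = "{y0<..y0 + d}"
  have inR: "- a < y" "ereal y < R" "\<eta> < f y" "\<eta> < g y" if "y \<in> ?A" for y
  proof -
    have "y < r" and "\<eta> < f y" "\<eta> < g y" using s(2)[of y] that d by auto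
    then show "ereal y < R" "\<eta> < f y" "\<eta> < g y" using r less_trans[of "ereal y" "ereal r" R] by auto
    show "- a < y" using y0 that by auto
  qed
  have step: "\<bar>W y\<bar> \<le> 1 / 2 * M * 1"
    if M: "0 \<le> M" "\<And>y. y \<in> ?A \<Longrightarrow> \<bar>W y\<bar> \<le> M * 1" and y: "y \<in> ?A" for M y
  proof -
    have Q: "\<bar>Q t\<bar> \<le> 2 * M * (t - y0)" if t: "t \<in> ?A" for t
    proof (rule abs_le_of_deriv_at_right[OF at_y0(1), where g' = "\<lambda>y. c * W y" and e' = "\<lambda>y. 2 * M"
          and T = t and e = "\<lambda>t. 2 * M * (t - y0)"])
      show "((\<lambda>t. 2 * M * (t - y0)) \<longlongrightarrow> 0) (at_right y0)" by (auto intro!: tendsto_eq_intros)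
      fix s assume s: "y0 < s" "s \<le> t"
      show "((\<lambda>t. 2 * M * (t - y0)) has_real_derivative 2 * M) (at s)"
        by (auto intro!: derivative_eq_intros)
      show "(Q has_real_derivative c * W s) (at s)" using s t by (intro dQ inR) auto
      show "\<bar>c * W s\<bar> \<le> 2 * M"
        unfolding abs_mult by (rule mult_mono) (use c M(2)[of s] s t in auto)
    qed (use t in auto)
    have "\<bar>u y\<bar> \<le> Y * M * (y - y0)"
    proof (rule abs_le_of_deriv_at_right[OF at_y0(2), where g' = "\<lambda>y. Q y - y * W y" and e' = "\<lambda>y. Y * M"
          and T = y and e = "\<lambda>t. Y * M * (t - y0)"])
      show "((\<lambda>t. Y * M * (t - y0)) \<longlongrightarrow> 0) (at_right y0)" by (auto intro!: tendsto_eq_intros)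
      fix s assume s: "y0 < s" "s \<le> y"
      show "((\<lambda>t. Y * M * (t - y0)) has_real_derivative Y * M) (at s)"
        by (auto intro!: derivative_eq_intros)
      show "(u has_real_derivative Q s - s * W s) (at s)" using s y by (intro du inR) auto
      have "\<bar>s * W s\<bar> \<le> (\<bar>y0\<bar> + 1) * M"
        unfolding abs_mult by (rule mult_mono) (use d M(2)[of s] s y in auto)
      moreover have "2 * M * (s - y0) \<le> 2 * M * 1" using M s y d by (intro mult_left_mono) auto
      then have "\<bar>Q s\<bar> \<le> 2 * M" using Q[of s] s y by auto
      ultimately show "\<bar>Q s - s * W s\<bar> \<le> Y * M" by (simp add: Y_def algebra_simps)
    qed (use y in auto)
    also have "\<dots> \<le> Y * M * d" using M y by (intro mult_left_mono) (auto simp: Y_def)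
    also have "\<dots> = M * (Y * d)" by simp
    also have "\<dots> \<le> M * (\<eta> / 2)" using M Yd by (intro mult_left_mono)
    finally have "\<bar>u y\<bar> \<le> M / 2 * \<eta>" by simp
    moreover have "\<bar>W y\<bar> * \<eta> \<le> \<bar>u y\<bar>"
      unfolding u_W using inR[OF y] by (intro mult_left_mono) auto
    ultimately have "\<bar>W y\<bar> * \<eta> \<le> M / 2 * \<eta>" by linarith
    then show ?thesis using \<eta> by simp
  qed
  have "continuous_on {y0..y0 + d} W"
    unfolding W_def[abs_def]
  proof (intro continuous_on_diff continuous_at_imp_continuous_on ballI)
    fix y assume "y \<in> {y0..y0 + d}"
    then have "- a < y" "ereal y < R" using inR[of y] y0 by (cases "y = y0"; auto)+
    then show "isCont f y" "isCont g y" using df dg DERIV_isCont by blast+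
  qed
  then have "bounded (W ` {y0..y0 + d})" by (intro compact_imp_bounded compact_continuous_image) auto
  then obtain M where M: "\<And>y. y0 \<le> y \<Longrightarrow> y \<le> y0 + d \<Longrightarrow> \<bar>W y\<bar> \<le> M" by (force simp: bounded_iff)
  have M0: "0 \<le> M" using M[of y0] d by simp
  show ?thesis
  proof (rule that[OF d(1)])
    fix y assume y: "y0 \<le> y" "y \<le> y0 + d"
    show "W y = 0"
    proof (cases "y = y0")
      case False
      then have "y \<in> ?A" using y by simp
      then show ?thesis
        by (intro zero_of_contraction[where W = W and A = ?A and w = "\<lambda>_. 1" and q = "1 / 2" and M = M and y = y, OF step])
           (use M M0 in auto)
    qed (use zero y0 in simp)
  qed
qed

text \<open>At the infimum of the points of disagreement, \<open>near_singular\<close> keeps away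
  from - a, continuity from the left gives agreement there, and \<open>beyond\<close> contradicts
  its choice.\<close>

lemma unique:
  assumes y: "- a < y" "ereal y < R"
  shows "g y = f y"
proof (rule ccontr)
  assume ne: "g y \<noteq> f y"
  let ?S = "{y. - a < y \<and> ereal y < R \<and> W y \<noteq> 0}"
  have bb: "bdd_below ?S" by (rule bdd_belowI[of _ "- a"]) auto
  have yS: "y \<in> ?S" using y ne by (simp add: W_def)
  define y0 where "y0 = Inf ?S"
  have y0_le: "y0 \<le> y" unfolding y0_def by (rule cInf_lower[OF yS bb])
  have y0_R: "ereal y0 < R" using y0_le y(2) by (meson ereal_less_eq(3) le_less_trans)
  have below: "W z = 0" if "- a < z" "z < y0" for z
  proof (rule ccontr)
    assume "W z \<noteq> 0"
    then have "z \<in> ?S" using that less_trans[OF _ y0_R, of "ereal z"] by simp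
    then have "y0 \<le> z" unfolding y0_def by (rule cInf_lower[OF _ bb])
    then show False using that by simp
  qed
  have greatest: "r \<le> y0" if "\<And>z. - a < z \<Longrightarrow> ereal z < R \<Longrightarrow> z < r \<Longrightarrow> W z = 0" for r
    unfolding y0_def by (rule cInf_greatest) (use yS that not_less in blast)+
  obtain d where d: "0 < d" "\<And>y. - a < y \<Longrightarrow> y \<le> - a + d \<Longrightarrow> W y = 0" by (rule near_singular) blast
  have "- a + d \<le> y0" by (rule greatest) (use d in auto)
  then have y0: "- a < y0" using d by simp
  have "isCont W y0" unfolding W_def[abs_def]
    using df[OF y0 y0_R] dg[OF y0 y0_R] by (intro continuous_diff) (auto dest: DERIV_isCont)
  then have "(W \<longlongrightarrow> W y0) (at_left y0)" by (metis filterlim_at_split isCont_def)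
  moreover have "(W \<longlongrightarrow> 0) (at_left y0)"
  proof (rule Lim_transform_eventually[OF tendsto_const])
    show "\<forall>\<^sub>F z in at_left y0. 0 = W z"
      using eventually_at_left_real[OF y0] by eventually_elim (use below in auto)
  qed
  ultimately have "W y0 = 0" using tendsto_unique[OF trivial_limit_at_left_real] by blast
  then have le: "W z = 0" if "- a < z" "z \<le> y0" for z using below that by (cases "z = y0") auto
  obtain e where e: "0 < e" "\<And>z. y0 \<le> z \<Longrightarrow> z \<le> y0 + e \<Longrightarrow> W z = 0"
    by (rule beyond[OF y0 y0_R le]) auto
  have "y0 + e \<le> y0" by (rule greatest) (use le e in \<open>meson less_imp_le linear\<close>)
  then show False using e by simp
qed

end

lemma cauchy_solution_mono:
  assumes "cauchy_solution m a S f" "R \<le> S" "ereal (- a) < R"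
  shows "cauchy_solution m a R f"
  using assms less_le_trans unfolding cauchy_solution_def by blast

lemma cauchy_solution_unique:
  assumes "1 / 2 < m" "0 < a" "cauchy_solution m a \<infinity> f" "\<And>y. - a < y \<Longrightarrow> 0 < f y"
    and g: "cauchy_solution m a R g" and "- a < y" "ereal y < R"
  shows "g y = f y"
proof -
  have "cauchy_solution m a R f"
    by (rule cauchy_solution_mono[OF assms(3)]) (use g in \<open>auto simp: cauchy_solution_def\<close>)
  then interpret two_solutions m a R f g by unfold_locales (use assms in auto)
  show ?thesis by (rule unique) fact+
qed

section \<open>The power series\<close>

lemma sum_flip: "(\<Sum>l\<in>{1..k-1}. g l) = (\<Sum>l\<in>{1..k-1}. g (k - l))"
  for g :: "nat \<Rightarrow> 'a :: comm_monoid_add"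
  by (rule sum.reindex_bij_witness[of _ "\<lambda>l. k - l" "\<lambda>l. k - l"]) auto

text \<open>Exchanging \<open>l\<close> and \<open>k - l\<close> replaces \<open>l\<close> by its
  mean \<open>k / 2\<close>, and \<open>k * (k + 3) / 2 + 1 = (k + 1) * (k + 2) / 2\<close>. This is
  the weight with which the second derivative of half a square acts on the coefficients.\<close>

lemma chi_rec:
  assumes "2 \<le> k"
  shows "(real k + 1)\<^sup>2 * chi m k = - chi m (k - 1) * ((1 + m * (real k - 1)) / m)
    - (real k + 1) * (real k + 2) / 2 * (\<Sum>l\<in>{1..k-1}. chi m l * chi m (k - l))"
proof -
  let ?p = "\<lambda>l. chi m l * chi m (k - l)"
  have "(\<Sum>l\<in>{1..k-1}. real l * ?p l) = (\<Sum>l\<in>{1..k-1}. real (k - l) * ?p (k - l))"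
    by (rule sum_flip)
  also have "\<dots> = (\<Sum>l\<in>{1..k-1}. (real k - real l) * ?p l)"
    using assms by (intro sum.cong) (auto simp: of_nat_diff)
  finally have "2 * (\<Sum>l\<in>{1..k-1}. real l * ?p l) = real k * (\<Sum>l\<in>{1..k-1}. ?p l)"
    by (simp add: left_diff_distrib sum_subtractf sum_distrib_left)
  moreover have "(\<Sum>l\<in>{1..k-1}. (real l * (real k + 3) + 1) * chi m l * chi m (k - l))
      = (real k + 3) * (\<Sum>l\<in>{1..k-1}. real l * ?p l) + (\<Sum>l\<in>{1..k-1}. ?p l)"
    by (simp add: sum_distrib_left algebra_simps flip: sum.distrib)
  ultimately have "(\<Sum>l\<in>{1..k-1}. (real l * (real k + 3) + 1) * chi m l * chi m (k - l))
      = (real k + 1) * (real k + 2) / 2 * (\<Sum>l\<in>{1..k-1}. ?p l)"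
    by (simp add: algebra_simps)
  then show ?thesis using assms by (subst chi.simps) simp
qed

section \<open>Convergence of the series\<close>

text \<open>Telescoping; at \<open>n = 0\<close> the bound reads \<open>0 \<le> 2\<close>, because
  division by 0 gives 0.\<close>

lemma sum_inverse_squares: "(\<Sum>l\<in>{1..n}. 1 / (real l)\<^sup>2) \<le> 2 - 1 / real n"
proof (induction n)
  case (Suc n)
  show ?case
  proof (cases "n = 0")
    case False
    then have "1 / (real (Suc n))\<^sup>2 \<le> 1 / (real n * real (Suc n))"
      by (intro divide_left_mono) (auto simp: power2_eq_square)
    also have "\<dots> = 1 / real n - 1 / real (Suc n)" using False by (simp add: field_simps)
    finally show ?thesis using Suc by simp
  qed simp
qed simp

text \<open>For \<open>x + y = k\<close> one has \<open>k^2 \<le> 2 (x^2 + y^2)\<close>; dividing by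
  \<open>x^2 y^2 k^2\<close> separates the product into single inverse squares, whose sums are at
  most 2 each.\<close>

lemma sum_inverse_squares_conv:
  assumes "2 \<le> k"
  shows "(\<Sum>l\<in>{1..k-1}. 1 / ((real l)\<^sup>2 * (real (k - l))\<^sup>2)) \<le> 8 / (real k)\<^sup>2"
proof -
  have "1 / ((real l)\<^sup>2 * (real (k - l))\<^sup>2) \<le> 2 / (real k)\<^sup>2 * (1 / (real l)\<^sup>2 + 1 / (real (k - l))\<^sup>2)"
    if "l \<in> {1..k-1}" for l
  proof -
    define x y where "x = real l" and "y = real (k - l)"
    have xy: "0 < x" "0 < y" "real k = x + y" using that assms by (auto simp: x_def y_def of_nat_diff)
    have "(x + y)\<^sup>2 \<le> 2 * (x\<^sup>2 + y\<^sup>2)" using zero_le_power2[of "x - y"] by (simp add: power2_eq_square algebra_simps)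
    then have "(x + y)\<^sup>2 / (x\<^sup>2 * y\<^sup>2 * (x + y)\<^sup>2) \<le> 2 * (x\<^sup>2 + y\<^sup>2) / (x\<^sup>2 * y\<^sup>2 * (x + y)\<^sup>2)"
      by (intro divide_right_mono) auto
    also have "(x + y)\<^sup>2 / (x\<^sup>2 * y\<^sup>2 * (x + y)\<^sup>2) = 1 / (x\<^sup>2 * y\<^sup>2)" using xy by simp
    also have "2 * (x\<^sup>2 + y\<^sup>2) / (x\<^sup>2 * y\<^sup>2 * (x + y)\<^sup>2) = 2 / (x + y)\<^sup>2 * (1 / x\<^sup>2 + 1 / y\<^sup>2)"
    proof -
      have "(x\<^sup>2 + y\<^sup>2) / (x\<^sup>2 * y\<^sup>2) = 1 / x\<^sup>2 + 1 / y\<^sup>2" using xy by (simp add: add_divide_distrib)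
      then show ?thesis by (metis times_divide_times_eq mult.commute)
    qed
    finally show ?thesis by (simp add: x_def[symmetric] y_def[symmetric] xy(3))
  qed
  then have "(\<Sum>l\<in>{1..k-1}. 1 / ((real l)\<^sup>2 * (real (k - l))\<^sup>2))
      \<le> (\<Sum>l\<in>{1..k-1}. 2 / (real k)\<^sup>2 * (1 / (real l)\<^sup>2 + 1 / (real (k - l))\<^sup>2))"
    by (rule sum_mono)
  also have "\<dots> = 2 / (real k)\<^sup>2 * ((\<Sum>l\<in>{1..k-1}. 1 / (real l)\<^sup>2) + (\<Sum>l\<in>{1..k-1}. 1 / (real (k - l))\<^sup>2))"
    by (simp add: sum_distrib_left sum.distrib distrib_left)
  also have "(\<Sum>l\<in>{1..k-1}. 1 / (real (k - l))\<^sup>2) = (\<Sum>l\<in>{1..k-1}. 1 / (real l)\<^sup>2)"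
    by (subst sum_flip) (intro sum.cong, auto)
  also have "2 / (real k)\<^sup>2 * ((\<Sum>l\<in>{1..k-1}. 1 / (real l)\<^sup>2) + (\<Sum>l\<in>{1..k-1}. 1 / (real l)\<^sup>2)) \<le> 2 / (real k)\<^sup>2 * (2 + 2)"
  proof (intro mult_left_mono add_mono)
    show "(\<Sum>l\<in>{1..k-1}. 1 / (real l)\<^sup>2) \<le> 2" by (rule order_trans[OF sum_inverse_squares]) simp
    then show "(\<Sum>l\<in>{1..k-1}. 1 / (real l)\<^sup>2) \<le> 2" .
  qed auto
  finally show ?thesis by simp
qed

text \<open>The weight \<open>1 / k\<^sup>2\<close> is reproduced by the convolution.\<close>

lemma chi_bound:
  assumes m: "1 / 2 < m" and "1 \<le> k"
  shows "\<bar>chi m k\<bar> \<le> 8 ^ k / (16 * (real k)\<^sup>2)"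
  using \<open>1 \<le> k\<close>
proof (induction k rule: less_induct)
  case (less k)
  show ?case
  proof (cases "k = 1")
    case True
    \<comment> \<open>\<open>1 / (4 * m) < 1 / 2 = 8 / 16\<close>: the base case prescribes the
      ratio of the two constants.\<close>
    then show ?thesis using m by (subst chi.simps) (simp add: field_simps)
  next
    case False
    then have k: "2 \<le> k" using less.prems by simp
    let ?S = "\<Sum>l\<in>{1..k-1}. chi m l * chi m (k - l)"
    \<comment> \<open>Of the available \<open>(real k + 1)\<^sup>2 * ?r\<close> the convolution uses
      at most 1/3 and the linear term at most 1/2. The 16 reduces the convolution to
      \<open>?r / 2\<close>; the 8 absorbs the factor \<open>k^2 / (k - 1)^2 \<le> 4\<close> of the
      linear term.\<close>
    let ?r = "8 ^ k / (16 * (real k)\<^sup>2) :: real"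
    have "\<bar>?S\<bar> \<le> (\<Sum>l\<in>{1..k-1}. 8 ^ k / 256 * (1 / ((real l)\<^sup>2 * (real (k - l))\<^sup>2)))"
    proof (rule order_trans[OF sum_abs sum_mono])
      fix l assume l: "l \<in> {1..k-1}"
      have "\<bar>chi m l * chi m (k - l)\<bar> \<le> 8 ^ l / (16 * (real l)\<^sup>2) * (8 ^ (k - l) / (16 * (real (k - l))\<^sup>2))"
        unfolding abs_mult by (rule mult_mono) (use less.IH[of l] less.IH[of "k - l"] l in auto)
      also have "\<dots> = 8 ^ (l + (k - l)) / 256 * (1 / ((real l)\<^sup>2 * (real (k - l))\<^sup>2))"
        by (simp add: power_add)
      also have "l + (k - l) = k" using l by (intro le_add_diff_inverse) auto
      finally show "\<bar>chi m l * chi m (k - l)\<bar> \<le> 8 ^ k / 256 * (1 / ((real l)\<^sup>2 * (real (k - l))\<^sup>2))" .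
    qed
    also have "\<dots> = 8 ^ k / 256 * (\<Sum>l\<in>{1..k-1}. 1 / ((real l)\<^sup>2 * (real (k - l))\<^sup>2))"
      by (simp only: sum_distrib_left)
    also have "\<dots> \<le> 8 ^ k / 256 * (8 / (real k)\<^sup>2)"
      by (intro mult_left_mono sum_inverse_squares_conv k) auto
    finally have S: "\<bar>?S\<bar> \<le> ?r / 2" by (simp add: field_simps)
    have "\<bar>(real k + 1) * (real k + 2) / 2 * ?S\<bar> \<le> (real k + 1) * (real k + 2) / 2 * (?r / 2)"
      unfolding abs_mult using S by (intro mult_mono) auto
    also have "\<dots> \<le> (real k + 1)\<^sup>2 * (2 / 3) * (?r / 2)"
    proof (rule mult_right_mono)
      define x where "x = real k"
      have "2 \<le> x" using k by (simp add: x_def)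
      then have "0 \<le> (x + 1) * (x - 2) / 6" by simp
      also have "\<dots> = (x + 1)\<^sup>2 * (2 / 3) - (x + 1) * (x + 2) / 2"
        by (simp add: power2_eq_square field_simps)
      finally show "(real k + 1) * (real k + 2) / 2 \<le> (real k + 1)\<^sup>2 * (2 / 3)"
        unfolding x_def by simp
    qed simp
    finally have 1: "\<bar>(real k + 1) * (real k + 2) / 2 * ?S\<bar> \<le> (real k + 1)\<^sup>2 * ?r / 3" by simp
    have "(1 + m * (real k - 1)) / m \<le> real k + 1" using m by (simp add: field_simps)
    moreover have "0 \<le> (1 + m * (real k - 1)) / m" using m k by (intro divide_nonneg_nonneg add_nonneg_nonneg) auto
    ultimately have "\<bar>- chi m (k - 1) * ((1 + m * (real k - 1)) / m)\<bar> \<le> 8 ^ (k - 1) / (16 * (real (k - 1))\<^sup>2) * (real k + 1)"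
      unfolding abs_mult using less.IH[of "k - 1"] k by (intro mult_mono) auto
    also have "\<dots> \<le> (real k + 1)\<^sup>2 * ?r / 2"
    proof -
      define x where "x = real k"
      have x: "2 \<le> x" "real (k - 1) = x - 1" using k by (auto simp: x_def of_nat_diff)
      have e: "(8::real) ^ k = 8 * 8 ^ (k - 1)" using k by (cases k) auto
      have "x\<^sup>2 \<le> 4 * (x - 1)\<^sup>2"
      proof -
        have "x\<^sup>2 \<le> (2 * (x - 1))\<^sup>2" using x by (intro power_mono) auto
        then show ?thesis by (simp only: power_mult_distrib) simp
      qed
      then have "1 / (x - 1)\<^sup>2 \<le> 4 / x\<^sup>2" using x by (simp add: field_simps)
      also have "\<dots> \<le> 4 * (x + 1) / x\<^sup>2" using x by (intro divide_right_mono) auto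
      finally have "8 ^ (k - 1) / 16 * (x + 1) * (1 / (x - 1)\<^sup>2) \<le> 8 ^ (k - 1) / 16 * (x + 1) * (4 * (x + 1) / x\<^sup>2)"
        using x by (intro mult_left_mono) auto
      moreover have "8 ^ (k - 1) / (16 * (x - 1)\<^sup>2) * (x + 1) = 8 ^ (k - 1) / 16 * (x + 1) * (1 / (x - 1)\<^sup>2)" by simp
      moreover have "(x + 1)\<^sup>2 * (8 * 8 ^ (k - 1) / (16 * x\<^sup>2)) / 2 = 8 ^ (k - 1) / 16 * (x + 1) * (4 * (x + 1) / x\<^sup>2)"
        using x by (simp add: power2_eq_square field_simps)
      ultimately show ?thesis unfolding x(2) e x_def[symmetric] by simp
    qed
    finally have "\<bar>(real k + 1)\<^sup>2 * chi m k\<bar> \<le> (real k + 1)\<^sup>2 * ?r / 2 + (real k + 1)\<^sup>2 * ?r / 3"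
      unfolding chi_rec[OF k] by (intro order_trans[OF abs_triangle_ineq4] add_mono 1)
    moreover have "0 \<le> (real k + 1)\<^sup>2 * ?r" by simp
    ultimately have "\<bar>(real k + 1)\<^sup>2 * chi m k\<bar> \<le> (real k + 1)\<^sup>2 * ?r" by linarith
    then have "(real k + 1)\<^sup>2 * \<bar>chi m k\<bar> \<le> (real k + 1)\<^sup>2 * ?r" by (simp only: abs_mult abs_power2)
    then show ?thesis by (rule mult_left_le_imp_le) (simp add: zero_less_power)
  qed
qed

section \<open>The formal solution and its sum\<close>

text \<open>The square bracket in the expansion of \<open>f\<close>, in the variable
  \<open>s = (y + a) / a\<close>. Its coefficient at 0 is the leading 1 instead of the dummy
  \<open>chi m 0\<close>.\<close>

definition e_fps :: "real \<Rightarrow> real fps" where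
  "e_fps m = Abs_fps (\<lambda>n. if n = 0 then 1 else chi m n)"

text \<open>The coefficients are at most \<open>8 ^ n\<close>, so at 1/16 a geometric series with
  ratio 1/2 dominates. The field is left general: the differential equation uses the real series,
  holomorphy the complex one.\<close>

lemma e_fps_conv:
  assumes m: "1 / 2 < m"
  shows "summable (\<lambda>n. of_real (fps_nth (e_fps m) n) * (1 / 16) ^ n :: 'a :: {banach, real_normed_field})"
proof (rule summable_comparison_test')
  show "summable (\<lambda>n. (1 / 2 :: real) ^ n)" by (rule summable_geometric) simp
  fix n :: nat
  have "\<bar>fps_nth (e_fps m) n\<bar> \<le> 8 ^ n"
  proof (cases "n = 0")
    case False
    then have "\<bar>chi m n\<bar> \<le> 8 ^ n / (16 * (real n)\<^sup>2)" using chi_bound[OF m, of n] by simp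
    also have "\<dots> \<le> 8 ^ n / 1"
    proof (rule divide_left_mono)
      have "1 \<le> (real n)\<^sup>2" using False by (simp add: one_le_power)
      then show "1 \<le> 16 * (real n)\<^sup>2" by simp
    qed (use False in auto)
    finally show ?thesis using False by (simp add: e_fps_def)
  qed (simp add: e_fps_def)
  then have "\<bar>fps_nth (e_fps m) n\<bar> * (1 / 16) ^ n \<le> 8 ^ n * (1 / 16) ^ n" by (rule mult_right_mono) simp
  also have "\<dots> = (1 / 2) ^ n" by (simp flip: power_mult_distrib)
  finally show "norm (of_real (fps_nth (e_fps m) n) * (1 / 16) ^ n :: 'a) \<le> (1 / 2) ^ n"
    by (simp add: norm_mult norm_power norm_divide)
qed

lemma e_fps_radius:
  assumes "1 / 2 < m"
  shows "1 / 16 \<le> fps_conv_radius (e_fps m)"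
    "1 / 16 \<le> fps_conv_radius (Abs_fps (\<lambda>n. of_real (fps_nth (e_fps m) n)) :: 'a :: {banach, real_normed_field} fps)"
proof -
  show "1 / 16 \<le> fps_conv_radius (Abs_fps (\<lambda>n. of_real (fps_nth (e_fps m) n)) :: 'a fps)"
    using conv_radius_geI[OF e_fps_conv[OF assms, where 'a = 'a]] by (simp add: fps_conv_radius_def norm_divide one_ereal_def numeral_eq_ereal)
  show "1 / 16 \<le> fps_conv_radius (e_fps m)"
    using conv_radius_geI[OF e_fps_conv[OF assms, where 'a = real]] by (simp add: fps_conv_radius_def one_ereal_def numeral_eq_ereal)
qed

lemma e_fps_conv_sum:
  assumes "2 \<le> n"
  shows "fps_nth (e_fps m * e_fps m) n = 2 * chi m n + (\<Sum>l\<in>{1..n-1}. chi m l * chi m (n - l))"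
proof -
  let ?e = "fps_nth (e_fps m)"
  have "{0..n} = insert 0 (insert n {1..n-1})" using assms by auto
  then have "fps_nth (e_fps m * e_fps m) n = ?e 0 * ?e n + (?e n * ?e 0 + (\<Sum>l\<in>{1..n-1}. ?e l * ?e (n - l)))"
    using assms by (simp add: fps_mult_nth)
  also have "(\<Sum>l\<in>{1..n-1}. ?e l * ?e (n - l)) = (\<Sum>l\<in>{1..n-1}. chi m l * chi m (n - l))"
    by (intro sum.cong) (auto simp: e_fps_def)
  finally show ?thesis using assms by (simp add: e_fps_def)
qed

text \<open>With \<open>f = a\<^sup>2 \<phi>((y + a) / a)\<close> the equation becomes \<open>(\<phi> \<phi>' + (s - 1) \<phi>)' = (2 m - 1) / m \<phi>\<close>.\<close>

definition phi_fps :: "real \<Rightarrow> real fps" where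
  "phi_fps m = fps_X * e_fps m"

text \<open>Writing \<open>\<phi> \<phi>'\<close> as half the derivative of the square leaves only
  coefficients of \<open>e_fps m * e_fps m\<close>. The coefficient at 0 reflects the slope 1, the
  one at 1 yields \<open>- 1 / (4 * m)\<close>, and from 2 on it is \<open>chi_rec\<close>.\<close>

lemma phi_fps_ode:
  assumes m: "1 / 2 < m"
  shows "fps_deriv (phi_fps m * fps_deriv (phi_fps m) + (fps_X - 1) * phi_fps m)
    = fps_const ((2 * m - 1) / m) * phi_fps m"
proof -
  let ?F = "phi_fps m" and ?e = "e_fps m"
  have F: "fps_nth ?F n = (if n = 0 then 0 else fps_nth ?e (n - 1))" for n
    by (simp add: phi_fps_def)
  have FF: "fps_nth (?F * ?F) (Suc (Suc n)) = fps_nth (?e * ?e) n" for n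
  proof -
    have "?F * ?F = fps_X * (fps_X * (?e * ?e))" by (simp add: phi_fps_def algebra_simps)
    then show ?thesis by simp
  qed
  have "2 * (?F * fps_deriv ?F) = fps_deriv (?F * ?F)" by (simp add: algebra_simps)
  then have "fps_const (1 / 2) * fps_deriv (?F * ?F) = fps_const (1 / 2) * (fps_const 2 * (?F * fps_deriv ?F))"
    by (simp add: fps_numeral_fps_const)
  then have half: "?F * fps_deriv ?F = fps_const (1 / 2) * fps_deriv (?F * ?F)"
    by (simp flip: mult.assoc)
  show ?thesis
  proof (rule fps_ext)
    fix n
    have "fps_nth (?F * fps_deriv ?F) (Suc n) = 1 / 2 * fps_nth (fps_deriv (?F * ?F)) (Suc n)"
      by (subst half) (simp only: fps_mult_left_const_nth)
    also have "fps_nth (fps_deriv (?F * ?F)) (Suc n) = real (n + 2) * fps_nth (?e * ?e) n"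
      using FF[of n] by (simp del: fps_deriv_mult)
    finally have nth: "fps_nth (?F * fps_deriv ?F) (Suc n) = 1 / 2 * (real (n + 2) * fps_nth (?e * ?e) n)" .
    have "fps_nth (fps_deriv (?F * fps_deriv ?F + (fps_X - 1) * ?F)) n
        = real (n + 1) * (fps_nth (?F * fps_deriv ?F) (Suc n) + fps_nth ((fps_X - 1) * ?F) (Suc n))"
      by (simp only: fps_deriv_nth fps_add_nth Suc_eq_plus1)
    also have "\<dots> = 1 / 2 * real (n + 1) * real (n + 2) * fps_nth (?e * ?e) n + real (n + 1) * (fps_nth ?F n - fps_nth ?F (Suc n))"
      unfolding nth by (simp add: left_diff_distrib algebra_simps)
    also have "\<dots> = (2 * m - 1) / m * fps_nth ?F n"
    proof -
      consider "n = 0" | "n = 1" | "2 \<le> n" by linarith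
      then show ?thesis
      proof cases
        case 1
        then show ?thesis by (simp add: F e_fps_def)
      next
        case 2
        have "chi m 1 = - 1 / (4 * m)" by (subst chi.simps) simp
        then show ?thesis using 2 m by (simp add: F e_fps_def fps_mult_nth field_simps)
      next
        case 3
        let ?S = "\<Sum>l\<in>{1..n-1}. chi m l * chi m (n - l)"
        have "1 / 2 * real (n + 1) * real (n + 2) * fps_nth (?e * ?e) n + real (n + 1) * (fps_nth ?F n - fps_nth ?F (Suc n))
          = (real n + 1)\<^sup>2 * chi m n + (real n + 1) * (real n + 2) / 2 * ?S + (real n + 1) * chi m (n - 1)"
          using 3 by (simp add: F e_fps_conv_sum, simp add: e_fps_def algebra_simps power2_eq_square)
        also have "\<dots> = chi m (n - 1) * (real n + 1 - (1 + m * (real n - 1)) / m)"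
        proof -
          define q where "q = (1 + m * (real n - 1)) / m"
          show ?thesis unfolding chi_rec[OF 3] q_def[symmetric] by (simp add: algebra_simps)
        qed
        also have "real n + 1 - (1 + m * (real n - 1)) / m = (2 * m - 1) / m"
          using m by (simp add: field_simps)
        finally show ?thesis using 3 by (simp add: F e_fps_def)
      qed
    qed
    finally show "fps_nth (fps_deriv (?F * fps_deriv ?F + (fps_X - 1) * ?F)) n
        = fps_nth (fps_const ((2 * m - 1) / m) * ?F) n" by simp
  qed
qed

lemma phi_fps_radius:
  assumes "1 / 2 < m"
  shows "1 / 16 \<le> fps_conv_radius (phi_fps m)"
  using fps_conv_radius_mult[of fps_X "e_fps m"] e_fps_radius(1)[OF assms]
  by (simp add: phi_fps_def order_trans)

lemma eval_phi_ode:
  assumes m: "1 / 2 < m" and s: "\<bar>s\<bar> < 1 / 16"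
  shows "(eval_fps (phi_fps m) has_real_derivative eval_fps (fps_deriv (phi_fps m)) s) (at s)"
    "((\<lambda>s. eval_fps (phi_fps m) s * eval_fps (fps_deriv (phi_fps m)) s + (s - 1) * eval_fps (phi_fps m) s)
      has_real_derivative (2 * m - 1) / m * eval_fps (phi_fps m) s) (at s)"
proof -
  let ?F = "phi_fps m" and ?r = "ereal (1 / 16)"
  let ?G = "?F * fps_deriv ?F + (fps_X - 1) * ?F"
  have rF: "?r \<le> fps_conv_radius ?F" using phi_fps_radius[OF m] by (simp add: one_ereal_def numeral_eq_ereal)
  have rF': "?r \<le> fps_conv_radius (fps_deriv ?F)" using rF fps_conv_radius_deriv[of ?F] by (rule order_trans)
  have rX: "fps_conv_radius (fps_X - 1 :: real fps) = \<infinity>"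
    using fps_conv_radius_diff[of "fps_X :: real fps" 1] by simp
  have r1: "?r \<le> fps_conv_radius (?F * fps_deriv ?F)"
    using fps_conv_radius_mult[of ?F "fps_deriv ?F"] rF rF' by (meson min.boundedI order_trans)
  have r2: "?r \<le> fps_conv_radius ((fps_X - 1) * ?F)"
    using fps_conv_radius_mult[of "fps_X - 1" ?F] rF rX by (simp add: order_trans)
  have rG: "?r \<le> fps_conv_radius ?G"
    using fps_conv_radius_add[of "?F * fps_deriv ?F" "(fps_X - 1) * ?F"] r1 r2 by (meson min.boundedI order_trans)
  have less: "ereal (norm t) < fps_conv_radius H" if "?r \<le> fps_conv_radius H" "t \<in> ball 0 (1 / 16)" for t :: real and H :: "real fps"
    using that by (intro less_le_trans[OF _ that(1)]) simp
  have s': "s \<in> ball 0 (1 / 16)" using s by simp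
  show "(eval_fps ?F has_real_derivative eval_fps (fps_deriv ?F) s) (at s)"
    by (intro has_field_derivative_eval_fps less rF s')
  have eval: "eval_fps ?G t = eval_fps ?F t * eval_fps (fps_deriv ?F) t + (t - 1) * eval_fps ?F t"
    if "t \<in> ball 0 (1 / 16)" for t
    unfolding eval_fps_add[OF less[OF r1 that] less[OF r2 that]] eval_fps_mult[OF less[OF rF that] less[OF rF' that]]
    using eval_fps_mult[OF less[OF _ that] less[OF rF that], of "fps_X - 1"] by (simp add: rX eval_fps_diff)
  have "(eval_fps ?G has_real_derivative eval_fps (fps_deriv ?G) s) (at s)"
    by (intro has_field_derivative_eval_fps less rG s')
  moreover have "eval_fps (fps_deriv ?G) s = (2 * m - 1) / m * eval_fps ?F s"
    unfolding phi_fps_ode[OF m]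
    using eval_fps_mult[OF _ less[OF rF s'], of "fps_const ((2 * m - 1) / m)"] by simp
  ultimately have "(eval_fps ?G has_real_derivative (2 * m - 1) / m * eval_fps ?F s) (at s)" by simp
  then show "((\<lambda>s. eval_fps ?F s * eval_fps (fps_deriv ?F) s + (s - 1) * eval_fps ?F s)
      has_real_derivative (2 * m - 1) / m * eval_fps ?F s) (at s)"
    by (rule has_field_derivative_transform_within_open[OF _ open_ball s']) (rule eval)
qed

lemma phi_cauchy_solution:
  assumes m: "1 / 2 < m" and a: "0 < a"
  shows "cauchy_solution m a (ereal (- a + a / 16)) (\<lambda>y. a\<^sup>2 * eval_fps (phi_fps m) ((y + a) / a))"
proof -
  let ?\<phi> = "eval_fps (phi_fps m)" and ?\<phi>' = "eval_fps (fps_deriv (phi_fps m))"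
  let ?g = "\<lambda>y. a\<^sup>2 * ?\<phi> ((y + a) / a)"
  \<comment> \<open>The interval reaches to the left of - a, which makes - a an interior point: the
    one-sided limits are then values of the series.\<close>
  let ?I = "{- a - a / 16<..<- a + a / 16}"
  have small: "\<bar>(y + a) / a\<bar> < 1 / 16" if "y \<in> ?I" for y
  proof -
    have "\<bar>y + a\<bar> < a / 16" using that unfolding abs_less_iff greaterThanLessThan_iff by linarith
    then show ?thesis using a by (simp add: abs_divide field_simps)
  qed
  have dlin: "((\<lambda>y. (y + a) / a) has_real_derivative 1 / a) (at y)" for y
    using a by (auto intro!: derivative_eq_intros)
  have dg: "(?g has_real_derivative a * ?\<phi>' ((y + a) / a)) (at y)" if y: "y \<in> ?I" for y
    using DERIV_cmult[OF DERIV_chain2[OF eval_phi_ode(1)[OF m small[OF y]] dlin], of "a\<^sup>2"] a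
    by (simp add: power2_eq_square)
  have dg': "deriv ?g y = a * ?\<phi>' ((y + a) / a)" if y: "y \<in> ?I" for y
    using dg[OF y] by (rule DERIV_imp_deriv)
  have end_in: "- a \<in> ?I" using a by simp
  have ev: "\<forall>\<^sub>F y in at_right (- a). y \<in> ?I"
    using eventually_at_right_real[of "- a" "- a + a / 16"] a by (auto elim!: eventually_mono)
  have phi0: "?\<phi> 0 = 0" "?\<phi>' 0 = 1" by (simp_all add: eval_fps_at_0 phi_fps_def e_fps_def)
  show ?thesis
    unfolding cauchy_solution_def
  proof (intro conjI allI impI)
    show "ereal (- a) < ereal (- a + a / 16)" using a by simp
    fix y assume "- a < y \<and> ereal y < ereal (- a + a / 16)"
    then have y: "y \<in> ?I" using a by auto
    show "?g differentiable at y" using dg[OF y] by (auto simp: real_differentiable_def)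
    have "((\<lambda>y. a ^ 3 * (?\<phi> ((y + a) / a) * ?\<phi>' ((y + a) / a) + ((y + a) / a - 1) * ?\<phi> ((y + a) / a)))
        has_real_derivative a ^ 3 * ((2 * m - 1) / m * ?\<phi> ((y + a) / a) * (1 / a))) (at y)"
      by (rule DERIV_cmult[OF DERIV_chain2[OF eval_phi_ode(2)[OF m small[OF y]] dlin]])
    moreover have "a ^ 3 * ((2 * m - 1) / m * ?\<phi> ((y + a) / a) * (1 / a)) = (2 * m - 1) / m * ?g y"
      using a by (simp add: power3_eq_cube power2_eq_square)
    ultimately have "((\<lambda>y. a ^ 3 * (?\<phi> ((y + a) / a) * ?\<phi>' ((y + a) / a) + ((y + a) / a - 1) * ?\<phi> ((y + a) / a)))
        has_real_derivative (2 * m - 1) / m * ?g y) (at y)" by simp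
    moreover have "a ^ 3 * (?\<phi> ((z + a) / a) * ?\<phi>' ((z + a) / a) + ((z + a) / a - 1) * ?\<phi> ((z + a) / a))
        = ?g z * deriv ?g z + z * ?g z" if "z \<in> ?I" for z
    proof -
      have eq: "(z + a) / a - 1 = z / a" using a by (simp add: field_simps)
      show ?thesis unfolding dg'[OF that] eq
        using a by (simp only: power3_eq_cube power2_eq_square) (simp add: distrib_left)
    qed
    ultimately show "((\<lambda>s. ?g s * deriv ?g s + s * ?g s) has_real_derivative (2 * m - 1) / m * ?g y) (at y)"
      by (rule has_field_derivative_transform_within_open[OF _ open_greaterThanLessThan y])
  next
    have "(?g \<longlongrightarrow> ?g (- a)) (at_right (- a))"
      using DERIV_isCont[OF dg[OF end_in]] unfolding isCont_def by (rule tendsto_within_subset) simp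
    then show "(?g \<longlongrightarrow> 0) (at_right (- a))" by (simp add: phi0)
    have "isCont ?\<phi>' ((- a + a) / a)"
    proof (intro continuous_eval_fps less_le_trans[OF _ fps_conv_radius_deriv] less_le_trans[OF _ phi_fps_radius[OF m]])
      show "ereal (norm ((- a + a) / a)) < 1 / 16" by (simp add: one_ereal_def numeral_eq_ereal)
    qed
    then have "isCont (\<lambda>y. a * ?\<phi>' ((y + a) / a)) (- a)"
      by (intro continuous_mult continuous_const isCont_o2[OF DERIV_isCont[OF dlin]])
    then have "((\<lambda>y. a * ?\<phi>' ((y + a) / a)) \<longlongrightarrow> a) (at_right (- a))"
      unfolding isCont_def by (simp add: phi0 filterlim_at_split)
    then show "(deriv ?g \<longlongrightarrow> a) (at_right (- a))"
      by (rule Lim_transform_eventually) (use ev in \<open>eventually_elim, simp add: dg'\<close>)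
  qed
qed

text \<open>The complex series has the real coefficients, so the two sums agree on the real segment.
  The shift to \<open>Suc k\<close> starts the sum at index 1; the head of the full series
  \<open>E\<close> is the explicit 1.\<close>

lemma series_holomorphic:
  fixes a :: real
  assumes m: "1 / 2 < m" and a: "0 < a"
  defines "F \<equiv> \<lambda>z :: complex. of_real a * (z + of_real a) *
      (1 + (\<Sum>k. of_real (chi m (Suc k)) * (z + of_real a) ^ Suc k / of_real a ^ Suc k))"
  shows "F holomorphic_on ball (of_real (- a)) (a / 16)"
    "\<And>y. - a < y \<Longrightarrow> y < - a + a / 16 \<Longrightarrow> F (of_real y) = of_real (a\<^sup>2 * eval_fps (phi_fps m) ((y + a) / a))"
    "\<And>z :: complex. z \<in> ball (of_real (- a)) (a / 16) \<Longrightarrow>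
      summable (\<lambda>k. of_real (chi m (Suc k)) * (z + of_real a) ^ Suc k / of_real a ^ Suc k)"
proof -
  define E where "E = (Abs_fps (\<lambda>n. of_real (fps_nth (e_fps m) n)) :: complex fps)"
  have E: "ereal (1 / 16) \<le> fps_conv_radius E"
    using e_fps_radius(2)[OF m] by (simp add: E_def one_ereal_def numeral_eq_ereal)
  let ?w = "\<lambda>z :: complex. (z + of_real a) / of_real a"
  have w: "norm (?w z) < 1 / 16" if "z \<in> ball (of_real (- a)) (a / 16)" for z
  proof -
    have "norm (z + of_real a) < a / 16" using that by (simp add: dist_norm norm_minus_commute add.commute)
    then show ?thesis using a by (simp add: norm_divide field_simps)
  qed
  have wr: "ereal (norm (?w z)) < fps_conv_radius E" if "z \<in> ball (of_real (- a)) (a / 16)" for z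
    using w[OF that] by (intro less_le_trans[OF _ E]) simp
  have tm: "fps_nth E (Suc k) * ?w z ^ Suc k = of_real (chi m (Suc k)) * (z + of_real a) ^ Suc k / of_real a ^ Suc k" for z k
    by (simp only: E_def e_fps_def fps_nth_Abs_fps power_divide) simp
  have sm: "summable (\<lambda>k. fps_nth E k * ?w z ^ k)" if "z \<in> ball (of_real (- a)) (a / 16)" for z
    by (rule summable_fps[OF wr[OF that]])
  show sm': "summable (\<lambda>k. of_real (chi m (Suc k)) * (z + of_real a) ^ Suc k / of_real a ^ Suc k)"
    if "z \<in> ball (of_real (- a)) (a / 16)" for z :: complex
    using iffD2[OF summable_Suc_iff sm[OF that]] unfolding tm .
  have F: "F z = of_real a * (z + of_real a) * eval_fps E (?w z)" if "z \<in> ball (of_real (- a)) (a / 16)" for z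
    using suminf_split_head[OF sm[OF that]] unfolding tm
    by (simp add: F_def eval_fps_def E_def e_fps_def)
  have "(\<lambda>z. of_real a * (z + of_real a) * eval_fps E (?w z)) holomorphic_on ball (of_real (- a)) (a / 16)"
    using a wr by (intro holomorphic_intros holomorphic_on_compose_gen[of ?w _ "eval_fps E" "eball 0 (fps_conv_radius E)", unfolded o_def]) auto
  then show "F holomorphic_on ball (of_real (- a)) (a / 16)"
    by (rule holomorphic_transform) (simp add: F)
  fix y assume y: "- a < y" "y < - a + a / 16"
  then have yb: "of_real y \<in> ball (of_real (- a) :: complex) (a / 16)" by (simp add: dist_real_def del: of_real_minus)
  have s: "\<bar>(y + a) / a\<bar> < 1 / 16" using y a by (simp add: field_simps)
  then have sr: "ereal (norm ((y + a) / a)) < fps_conv_radius (e_fps m)"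
    by (intro less_le_trans[OF _ e_fps_radius(1)[OF m]]) (simp add: one_ereal_def numeral_eq_ereal)
  have "eval_fps E (?w (of_real y)) = of_real (eval_fps (e_fps m) ((y + a) / a))"
    unfolding eval_fps_def E_def
    by (subst suminf_of_real[OF summable_fps[OF sr]]) simp
  moreover have "eval_fps (phi_fps m) ((y + a) / a) = (y + a) / a * eval_fps (e_fps m) ((y + a) / a)"
    unfolding phi_fps_def by (subst eval_fps_mult) (use sr in auto)
  ultimately show "F (of_real y) = of_real (a\<^sup>2 * eval_fps (phi_fps m) ((y + a) / a))"
    using a by (simp add: F[OF yb] power2_eq_square)
qed

section \<open>Behaviour for large arguments\<close>

text \<open>The difference quotient over the points \<open>t\<close> and \<open>(1 + d) * t\<close>
  bounds a nondecreasing \<open>h\<close> from above for \<open>d > 0\<close> and from below for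
  \<open>d < 0\<close>. Its limit \<open>L d\<close> in \<open>t\<close> tends to
  \<open>b * m\<close> as \<open>d\<close> tends to 0. \<open>b\<close> and \<open>h\<close> may
  have any sign, so that - \<Phi> can be inserted as well.\<close>

lemma monotone_density:
  fixes \<Phi> h :: "real \<Rightarrow> real"
  assumes asymp: "((\<lambda>t. \<Phi> t / t powr m) \<longlongrightarrow> b) at_top"
    and der: "\<And>t. T \<le> t \<Longrightarrow> (\<Phi> has_real_derivative h t) (at t)"
    and mono: "\<And>s t. T \<le> s \<Longrightarrow> s \<le> t \<Longrightarrow> h s \<le> h t"
  shows "((\<lambda>t. h t / t powr (m - 1)) \<longlongrightarrow> b * m) at_top"
proof -
  define q where "q d t = (\<Phi> ((1 + d) * t) - \<Phi> t) / (d * t powr m)" for d t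
  define L where "L d = b * (((1 + d) powr m - 1) / d)" for d
  have q_lim: "(q d \<longlongrightarrow> L d) at_top" if d: "- 1 < d" "d \<noteq> 0" for d
  proof -
    have "filterlim (\<lambda>t. (1 + d) * t) at_top at_top"
      using d by (intro filterlim_tendsto_pos_mult_at_top[OF tendsto_const _ filterlim_ident]) simp
    from filterlim_compose[OF asymp this]
    have "((\<lambda>t. (\<Phi> ((1 + d) * t) / ((1 + d) * t) powr m * (1 + d) powr m - \<Phi> t / t powr m) / d) \<longlongrightarrow>
        (b * (1 + d) powr m - b) / d) at_top"
      using d by (intro tendsto_intros asymp) auto
    moreover have "\<forall>\<^sub>F t in at_top. (\<Phi> ((1 + d) * t) / ((1 + d) * t) powr m * (1 + d) powr m - \<Phi> t / t powr m) / d = q d t"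
      using eventually_gt_at_top[of "0::real"]
    proof eventually_elim
      case (elim t)
      then have "((1 + d) * t) powr m = (1 + d) powr m * t powr m" using d by (simp add: powr_mult)
      moreover have "(1 + d) powr m \<noteq> 0" using d by simp
      ultimately show ?case using elim d by (simp add: q_def diff_divide_distrib mult.commute)
    qed
    ultimately have "(q d \<longlongrightarrow> (b * (1 + d) powr m - b) / d) at_top" by (rule Lim_transform_eventually)
    then show ?thesis by (simp add: L_def algebra_simps diff_divide_distrib)
  qed
  have powr1: "t powr m = t powr (m - 1) * t" if "0 < t" for t :: real
    using that by (simp add: powr_diff)
  have upper: "\<forall>\<^sub>F t in at_top. h t / t powr (m - 1) \<le> q d t" if d: "0 < d" for d
    using eventually_gt_at_top[of "max 0 T"]
  proof eventually_elim
    case (elim t)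
    then have t: "0 < t" "T \<le> t" by auto
    have lt: "t < (1 + d) * t" using t d by simp
    obtain x where x: "t < x" "x < (1 + d) * t" "\<Phi> ((1 + d) * t) - \<Phi> t = ((1 + d) * t - t) * h x"
      using MVT2[OF lt, of \<Phi> h] der t by force
    have "d * t * h t \<le> \<Phi> ((1 + d) * t) - \<Phi> t"
      unfolding x(3) using mono[of t x] t x d by (simp add: algebra_simps)
    then have "d * t * h t / (d * t powr m) \<le> q d t" unfolding q_def using d by (intro divide_right_mono) auto
    moreover have "d * t * h t / (d * t powr m) = h t / t powr (m - 1)" using t d by (simp add: powr1)
    ultimately show ?case by simp
  qed
  have lower: "\<forall>\<^sub>F t in at_top. q d t \<le> h t / t powr (m - 1)" if d: "- 1 < d" "d < 0" for d
    using eventually_gt_at_top[of "max 0 (\<bar>T\<bar> / (1 + d))"]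
  proof eventually_elim
    case (elim t)
    then have t: "0 < t" by auto
    have "\<bar>T\<bar> < (1 + d) * t" using elim d by (simp add: field_simps)
    then have T: "T \<le> (1 + d) * t" by simp
    have lt: "(1 + d) * t < t" using t d by simp
    obtain x where x: "(1 + d) * t < x" "x < t" "\<Phi> t - \<Phi> ((1 + d) * t) = (t - (1 + d) * t) * h x"
      using MVT2[OF lt, of \<Phi> h] der T by force
    have "(- d) * t * h x \<le> (- d) * t * h t"
      using mono[of x t] T t x d by (intro mult_left_mono mult_nonneg_nonneg) auto
    then have "d * t * h t \<le> \<Phi> ((1 + d) * t) - \<Phi> t" using x(3) by (simp add: algebra_simps)
    then have "q d t \<le> d * t * h t / (d * t powr m)" unfolding q_def using d t
      by (intro divide_right_mono_neg) (auto simp: mult_le_0_iff)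
    moreover have "d * t * h t / (d * t powr m) = h t / t powr (m - 1)" using t d by (simp add: powr1)
    ultimately show ?case by simp
  qed
  have "((\<lambda>d. (1 + d) powr m) has_real_derivative m) (at 0)"
    by (auto intro!: derivative_eq_intros)
  then have "((\<lambda>d. ((1 + d) powr m - 1) / d) \<longlongrightarrow> m) (at 0)"
    by (simp add: has_field_derivative_iff)
  then have L: "(L \<longlongrightarrow> b * m) (at 0)" unfolding L_def by (intro tendsto_intros)
  show ?thesis
  proof (rule order_tendstoI)
    fix z assume z: "z < b * m"
    have "\<forall>\<^sub>F d in at_left 0. z < L d" using order_tendstoD(1)[OF L z] by (simp add: eventually_at_split)
    moreover have "\<forall>\<^sub>F d in at_left (0::real). d \<in> {- 1<..<0}" by (rule eventually_at_left_real) simp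
    ultimately have "\<forall>\<^sub>F d in at_left 0. z < L d \<and> - 1 < d \<and> d < 0" by eventually_elim auto
    then obtain d where d: "z < L d" "- 1 < d" "d < 0"
      using eventually_happens'[OF trivial_limit_at_left_real] by blast
    have "\<forall>\<^sub>F t in at_top. z < q d t" using order_tendstoD(1)[OF q_lim d(1)] d by simp
    with lower[OF d(2,3)] show "\<forall>\<^sub>F t in at_top. z < h t / t powr (m - 1)" by eventually_elim auto
  next
    fix z assume z: "b * m < z"
    have "\<forall>\<^sub>F d in at_right 0. L d < z" using order_tendstoD(2)[OF L z] by (simp add: eventually_at_split)
    moreover have "\<forall>\<^sub>F d in at_right (0::real). d \<in> {0<..<1}" by (rule eventually_at_right_real) simp
    ultimately have "\<forall>\<^sub>F d in at_right 0. L d < z \<and> 0 < d" by eventually_elim auto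
    then obtain d where d: "L d < z" "0 < d"
      using eventually_happens'[OF trivial_limit_at_right_real] by blast
    have "\<forall>\<^sub>F t in at_top. q d t < z" using order_tendstoD(2)[OF q_lim d(1)] d by simp
    with upper[OF d(2)] show "\<forall>\<^sub>F t in at_top. h t / t powr (m - 1) < z" by eventually_elim auto
  qed
qed

lemma mono_bounded_tendsto_at_top:
  fixes g :: "real \<Rightarrow> real"
  assumes mono: "\<And>y z. Z \<le> y \<Longrightarrow> y \<le> z \<Longrightarrow> g y \<le> g z" and bound: "\<And>y. Z \<le> y \<Longrightarrow> g y \<le> M"
  obtains l where "(g \<longlongrightarrow> l) at_top"
proof (rule that)
  have bdd: "bdd_above (g ` {Z..})" using bound by (auto intro!: bdd_aboveI2)
  show "(g \<longlongrightarrow> (SUP y\<in>{Z..}. g y)) at_top"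
  proof (rule order_tendstoI)
    fix x assume "x < (SUP y\<in>{Z..}. g y)"
    then obtain y where y: "Z \<le> y" "x < g y" using less_cSUP_iff[OF _ bdd] by auto
    show "\<forall>\<^sub>F z in at_top. x < g z"
      using eventually_ge_at_top[of y] by eventually_elim (use y mono[of y] in \<open>force intro: less_le_trans\<close>)
  next
    fix x assume "(SUP y\<in>{Z..}. g y) < x"
    then show "\<forall>\<^sub>F z in at_top. g z < x"
      by (intro eventually_mono[OF eventually_ge_at_top[of Z]]) (auto intro: le_less_trans cSUP_upper[OF _ bdd])
  qed
qed

text \<open>\<open>K / y\<close> is the tail integral of the bound: \<open>L y - K / y\<close> is
  nondecreasing and is bounded above because \<open>L y + K / y\<close> is nonincreasing.\<close>

lemma tendsto_of_deriv_inverse_square: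
  fixes L L' :: "real \<Rightarrow> real"
  assumes Z: "0 < Z" and der: "\<And>y. Z \<le> y \<Longrightarrow> (L has_real_derivative L' y) (at y)"
    and bound: "\<And>y. Z \<le> y \<Longrightarrow> \<bar>L' y\<bar> \<le> K / y\<^sup>2"
  obtains l where "(L \<longlongrightarrow> l) at_top"
proof -
  have K: "0 \<le> K" using order_trans[OF abs_ge_zero bound[of Z]] Z by (simp add: zero_le_divide_iff)
  have incr: "L y - K / y \<le> L z - K / z" if "Z \<le> y" "y \<le> z" for y z
  proof (rule DERIV_nonneg_imp_nondecreasing[OF that(2)])
    fix x assume x: "y \<le> x"
    have "((\<lambda>x. L x - K / x) has_real_derivative L' x + K / x\<^sup>2) (at x)"
      using x that Z by (auto intro!: derivative_eq_intros der simp: power2_eq_square)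
    then show "\<exists>d. ((\<lambda>x. L x - K / x) has_real_derivative d) (at x) \<and> 0 \<le> d"
      using bound[of x] x that by (intro exI[of _ "L' x + K / x\<^sup>2"]) auto
  qed
  have decr: "L z + K / z \<le> L Z + K / Z" if "Z \<le> z" for z
  proof (rule DERIV_nonpos_imp_nonincreasing[OF that])
    fix x assume x: "Z \<le> x"
    have "((\<lambda>x. L x + K / x) has_real_derivative L' x - K / x\<^sup>2) (at x)"
      using x Z by (auto intro!: derivative_eq_intros der simp: power2_eq_square)
    then show "\<exists>d. ((\<lambda>x. L x + K / x) has_real_derivative d) (at x) \<and> d \<le> 0"
      using bound[of x] x by (intro exI[of _ "L' x - K / x\<^sup>2"]) auto
  qed
  have bd: "L y - K / y \<le> L Z + K / Z" if "Z \<le> y" for y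
  proof -
    have "0 \<le> K / y" using K Z that by simp
    then show ?thesis using decr[OF that] by linarith
  qed
  obtain l where l: "((\<lambda>y. L y - K / y) \<longlongrightarrow> l) at_top"
    by (rule mono_bounded_tendsto_at_top[of Z "\<lambda>y. L y - K / y", OF incr bd]) blast
  have "((\<lambda>y. K / y) \<longlongrightarrow> 0) at_top" by real_asymp
  from tendsto_add[OF l this] have "(L \<longlongrightarrow> l) at_top" by simp
  then show ?thesis by (rule that)
qed

section \<open>Fast and slow modes of the difference of two solutions\<close>

lemma abs_less_square_iff: "\<bar>x\<bar> < \<bar>y\<bar> \<longleftrightarrow> x\<^sup>2 < y\<^sup>2" for x y :: real
  by (simp add: abs_le_square_iff flip: not_le)

text \<open>\<open>u\<close> is half the difference of the squares of two solutions \<open>f\<close>, \<open>g\<close>, \<open>\<mu> = 2 y / (f + g)\<close>. The system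
  has a fast mode \<open>u' \<approx> - \<mu> u\<close> and an algebraic mode \<open>R \<approx> y\<^bsup>c\<^esup>\<close>; the cone
  \<open>\<bar>u\<bar> < \<bar>R\<bar>\<close> is invariant and belongs to the latter.\<close>

locale fast_slow =
  fixes u R \<mu> :: "real \<Rightarrow> real" and c Z :: real
  assumes Z: "1 \<le> Z" and c: "0 < c"
    and du: "\<And>y. Z \<le> y \<Longrightarrow> (u has_real_derivative - (\<mu> y + c / y) * u y + R y) (at y)"
    and dR: "\<And>y. Z \<le> y \<Longrightarrow> (R has_real_derivative c / y * R y - c * (c + 1) / y\<^sup>2 * u y) (at y)"
    and mu: "\<And>y. Z \<le> y \<Longrightarrow> c * (c + 1) + 3 \<le> \<mu> y"
    and small: "((\<lambda>y. \<mu> y * u y / y powr c) \<longlongrightarrow> 0) at_top" "((\<lambda>y. u y / y powr (c + 1)) \<longlongrightarrow> 0) at_top"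
begin

text \<open>An upper bound for the total coupling \<open>1 + c * (c + 1) / y\<^sup>2\<close> of
  \<open>u\<close> and \<open>R\<close> on \<open>1 \<le> y\<close>.\<close>

definition k :: real where "k = c * (c + 1) + 1"

lemma k: "1 < k" using c by (simp add: k_def)

text \<open>In the derivative of \<open>R^2 - u^2\<close> the mixed terms cost at most
  \<open>k (u^2 + R^2)\<close>. The damping of \<open>u\<close>, which is at least \<open>k\<close>,
  pays for the part with \<open>u\<close>, the factor \<open>exp (k * y)\<close> for the part with
  \<open>R\<close>.\<close>

lemma cone_invariant:
  assumes y0: "Z \<le> y0" "y0 \<le> y" and cone: "\<bar>u y0\<bar> < \<bar>R y0\<bar>"
  shows "\<bar>u y\<bar> < \<bar>R y\<bar>"
proof -
  define S where "S = (\<lambda>y. ((R y)\<^sup>2 - (u y)\<^sup>2) * exp (k * y))"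
  have "S y0 \<le> S y"
  proof (rule DERIV_nonneg_imp_nondecreasing[OF y0(2)])
    fix x assume "y0 \<le> x"
    then have x: "Z \<le> x" "1 \<le> x" using y0 Z by auto
    let ?D = "2 * R x * (c / x * R x - c * (c + 1) / x\<^sup>2 * u x)
        - 2 * u x * (- (\<mu> x + c / x) * u x + R x) + k * ((R x)\<^sup>2 - (u x)\<^sup>2)"
    have "(S has_real_derivative ?D * exp (k * x)) (at x)"
      unfolding S_def by (auto intro!: derivative_eq_intros du dR x simp: algebra_simps)
    moreover have "0 \<le> ?D"
    proof -
      have "c * (c + 1) / x\<^sup>2 \<le> c * (c + 1) / 1" using x c by (intro divide_left_mono) auto
      then have "(1 + c * (c + 1) / x\<^sup>2) * \<bar>u x * R x\<bar> \<le> k * \<bar>u x * R x\<bar>"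
        by (intro mult_right_mono) (auto simp: k_def)
      moreover have "(1 + c * (c + 1) / x\<^sup>2) * (u x * R x) \<le> (1 + c * (c + 1) / x\<^sup>2) * \<bar>u x * R x\<bar>"
        using c by (intro mult_left_mono) auto
      moreover have "2 * \<bar>u x * R x\<bar> \<le> (u x)\<^sup>2 + (R x)\<^sup>2"
        using zero_le_power2[of "\<bar>u x\<bar> - \<bar>R x\<bar>"] by (simp add: power2_diff abs_mult)
      then have "k * (2 * \<bar>u x * R x\<bar>) \<le> k * ((u x)\<^sup>2 + (R x)\<^sup>2)" using k by (intro mult_left_mono) auto
      then have "2 * (k * \<bar>u x * R x\<bar>) \<le> k * (u x)\<^sup>2 + k * (R x)\<^sup>2" by (simp add: distrib_left)
      moreover have "k * (u x)\<^sup>2 \<le> (\<mu> x + c / x) * (u x)\<^sup>2"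
      proof (intro mult_right_mono)
        have "0 \<le> c / x" using x c by simp
        then show "k \<le> \<mu> x + c / x" using mu[OF x(1)] by (simp add: k_def)
      qed simp
      moreover have "0 \<le> c / x * (R x)\<^sup>2" using x c by simp
      moreover have "?D = 2 * (c / x * (R x)\<^sup>2) - 2 * ((1 + c * (c + 1) / x\<^sup>2) * (u x * R x))
          + 2 * ((\<mu> x + c / x) * (u x)\<^sup>2) + (k * (R x)\<^sup>2 - k * (u x)\<^sup>2)"
        by (simp add: algebra_simps power2_eq_square)
      ultimately show ?thesis by linarith
    qed
    ultimately show "\<exists>d. (S has_real_derivative d) (at x) \<and> 0 \<le> d" by (intro exI[of _ "?D * exp (k * x)"]) simp
  qed
  moreover have "0 < S y0" using cone by (simp add: S_def flip: abs_less_square_iff)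
  ultimately have "0 < S y" by simp
  then show ?thesis by (simp add: S_def zero_less_mult_iff flip: abs_less_square_iff)
qed

text \<open>Inside the cone \<open>R\<close> keeps its sign and feels \<open>u\<close> only through
  an integrable coupling, so it grows at least like \<open>y powr c\<close>. By \<open>small\<close>
  the damping terms of \<open>u\<close> are of lower order, so \<open>u\<close> would grow like
  \<open>y powr (c + 1)\<close>, which \<open>small\<close> forbids.\<close>

lemma no_slow_mode:
  assumes y0: "Z \<le> y0"
  shows "R y0 \<le> \<bar>u y0\<bar>"
proof (rule ccontr)
  assume "\<not> ?thesis"
  then have R0: "\<bar>u y0\<bar> < R y0" by simp
  have cone: "\<bar>u y\<bar> < \<bar>R y\<bar>" if "y0 \<le> y" for y
    using cone_invariant[OF y0 that] R0 by simp
  have Rpos: "0 < R y" if y: "y0 \<le> y" for y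
  proof (rule ccontr)
    assume "\<not> 0 < R y"
    then obtain x where x: "y0 \<le> x" "R x = 0"
      using IVT2[of R y 0 y0] R0 y y0 DERIV_isCont[OF dR] by force
    then show False using cone[of x] by simp
  qed
  \<comment> \<open>The power removes the free growth of \<open>R\<close>; the last factor absorbs
    the coupling, which is at most \<open>k / y\<^sup>2\<close> relative to
    \<open>R\<close>.\<close>
  define G where "G = (\<lambda>y. R y * y powr (- c) * exp (- (k / y)))"
  have G: "G y0 \<le> G y" if y: "y0 \<le> y" for y
  proof (rule DERIV_nonneg_imp_nondecreasing[OF y])
    fix x assume yx: "y0 \<le> x"
    then have x: "Z \<le> x" "0 < x" using y0 Z by auto
    let ?D = "(k * R x - c * (c + 1) * u x) / x\<^sup>2 * x powr (- c) * exp (- (k / x))"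
    have "(G has_real_derivative ?D) (at x)"
    proof -
      have "x powr (- c - 1) = x powr (- c) / x" using x by (simp add: powr_diff)
      then show ?thesis
        unfolding G_def using x
        by (auto intro!: derivative_eq_intros dR simp: power2_eq_square) (simp add: field_simps)
    qed
    moreover have "0 \<le> ?D"
    proof -
      have "c * (c + 1) * u x \<le> c * (c + 1) * R x"
        using cone[OF yx] Rpos[OF yx] c by (intro mult_left_mono) auto
      also have "\<dots> \<le> k * R x" using Rpos[OF yx] by (intro mult_right_mono) (auto simp: k_def)
      finally show ?thesis by (intro mult_nonneg_nonneg divide_nonneg_nonneg) auto
    qed
    ultimately show "\<exists>d. (G has_real_derivative d) (at x) \<and> 0 \<le> d" by blast
  qed
  define \<eta> where "\<eta> = G y0"
  have \<eta>: "0 < \<eta>" using Rpos[of y0] y0 Z by (simp add: \<eta>_def G_def)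
  have R_lower: "\<eta> * y powr c \<le> R y" if y: "y0 \<le> y" for y
  proof -
    have "0 < y" using y y0 Z by simp
    have "\<eta> \<le> R y * y powr (- c) * exp (- (k / y))" using G[OF y] by (simp add: \<eta>_def G_def)
    also have "\<dots> \<le> R y * y powr (- c) * 1"
      using Rpos[OF y] \<open>0 < y\<close> k by (intro mult_left_mono) auto
    finally show ?thesis using \<open>0 < y\<close> by (simp add: powr_minus field_simps)
  qed
  \<comment> \<open>Each of the two damping terms may consume a quarter of the lower bound
    \<open>\<eta> * y powr c\<close> for \<open>R\<close>; half of it remains for the growth of
    \<open>u\<close>.\<close>
  have "\<forall>\<^sub>F y in at_top. \<mu> y * u y / y powr c < \<eta> / 4"
    by (rule order_tendstoD(2)[OF small(1)]) (use \<eta> in simp)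
  moreover have "\<forall>\<^sub>F y in at_top. u y / y powr (c + 1) < \<eta> / (4 * c)"
    by (rule order_tendstoD(2)[OF small(2)]) (use \<eta> c in simp)
  ultimately have "\<forall>\<^sub>F y in at_top. \<mu> y * u y / y powr c < \<eta> / 4 \<and> u y / y powr (c + 1) < \<eta> / (4 * c)"
    by (rule eventually_conj)
  then obtain y1 where y1: "\<And>y. y1 \<le> y \<Longrightarrow> \<mu> y * u y / y powr c < \<eta> / 4 \<and> u y / y powr (c + 1) < \<eta> / (4 * c)"
    by (auto simp: eventually_at_top_linorder)
  define y2 where "y2 = max y0 y1"
  define C where "C = u y2 - \<eta> / (2 * (c + 1)) * y2 powr (c + 1)"
  have u_lower: "C \<le> u y - \<eta> / (2 * (c + 1)) * y powr (c + 1)" if y: "y2 \<le> y" for y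
    unfolding C_def
  proof (rule DERIV_nonneg_imp_nondecreasing[OF y])
    fix x assume "y2 \<le> x"
    then have x: "y0 \<le> x" "y1 \<le> x" "Z \<le> x" "0 < x" using y0 Z by (auto simp: y2_def)
    let ?D = "- (\<mu> x + c / x) * u x + R x - \<eta> / 2 * x powr c"
    have "((\<lambda>y. u y - \<eta> / (2 * (c + 1)) * y powr (c + 1)) has_real_derivative ?D) (at x)"
      using x c by (auto intro!: derivative_eq_intros du) (simp add: field_simps)
    moreover have "0 \<le> ?D"
    proof -
      have "4 * (\<mu> x * u x) \<le> \<eta> * x powr c" "4 * (c / x * u x) \<le> \<eta> * x powr c"
        using y1[OF x(2)] x c by (auto simp: powr_add field_simps)
      then have "0 \<le> R x - \<mu> x * u x - c / x * u x - (\<eta> * x powr c) / 2"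
        using R_lower[OF x(1)] by linarith
      also have "\<dots> = ?D" by (simp add: algebra_simps)
      finally show ?thesis .
    qed
    ultimately show "\<exists>d. ((\<lambda>y. u y - \<eta> / (2 * (c + 1)) * y powr (c + 1)) has_real_derivative d) (at x) \<and> 0 \<le> d"
      by blast
  qed
  have "\<eta> / (2 * (c + 1)) \<le> 0"
  proof (rule tendsto_upperbound)
    show "((\<lambda>y. \<eta> / (2 * (c + 1)) + C / y powr (c + 1) - u y / y powr (c + 1)) \<longlongrightarrow> \<eta> / (2 * (c + 1))) at_top"
    proof -
      have "((\<lambda>y. C / y powr (c + 1)) \<longlongrightarrow> 0) at_top" using c by real_asymp
      from tendsto_diff[OF tendsto_add[OF tendsto_const[of "\<eta> / (2 * (c + 1))"] this] small(2)]
      show ?thesis by simp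
    qed
    show "\<forall>\<^sub>F y in at_top. \<eta> / (2 * (c + 1)) + C / y powr (c + 1) - u y / y powr (c + 1) \<le> 0"
      using eventually_ge_at_top[of "max 1 y2"]
    proof eventually_elim
      case (elim y)
      then have "(C + \<eta> / (2 * (c + 1)) * y powr (c + 1)) / y powr (c + 1) \<le> u y / y powr (c + 1)"
        using u_lower[of y] by (intro divide_right_mono) auto
      then show ?case using elim by (simp add: add_divide_distrib)
    qed
  qed simp
  then show False using \<eta> c by (simp add: divide_le_0_iff)
qed

end

text \<open>Linearity turns the one-sided conclusion of \<open>no_slow_mode\<close> into a bound for
  the absolute value of \<open>R\<close>, and later reduces negative \<open>u\<close> to positive
  \<open>u\<close>.\<close>

lemma fast_slow_uminus:
  assumes "fast_slow u R \<mu> c Z"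
  shows "fast_slow (\<lambda>y. - u y) (\<lambda>y. - R y) \<mu> c Z"
proof -
  interpret fast_slow u R \<mu> c Z by fact
  show ?thesis
  proof
    fix y assume y: "Z \<le> y"
    show "((\<lambda>y. - u y) has_real_derivative - (\<mu> y + c / y) * - u y + - R y) (at y)"
      using DERIV_minus[OF du[OF y]] by simp
    show "((\<lambda>y. - R y) has_real_derivative c / y * - R y - c * (c + 1) / y\<^sup>2 * - u y) (at y)"
      using DERIV_minus[OF dR[OF y]] by simp
  qed (use Z c mu tendsto_minus[OF small(1)] tendsto_minus[OF small(2)] in auto)
qed

context fast_slow begin

lemma R_le_u: "Z \<le> y \<Longrightarrow> \<bar>R y\<bar> \<le> \<bar>u y\<bar>"
  using no_slow_mode[of y] fast_slow.no_slow_mode[OF fast_slow_uminus[OF fast_slow_axioms], of y]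
  by simp

text \<open>Of a damping of at least 2, one unit is spent on \<open>R\<close> and one remains. The
  rate 1 is crude, but it beats every power, and it shows that a zero of \<open>u\<close> is
  final.\<close>

lemma u_decay:
  assumes "Z \<le> y" "y \<le> z"
  shows "\<bar>u z\<bar> * exp z \<le> \<bar>u y\<bar> * exp y"
proof -
  have "(u z * exp z)\<^sup>2 \<le> (u y * exp y)\<^sup>2"
  proof (rule DERIV_nonpos_imp_nonincreasing[OF assms(2)])
    fix x assume "y \<le> x"
    then have x: "Z \<le> x" "0 < x" using assms Z by auto
    let ?D = "2 * (u x * exp x) * ((- (\<mu> x + c / x) * u x + R x) * exp x + u x * exp x)"
    have "((\<lambda>x. (u x * exp x)\<^sup>2) has_real_derivative ?D) (at x)"
      by (auto intro!: derivative_eq_intros du x simp: algebra_simps power2_eq_square)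
    moreover have "?D \<le> 0"
    proof -
      have "u x * R x \<le> \<bar>u x\<bar> * \<bar>R x\<bar>" by (simp add: abs_le_D1 flip: abs_mult)
      also have "\<dots> \<le> \<bar>u x\<bar> * \<bar>u x\<bar>" using R_le_u[OF x(1)] by (intro mult_left_mono) auto
      finally have "u x * R x \<le> u x * u x" by simp
      moreover have "2 * (u x * u x) \<le> (\<mu> x + c / x) * (u x * u x)"
      proof (rule mult_right_mono)
        have "0 \<le> c / x" "0 \<le> c * (c + 1)" using x c by auto
        then show "2 \<le> \<mu> x + c / x" using mu[OF x(1)] by linarith
      qed simp
      ultimately have "(u x * R x + u x * u x - (\<mu> x + c / x) * (u x * u x)) * (2 * (exp x * exp x)) \<le> 0"
        by (intro mult_nonpos_nonneg) (linarith, simp)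
      then show ?thesis by (simp add: algebra_simps)
    qed
    ultimately show "\<exists>d. ((\<lambda>x. (u x * exp x)\<^sup>2) has_real_derivative d) (at x) \<and> d \<le> 0" by blast
  qed
  then have "\<bar>u z * exp z\<bar> \<le> \<bar>u y * exp y\<bar>" by (simp add: abs_le_square_iff)
  then show ?thesis by (simp add: abs_mult)
qed

lemma u_exp_bound: "Z \<le> y \<Longrightarrow> \<bar>u y\<bar> \<le> \<bar>u Z\<bar> * exp Z * exp (- y)"
  using u_decay[of Z y] by (simp add: exp_minus field_simps)

lemma u_zero: "Z \<le> y \<Longrightarrow> y \<le> z \<Longrightarrow> u y = 0 \<Longrightarrow> u z = 0"
  using u_decay[of y z] by (simp add: mult_le_0_iff)

lemma lim_u: "(u \<longlongrightarrow> 0) at_top"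
proof (rule Lim_null_comparison)
  show "\<forall>\<^sub>F y in at_top. norm (u y) \<le> \<bar>u Z\<bar> * exp Z * exp (- y)"
    using eventually_ge_at_top[of Z] by eventually_elim (use u_exp_bound in auto)
  show "((\<lambda>y. \<bar>u Z\<bar> * exp Z * exp (- y)) \<longlongrightarrow> 0) at_top" by real_asymp
qed

text \<open>\<open>r\<close> is \<open>R\<close> without its free growth, and
  \<open>r' = - S\<close> makes it the tail integral of \<open>S\<close>. As
  \<open>u' \<le> - u\<close>, also \<open>S' \<le> - S\<close>, so the tail is at most
  \<open>S\<close> itself; this gains the factor \<open>1 / y^2\<close> over
  \<open>R_le_u\<close>.\<close>

lemma R_bounds:
  assumes y0: "Z \<le> y0" and pos: "\<And>y. y0 \<le> y \<Longrightarrow> 0 < u y"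
  shows "0 \<le> R y0" "R y0 \<le> c * (c + 1) / y0\<^sup>2 * u y0"
proof -
  define r where "r = (\<lambda>y. R y * y powr (- c))"
  define S where "S = (\<lambda>y. c * (c + 1) * u y * y powr (- c - 2))"
  have dr: "(r has_real_derivative - S y) (at y)" if y: "y0 \<le> y" for y
  proof -
    have "0 < y" "Z \<le> y" using y y0 Z by auto
    moreover have "y powr (- c - 1) = y powr (- c) / y" "y powr (- c - 2) = y powr (- c) / y\<^sup>2"
      using \<open>0 < y\<close> by (simp_all add: powr_diff)
    ultimately show ?thesis
      unfolding r_def S_def by (auto intro!: derivative_eq_intros dR) (simp add: field_simps)
  qed
  have S_pos: "0 < S y" if y: "y0 \<le> y" for y
    using pos[OF y] c y y0 Z by (simp add: S_def)
  have lim_powr: "((\<lambda>y. y powr (- c)) \<longlongrightarrow> 0) at_top" "((\<lambda>y. y powr (- c - 2)) \<longlongrightarrow> 0) at_top"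
    using c by real_asymp+
  have lim_R: "(R \<longlongrightarrow> 0) at_top"
    by (rule Lim_null_comparison[OF _ tendsto_rabs_zero[OF lim_u]])
       (use eventually_ge_at_top[of Z] in \<open>eventually_elim, simp add: R_le_u\<close>)
  have lim_r: "(r \<longlongrightarrow> 0) at_top"
    unfolding r_def using tendsto_mult[OF lim_R lim_powr(1)] by simp
  have lim_rS: "((\<lambda>y. r y - S y) \<longlongrightarrow> 0) at_top"
    using tendsto_diff[OF lim_r tendsto_mult[OF tendsto_mult[OF tendsto_const[of "c * (c + 1)"] lim_u] lim_powr(2)]]
    by (simp add: S_def)
  have "0 \<le> r y0"
  proof (rule tendsto_upperbound[OF lim_r])
    show "\<forall>\<^sub>F y in at_top. r y \<le> r y0"
      using eventually_ge_at_top[of y0]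
    proof eventually_elim
      case (elim y)
      then show ?case
      proof (rule DERIV_nonpos_imp_nonincreasing)
        show "\<exists>d. (r has_real_derivative d) (at x) \<and> d \<le> 0" if "y0 \<le> x" for x
          using dr[OF that] S_pos[OF that] by (intro exI[of _ "- S x"]) simp
      qed
    qed
  qed simp
  then show "0 \<le> R y0" using y0 Z by (simp add: r_def zero_le_mult_iff)
  have "r y0 - S y0 \<le> 0"
  proof (rule tendsto_lowerbound[OF lim_rS])
    show "\<forall>\<^sub>F y in at_top. r y0 - S y0 \<le> r y - S y"
      using eventually_ge_at_top[of y0]
    proof eventually_elim
      case (elim y)
      then show ?case
      proof (rule DERIV_nonneg_imp_nondecreasing)
        fix x assume yx: "y0 \<le> x"
        then have x: "0 < x" "Z \<le> x" using y0 Z by auto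
        have powr_arg: "- 3 - c = - c - 3" by simp
        let ?u' = "- (\<mu> x + c / x) * u x + R x"
        let ?D = "- S x - c * (c + 1) * (?u' * x powr (- c - 2) + u x * ((- c - 2) * x powr (- c - 3)))"
        have "((\<lambda>y. r y - S y) has_real_derivative ?D) (at x)"
          using x dr[OF yx]
          by (auto intro!: derivative_eq_intros du simp: S_def) (simp add: algebra_simps powr_arg)
        moreover have "0 \<le> ?D"
        proof -
          have "0 \<le> c / x * u x" "0 \<le> c * (c + 1)" using x c pos[OF yx] by auto
          moreover have "(c * (c + 1) + 3) * u x \<le> \<mu> x * u x" using mu[OF x(2)] pos[OF yx] by (intro mult_right_mono) auto
          moreover have "R x \<le> u x" using R_le_u[OF x(2)] pos[OF yx] by simp
          moreover have "0 \<le> c * (c + 1) * u x" using c pos[OF yx] by simp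
          ultimately have u': "?u' \<le> - u x" using pos[OF yx] by (simp add: algebra_simps)
          have "?u' * x powr (- c - 2) \<le> - u x * x powr (- c - 2)" using u' by (intro mult_right_mono) auto
          moreover have "u x * ((- c - 2) * x powr (- c - 3)) \<le> 0"
            using pos[OF yx] c by (intro mult_nonneg_nonpos mult_nonpos_nonneg) auto
          ultimately have "c * (c + 1) * (?u' * x powr (- c - 2) + u x * ((- c - 2) * x powr (- c - 3)))
              \<le> c * (c + 1) * (- u x * x powr (- c - 2))"
            using c by (intro mult_left_mono) auto
          then show ?thesis by (simp add: S_def)
        qed
        ultimately show "\<exists>d. ((\<lambda>y. r y - S y) has_real_derivative d) (at x) \<and> 0 \<le> d" by blast
      qed
    qed
  qed simp
  then have "R y0 * y0 powr (- c) \<le> c * (c + 1) / y0\<^sup>2 * u y0 * y0 powr (- c)"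
    using y0 Z by (simp add: r_def S_def powr_diff)
  then show "R y0 \<le> c * (c + 1) / y0\<^sup>2 * u y0"
    by (rule mult_right_le_imp_le) (use y0 Z in simp)
qed

end

text \<open>In the first case the exponential correction is absent. In the second the sign
  \<open>s\<close> makes \<open>ln (s * u y)\<close> available, and \<open>R / u\<close> contributes
  an integrable term to its derivative.\<close>

lemma fast_slow_dichotomy:
  assumes "fast_slow u R \<mu> c Z"
  obtains Z' where "Z \<le> Z'" "\<And>y. Z' \<le> y \<Longrightarrow> u y = 0"
  | Z' s where "Z \<le> Z'" "s = 1 \<or> s = - 1" "\<And>y. Z' \<le> y \<Longrightarrow> 0 < s * u y"
      "\<And>y. Z' \<le> y \<Longrightarrow> \<bar>R y / u y\<bar> \<le> c * (c + 1) / y\<^sup>2"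
proof -
  interpret fast_slow u R \<mu> c Z by fact
  interpret minus: fast_slow "\<lambda>y. - u y" "\<lambda>y. - R y" \<mu> c Z by (rule fast_slow_uminus) fact
  show ?thesis
  proof (cases "\<exists>y\<ge>Z. u y = 0")
    case True
    then show ?thesis using that(1) u_zero by blast
  next
    case False
    then have nz: "u y \<noteq> 0" if "Z \<le> y" for y using that by blast
    have sgn: "0 < s * u y" if s: "s = 1 \<or> s = - 1" "0 < s * u Z" and y: "Z \<le> y" for s y
    proof (rule ccontr)
      assume "\<not> 0 < s * u y"
      moreover have "isCont (\<lambda>y. s * u y) x" if "Z \<le> x" for x
        using DERIV_isCont[OF du[OF that]] by (intro continuous_intros)
      ultimately obtain x where "Z \<le> x" "s * u x = 0"
        using IVT2[of "\<lambda>y. s * u y" y 0 Z] s y by force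
      then show False using nz s by auto
    qed
    obtain s :: real where s: "s = 1 \<or> s = - 1" "0 < s * u Z"
    proof (cases "0 < u Z")
      case True
      then show ?thesis using that[of 1] by simp
    next
      case False
      then show ?thesis using that[of "- 1"] nz[of Z] by simp
    qed
    show ?thesis
    proof (rule that(2)[OF order_refl s(1)])
      fix y assume y: "Z \<le> y"
      show "0 < s * u y" by (rule sgn[OF s y])
      have ab: "0 \<le> s * R y \<and> s * R y \<le> c * (c + 1) / y\<^sup>2 * (s * u y)"
        using s(1)
      proof
        assume "s = 1"
        then show ?thesis using R_bounds[of y] sgn[OF s] y by simp
      next
        assume "s = - 1"
        then show ?thesis using minus.R_bounds[of y] sgn[OF s] y by simp
      qed
      have "R y / u y = (s * R y) / (s * u y)" using s(1) by auto
      moreover have "(s * R y) / (s * u y) \<le> c * (c + 1) / y\<^sup>2"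
        unfolding pos_divide_le_eq[OF sgn[OF s y]] using ab by blast
      moreover have "0 \<le> (s * R y) / (s * u y)"
        by (rule divide_nonneg_pos[OF conjunct1[OF ab] sgn[OF s y]])
      ultimately show "\<bar>R y / u y\<bar> \<le> c * (c + 1) / y\<^sup>2" by simp
    qed
  qed
qed

section \<open>Comparison with the expansion function \<theta>\<close>

text \<open>Change of variables \<open>x = y powr n\<close>. Since \<open>n = 2 - \<beta>\<close>,
  every power involved is rational in \<open>y\<close> and \<open>p\<close>, and the claim becomes
  algebraic: \<open>E\<close> is the equation for \<theta> times
  \<open>B * n\<^sup>2 * y\<^sup>2 * W\<close>, and the residual of the equation for
  \<open>g\<close> is \<open>B * E\<close>.\<close>

lemma theta_solves:
  fixes m B \<beta> n y :: real and \<theta> :: "real \<Rightarrow> real"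
  defines "\<beta> \<equiv> (m - 1) / m" and "n \<equiv> (m + 1) / m"
  defines "g \<equiv> \<lambda>s. B * s powr \<beta> * (1 + \<theta> (s powr n))"
    and "g1 \<equiv> \<lambda>s. B * (\<beta> * s powr (\<beta> - 1) * (1 + \<theta> (s powr n)) + n * s * deriv \<theta> (s powr n))"
  assumes m: "0 < m" and B: "0 < B" and y: "0 < y" and W: "0 < 1 + \<theta> (y powr n)"
    and diff: "\<theta> differentiable (at (y powr n))" "deriv \<theta> differentiable (at (y powr n))"
    and eq: "theta_equation_at m B \<theta> (y powr n)"
  shows "(g has_real_derivative g1 y) (at y)"
    "((\<lambda>s. g s * g1 s + s * g s) has_real_derivative (2 * m - 1) / m * g y) (at y)"
proof -
  define x t0 t1 t2 p where "x = y powr n" and "t0 = \<theta> x" and "t1 = deriv \<theta> x" and "t2 = deriv (deriv \<theta>) x"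
    and "p = y powr (\<beta> - 1)"
  define W where "W = 1 + t0"
  have p: "0 < p" and n: "0 < n" and W0: "0 < W"
    using y m W by (auto simp: p_def n_def W_def t0_def x_def)
  have n_beta: "n = 2 - \<beta>" using m by (simp add: n_def \<beta>_def field_simps)
  have powrs: "y powr \<beta> = p * y" "y powr (n - 1) = 1 / p" "x = y / p" "y powr (\<beta> - 2) = p / y"
    using y by (auto simp: p_def x_def n_beta powr_diff powr_minus field_simps power2_eq_square)
  have dx: "((\<lambda>s. s powr n) has_real_derivative n / p) (at y)"
    using y by (auto intro!: derivative_eq_intros simp: powrs)
  have dtheta: "((\<lambda>s. \<theta> (s powr n)) has_real_derivative t1 * (n / p)) (at y)"
    using DERIV_chain2[OF DERIV_deriv_iff_real_differentiable[THEN iffD2, OF diff(1)] dx] by (simp add: t1_def x_def)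
  have dtheta1: "((\<lambda>s. deriv \<theta> (s powr n)) has_real_derivative t2 * (n / p)) (at y)"
    using DERIV_chain2[OF DERIV_deriv_iff_real_differentiable[THEN iffD2, OF diff(2)] dx] by (simp add: t2_def x_def)
  have dq: "((\<lambda>s. s powr \<beta>) has_real_derivative \<beta> * p) (at y)"
    using y by (auto intro!: derivative_eq_intros simp: p_def)
  have dp: "((\<lambda>s. s powr (\<beta> - 1)) has_real_derivative (\<beta> - 1) * (p / y)) (at y)"
    using y by (auto intro!: derivative_eq_intros simp: powrs)
  have vals: "g y = B * (p * y) * W" "g1 y = B * (\<beta> * p * W + n * y * t1)"
    by (simp_all add: g_def g1_def W_def t0_def t1_def powrs p_def flip: x_def)
  show dg: "(g has_real_derivative g1 y) (at y)"
    unfolding vals(2) unfolding g_def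
  proof (rule DERIV_cong[OF DERIV_mult[OF DERIV_cmult[OF dq, of B] DERIV_add[OF DERIV_const dtheta]]])
    show "B * (\<beta> * p) * (1 + \<theta> (y powr n)) + (0 + t1 * (n / p)) * (B * y powr \<beta>) = B * (\<beta> * p * W + n * y * t1)"
      using p unfolding powrs(1) x_def[symmetric] t0_def[symmetric] W_def[symmetric] by (simp add: field_simps)
  qed
  define g2 where "g2 = B * (\<beta> * (\<beta> - 1) * p * W / y + (\<beta> + 1) * n * t1 + n\<^sup>2 * y * t2 / p)"
  have dg1: "(g1 has_real_derivative g2) (at y)"
    unfolding g1_def g2_def
  proof (rule DERIV_cong[OF DERIV_cmult[OF DERIV_add[OF
          DERIV_mult[OF DERIV_cmult[OF dp, of \<beta>] DERIV_add[OF DERIV_const dtheta]]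
          DERIV_mult[OF DERIV_cmult_Id dtheta1]]]])
    show "B * (\<beta> * ((\<beta> - 1) * (p / y)) * (1 + \<theta> (y powr n)) + (0 + t1 * (n / p)) * (\<beta> * y powr (\<beta> - 1))
        + (n * deriv \<theta> (y powr n) + t2 * (n / p) * (n * y)))
      = B * (\<beta> * (\<beta> - 1) * p * W / y + (\<beta> + 1) * n * t1 + n\<^sup>2 * y * t2 / p)"
      using p y unfolding p_def[symmetric] x_def[symmetric] t0_def[symmetric] t1_def[symmetric] W_def[symmetric]
      by (simp add: field_simps power2_eq_square)
  qed
  have dU: "((\<lambda>s. g s * g1 s + s * g s) has_real_derivative g1 y * g1 y + g y * g2 + (g y + y * g1 y)) (at y)"
    by (auto intro!: derivative_eq_intros dg dg1)
  have coeffs: "m / (B * (m + 1)) = 1 / (B * n)" "(4 * m - 3) / (x * (m + 1)) = (3 * \<beta> + 1) / (n * x)"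
    "(m - 1) * (m - 2) / ((m + 1)\<^sup>2 * x\<^sup>2) = \<beta> * (2 * \<beta> - 1) / (n\<^sup>2 * x\<^sup>2)"
  proof -
    have 1: "3 * \<beta> + 1 = (4 * m - 3) / m" "\<beta> * (2 * \<beta> - 1) = (m - 1) * (m - 2) / m\<^sup>2" "n\<^sup>2 = (m + 1)\<^sup>2 / m\<^sup>2"
      using m by (auto simp: \<beta>_def n_def field_simps power2_eq_square)
    show "m / (B * (m + 1)) = 1 / (B * n)" using m by (simp add: n_def)
    show "(4 * m - 3) / (x * (m + 1)) = (3 * \<beta> + 1) / (n * x)"
      unfolding 1 n_def using m by (simp add: mult.commute)
    show "(m - 1) * (m - 2) / ((m + 1)\<^sup>2 * x\<^sup>2) = \<beta> * (2 * \<beta> - 1) / (n\<^sup>2 * x\<^sup>2)"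
      unfolding 1 using m by simp
  qed
  define E where "E = B * n\<^sup>2 * y\<^sup>2 * W * t2 + n * y\<^sup>2 * t1 + B * n * (3 * \<beta> + 1) * p * y * W * t1
    + B * \<beta> * (2 * \<beta> - 1) * p\<^sup>2 * W\<^sup>2 + B * n\<^sup>2 * y\<^sup>2 * t1\<^sup>2"
  have "t2 + t1 * (1 / (B * n) + (3 * \<beta> + 1) / (n * x)) + t0 * (\<beta> * (2 * \<beta> - 1) / (n\<^sup>2 * x\<^sup>2))
      + 1 / (B * n) * t1 * (inverse W - 1) + t1\<^sup>2 / W + \<beta> * (2 * \<beta> - 1) / (n\<^sup>2 * x\<^sup>2) = 0" (is "?e = 0")
    using eq unfolding theta_equation_at_def x_def[symmetric] coeffs by (simp add: t0_def t1_def t2_def W_def)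
  moreover have "E = B * n\<^sup>2 * y\<^sup>2 * W * ?e"
  proof -
    define K C where "K = 1 / (B * n)" and "C = \<beta> * (2 * \<beta> - 1) / (n\<^sup>2 * x\<^sup>2)"
    have t0: "t0 = W - 1" by (simp add: W_def)
    have "?e = t2 + K * t1 * inverse W + t1 * ((3 * \<beta> + 1) / (n * x)) + W * C + t1\<^sup>2 / W"
      unfolding K_def[symmetric] C_def[symmetric] t0 by (simp add: algebra_simps)
    then have "B * n\<^sup>2 * y\<^sup>2 * W * ?e = B * n\<^sup>2 * y\<^sup>2 * W * t2 + B * n\<^sup>2 * y\<^sup>2 * W * (K * t1 * inverse W)
        + B * n\<^sup>2 * y\<^sup>2 * W * (t1 * ((3 * \<beta> + 1) / (n * x))) + B * n\<^sup>2 * y\<^sup>2 * W * (W * C)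
        + B * n\<^sup>2 * y\<^sup>2 * W * (t1\<^sup>2 / W)"
      by (simp only: distrib_left)
    moreover have "B * n\<^sup>2 * y\<^sup>2 * W * (K * t1 * inverse W) = n * y\<^sup>2 * t1"
      using n W0 B by (simp add: K_def power2_eq_square)
    moreover have "B * n\<^sup>2 * y\<^sup>2 * W * (t1 * ((3 * \<beta> + 1) / (n * x))) = B * n * (3 * \<beta> + 1) * p * y * W * t1"
      using n p y unfolding powrs(3) power2_eq_square by simp
    moreover have "B * n\<^sup>2 * y\<^sup>2 * W * (W * C) = B * \<beta> * (2 * \<beta> - 1) * p\<^sup>2 * W\<^sup>2"
      using n p y unfolding C_def powrs(3) power2_eq_square by simp
    moreover have "B * n\<^sup>2 * y\<^sup>2 * W * (t1\<^sup>2 / W) = B * n\<^sup>2 * y\<^sup>2 * t1\<^sup>2"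
      using W0 by simp
    ultimately show ?thesis unfolding E_def by (simp only:)
  qed
  ultimately have E: "E = 0" by simp
  have "g y * g2 = B\<^sup>2 * (\<beta> * (\<beta> - 1) * p\<^sup>2 * W\<^sup>2 + (\<beta> + 1) * n * p * y * W * t1 + n\<^sup>2 * y\<^sup>2 * W * t2)"
    unfolding vals g2_def using p y by (simp add: field_simps power2_eq_square)
  then have "g1 y * g1 y + g y * g2 + (g y + y * g1 y) - (1 + \<beta>) * g y = B * E"
    unfolding vals E_def by (simp add: algebra_simps power2_eq_square)
  moreover have "(2 * m - 1) / m = 1 + \<beta>" using m by (simp add: \<beta>_def field_simps)
  ultimately have "g1 y * g1 y + g y * g2 + (g y + y * g1 y) = (2 * m - 1) / m * g y" using E by simp
  with dU show "((\<lambda>s. g s * g1 s + s * g s) has_real_derivative (2 * m - 1) / m * g y) (at y)" by simp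
qed

text \<open>Two terms of the asymptotic series give \<open>1 / (1 + \<theta>) = 1 - T / x\<close> up
  to \<open>O(1 / x^2)\<close>, in the form of a finite limit.\<close>

lemma theta_expansion:
  assumes "theta_function m B \<theta>"
  defines "T \<equiv> B * (m - 1) * (m - 2) / (m * (m + 1))"
  obtains l where "((\<lambda>x. x\<^sup>2 * (1 / (1 + \<theta> x) - 1 + T / x)) \<longlongrightarrow> l) at_top"
proof -
  obtain c where c: "theta_formal_solution m B c"
      "\<And>N. (\<lambda>x. \<theta> x - (\<Sum>k=1..N. fps_nth c k / x ^ k)) \<in> o[at_top](\<lambda>x. 1 / x ^ N)"
    and lim: "(\<theta> \<longlongrightarrow> 0) at_top"
    using assms(1) unfolding theta_function_def by blast
  let ?c = "fps_nth c 2"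
  have T: "fps_nth c 1 = T" using c(1) by (simp add: theta_formal_solution_def T_def)
  have "(\<Sum>k=1..2. fps_nth c k / x ^ k) = T / x + ?c / x\<^sup>2" for x
    using T by (simp add: numeral_2_eq_2)
  then have "((\<lambda>x. (\<theta> x - (T / x + ?c / x\<^sup>2)) / (1 / x\<^sup>2)) \<longlongrightarrow> 0) at_top"
    using smalloD_tendsto[OF c(2)[of 2]] by simp
  then have "((\<lambda>x. (\<theta> x - (T / x + ?c / x\<^sup>2)) / (1 / x\<^sup>2) + ?c) \<longlongrightarrow> 0 + ?c) at_top" by (intro tendsto_intros)
  moreover have "\<forall>\<^sub>F x in at_top. (\<theta> x - (T / x + ?c / x\<^sup>2)) / (1 / x\<^sup>2) + ?c = x\<^sup>2 * (\<theta> x - T / x)"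
    using eventually_gt_at_top[of 0] by eventually_elim (simp add: field_simps)
  ultimately have l2: "((\<lambda>x. x\<^sup>2 * (\<theta> x - T / x)) \<longlongrightarrow> ?c) at_top"
    using Lim_transform_eventually by fastforce
  have "((\<lambda>x. x\<^sup>2 * (\<theta> x - T / x) * (1 / x) + T) \<longlongrightarrow> ?c * 0 + T) at_top"
    by (intro tendsto_intros l2) real_asymp
  moreover have "\<forall>\<^sub>F x in at_top. x\<^sup>2 * (\<theta> x - T / x) * (1 / x) + T = x * \<theta> x"
    using eventually_gt_at_top[of 0] by eventually_elim (simp add: field_simps power2_eq_square)
  ultimately have l1: "((\<lambda>x. x * \<theta> x) \<longlongrightarrow> T) at_top"
    using Lim_transform_eventually by fastforce
  have "((\<lambda>x. (x * \<theta> x)\<^sup>2 / (1 + \<theta> x) - x\<^sup>2 * (\<theta> x - T / x)) \<longlongrightarrow> T\<^sup>2 / (1 + 0) - ?c) at_top"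
    by (intro tendsto_intros l1 l2 lim) simp
  moreover have "\<forall>\<^sub>F x in at_top. (x * \<theta> x)\<^sup>2 / (1 + \<theta> x) - x\<^sup>2 * (\<theta> x - T / x) = x\<^sup>2 * (1 / (1 + \<theta> x) - 1 + T / x)"
    using order_tendstoD(1)[OF lim, of "- 1"]
  proof (rule eventually_mono)
    fix x assume "- 1 < \<theta> x"
    then have eq: "1 / (1 + \<theta> x) - 1 + T / x = (\<theta> x)\<^sup>2 / (1 + \<theta> x) - (\<theta> x - T / x)"
      by (simp add: field_simps power2_eq_square)
    show "(x * \<theta> x)\<^sup>2 / (1 + \<theta> x) - x\<^sup>2 * (\<theta> x - T / x) = x\<^sup>2 * (1 / (1 + \<theta> x) - 1 + T / x)"
      unfolding eq by (simp add: right_diff_distrib power_mult_distrib)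
  qed simp
  ultimately show ?thesis by (intro that) (rule Lim_transform_eventually)
qed

lemma tendsto_powr_exp_0: "((\<lambda>y::real. y powr e * exp (- y)) \<longlongrightarrow> 0) at_top"
proof -
  have "((\<lambda>y::real. y powr \<bar>e\<bar> * exp (- y)) \<longlongrightarrow> 0) at_top"
  proof (cases "e = 0")
    case True
    have "((\<lambda>y::real. exp (- y)) \<longlongrightarrow> 0) at_top" by real_asymp
    moreover have "\<forall>\<^sub>F y::real in at_top. exp (- y) = y powr \<bar>e\<bar> * exp (- y)"
      using eventually_gt_at_top[of 0] by eventually_elim (simp add: True)
    ultimately show ?thesis by (rule Lim_transform_eventually)
  next
    case False
    then have "0 < \<bar>e\<bar>" by simp
    then show ?thesis by real_asymp
  qed
  moreover have "\<forall>\<^sub>F y::real in at_top. norm (y powr e * exp (- y)) \<le> y powr \<bar>e\<bar> * exp (- y)"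
    using eventually_ge_at_top[of 1] by eventually_elim (simp add: powr_mono)
  ultimately show ?thesis by (rule Lim_null_comparison[rotated])
qed

text \<open>\<open>u' / u = - \<mu> - c / y + R / u\<close>, where \<mu> equals
  \<open>y powr (n - 1) / B - T / (B * y)\<close> up to \<open>o(1 / y^2)\<close>. Integration gives
  \<open>u\<close> the power \<open>T / B - c\<close> and the exponential of
  \<open>- y powr n / (B * n)\<close>; dividing by the mean \<open>p\<close> of \<open>f\<close> and
  \<open>g\<close>, of order \<open>y powr \<beta>\<close>, lowers the power to
  \<open>T / B - c - \<beta>\<close>, which is \<open>kappa1 m\<close>.\<close>

lemma asymptotic_comparison:
  fixes f f1 \<theta> :: "real \<Rightarrow> real"
  assumes m: "1 / 2 < m" and B: "0 < B"
    and df: "\<And>y. Y \<le> y \<Longrightarrow> (f has_real_derivative f1 y) (at y)"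
    and dUf: "\<And>y. Y \<le> y \<Longrightarrow> ((\<lambda>s. f s * f1 s + s * f s) has_real_derivative (2 * m - 1) / m * f y) (at y)"
    and lim_f: "((\<lambda>y. f y / y powr ((m - 1) / m)) \<longlongrightarrow> B) at_top"
    and theta: "theta_function m B \<theta>"
  shows "\<exists>D \<eta>. (\<eta> \<longlongrightarrow> 0) at_top \<and> (\<forall>\<^sub>F y in at_top.
    f y = B * y powr ((m - 1) / m) * (1 + \<theta> (y powr ((m + 1) / m)))
      + D * y powr kappa1 m * exp (- (m / (B * (m + 1))) * y powr ((m + 1) / m)) * (1 + \<eta> y))"
proof -
  define \<beta> n c where "\<beta> = (m - 1) / m" and "n = (m + 1) / m" and "c = (2 * m - 1) / m"
  define T where "T = B * (m - 1) * (m - 2) / (m * (m + 1))"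
  define g g1 where "g = (\<lambda>s. B * s powr \<beta> * (1 + \<theta> (s powr n)))"
    and "g1 = (\<lambda>s. B * (\<beta> * s powr (\<beta> - 1) * (1 + \<theta> (s powr n)) + n * s * deriv \<theta> (s powr n)))"
  have beta: "\<beta> < 1" "n = 2 - \<beta>" "c = 1 + \<beta>" "0 < c" "1 < n"
    using m by (auto simp: \<beta>_def n_def c_def field_simps)
  have n0: "0 < n" using beta by simp
  have kappa: "kappa1 m = T / B - c - \<beta>"
  proof -
    have "T / B = (m - 1) * (m - 2) / (m * (m + 1))" using B by (simp add: T_def)
    moreover have "c = (2 * m - 1) * (m + 1) / (m * (m + 1))" "\<beta> = (m - 1) * (m + 1) / (m * (m + 1))"
      using m by (auto simp: c_def \<beta>_def)
    ultimately have "T / B - c - \<beta> = ((m - 1) * (m - 2) - (2 * m - 1) * (m + 1) - (m - 1) * (m + 1)) / (m * (m + 1))"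
      by (simp only: diff_divide_distrib)
    also have "(m - 1) * (m - 2) - (2 * m - 1) * (m + 1) - (m - 1) * (m + 1) = - (2 * m\<^sup>2 + 4 * m - 4)"
      by (simp add: algebra_simps power2_eq_square)
    finally show ?thesis by (simp add: kappa1_def)
  qed
  have x_top: "filterlim (\<lambda>y. y powr n) at_top at_top" using n0 by real_asymp
  have lim_theta: "((\<lambda>y. \<theta> (y powr n)) \<longlongrightarrow> 0) at_top"
    by (rule filterlim_compose[OF _ x_top]) (use theta in \<open>simp add: theta_function_def\<close>)
  obtain l where l: "((\<lambda>x. x\<^sup>2 * (1 / (1 + \<theta> x) - 1 + T / x)) \<longlongrightarrow> l) at_top"
    using theta_expansion[OF theta] unfolding T_def by blast
  have lim_g: "((\<lambda>y. g y / y powr \<beta>) \<longlongrightarrow> B) at_top"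
  proof (rule Lim_transform_eventually)
    show "((\<lambda>y. B * (1 + \<theta> (y powr n))) \<longlongrightarrow> B) at_top"
      by (auto intro!: tendsto_eq_intros lim_theta)
    show "\<forall>\<^sub>F y in at_top. B * (1 + \<theta> (y powr n)) = g y / y powr \<beta>"
      using eventually_gt_at_top[of 0] by eventually_elim (simp add: g_def)
  qed
  note lim_f = lim_f[folded \<beta>_def]
  define p where "p y = (f y + g y) / 2" for y
  define \<mu> where "\<mu> y = y / p y" for y
  define u where "u y = ((f y)\<^sup>2 - (g y)\<^sup>2) / 2" for y
  define Q where "Q y = (f y * f1 y + y * f y) - (g y * g1 y + y * g y)" for y
  \<comment> \<open>\<open>Q' = c (f - g) = c \<mu> u / y\<close> contains the fast rate;
    differentiating the added term cancels exactly this contribution.\<close>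
  define R where "R y = Q y + c * u y / y" for y
  have lim_p: "((\<lambda>y. p y / y powr \<beta>) \<longlongrightarrow> B) at_top"
    using tendsto_divide[OF tendsto_add[OF lim_f lim_g] tendsto_const[of 2]]
    by (simp add: p_def add_divide_distrib mult.commute)
  have lim_W: "((\<lambda>y. (f y - g y) / y powr \<beta>) \<longlongrightarrow> 0) at_top"
    using tendsto_diff[OF lim_f lim_g] by (simp add: diff_divide_distrib)
  have ev_p: "\<forall>\<^sub>F y in at_top. 0 < p y"
    using order_tendstoD(1)[OF lim_p B] eventually_gt_at_top[of 0]
    by eventually_elim (auto simp: zero_less_divide_iff)
  have ev_g: "\<forall>\<^sub>F y in at_top. 0 < g y"
    using order_tendstoD(1)[OF lim_g B] eventually_gt_at_top[of 0]
    by eventually_elim (auto simp: zero_less_divide_iff)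
  have mu_top: "filterlim \<mu> at_top at_top"
  proof -
    have 1: "filterlim (\<lambda>y::real. y powr (1 - \<beta>)) at_top at_top"
      using beta(1) by real_asymp
    have "filterlim (\<lambda>y. inverse (p y / y powr \<beta>) * y powr (1 - \<beta>)) at_top at_top"
      by (rule filterlim_tendsto_pos_mult_at_top[OF tendsto_inverse[OF lim_p] _ 1]) (use B in auto)
    moreover have "\<forall>\<^sub>F y in at_top. inverse (p y / y powr \<beta>) * y powr (1 - \<beta>) = \<mu> y"
      using eventually_gt_at_top[of 0] by eventually_elim (simp add: \<mu>_def powr_diff field_simps)
    ultimately show ?thesis by (simp only: filterlim_cong[OF refl refl])
  qed
  have ev_theta: "\<forall>\<^sub>F y in at_top. \<theta> differentiable (at (y powr n)) \<and> deriv \<theta> differentiable (at (y powr n))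
      \<and> theta_equation_at m B \<theta> (y powr n)"
  proof -
    have "\<forall>\<^sub>F x in at_top. \<theta> differentiable (at x) \<and> deriv \<theta> differentiable (at x) \<and> theta_equation_at m B \<theta> x"
      using theta by (simp add: theta_function_def)
    from eventually_compose_filterlim[OF this x_top] show ?thesis .
  qed
  have ev_W: "\<forall>\<^sub>F y in at_top. 0 < 1 + \<theta> (y powr n)"
    using order_tendstoD(1)[OF lim_theta, of "- 1"] by (auto elim: eventually_mono)
  have ev_mu: "\<forall>\<^sub>F y in at_top. c * (c + 1) + 3 \<le> \<mu> y"
    using mu_top by (simp add: filterlim_at_top)
  have "\<forall>\<^sub>F y in at_top. (1 \<le> y \<and> Y \<le> y) \<and> (0 < p y \<and> 0 < g y) \<and> (c * (c + 1) + 3 \<le> \<mu> y \<and> 0 < 1 + \<theta> (y powr n))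
      \<and> \<theta> differentiable (at (y powr n)) \<and> deriv \<theta> differentiable (at (y powr n)) \<and> theta_equation_at m B \<theta> (y powr n)"
    by (intro eventually_conj eventually_ge_at_top ev_p ev_g ev_mu ev_W ev_theta)
  then obtain Z where "\<And>y. Z \<le> y \<Longrightarrow> (1 \<le> y \<and> Y \<le> y) \<and> (0 < p y \<and> 0 < g y) \<and> (c * (c + 1) + 3 \<le> \<mu> y \<and> 0 < 1 + \<theta> (y powr n))
      \<and> \<theta> differentiable (at (y powr n)) \<and> deriv \<theta> differentiable (at (y powr n)) \<and> theta_equation_at m B \<theta> (y powr n)"
    by (auto simp: eventually_at_top_linorder)
  then have Zf: "1 \<le> y" "Y \<le> y" "0 < p y" "0 < g y" "c * (c + 1) + 3 \<le> \<mu> y" "0 < 1 + \<theta> (y powr n)"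
      "\<theta> differentiable (at (y powr n))" "deriv \<theta> differentiable (at (y powr n))" "theta_equation_at m B \<theta> (y powr n)"
    if "Z \<le> y" for y using that by blast+
  have dg: "(g has_real_derivative g1 y) (at y)"
    and dUg: "((\<lambda>s. g s * g1 s + s * g s) has_real_derivative c * g y) (at y)" if y: "Z \<le> y" for y
    unfolding g_def g1_def \<beta>_def n_def c_def
    by (rule theta_solves; use m B Zf[OF y] in \<open>simp add: n_def\<close>)+
  have W: "f y - g y = u y / p y" "y * (f y - g y) = \<mu> y * u y" if "Z \<le> y" for y
  proof -
    have "u y = (f y - g y) * p y" by (simp add: u_def p_def field_simps power2_eq_square)
    then show "f y - g y = u y / p y" "y * (f y - g y) = \<mu> y * u y"
      using Zf(3)[OF that] by (simp_all add: \<mu>_def)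
  qed
  have du: "(u has_real_derivative - (\<mu> y + c / y) * u y + R y) (at y)" if y: "Z \<le> y" for y
  proof -
    have "(u has_real_derivative f y * f1 y - g y * g1 y) (at y)"
      unfolding u_def[abs_def]
      by (auto intro!: derivative_eq_intros df dg y Zf(2)[OF y] simp: field_simps)
    moreover have "f y * f1 y - g y * g1 y = Q y - y * (f y - g y)" by (simp add: Q_def algebra_simps)
    moreover have "Q y - y * (f y - g y) = - (\<mu> y + c / y) * u y + R y"
      unfolding W(2)[OF y] by (simp add: R_def algebra_simps)
    ultimately show ?thesis by simp
  qed
  have dR: "(R has_real_derivative c / y * R y - c * (c + 1) / y\<^sup>2 * u y) (at y)" if y: "Z \<le> y" for y
  proof -
    have y0: "0 < y" using Zf(1)[OF y] by simp
    have dQ: "(Q has_real_derivative c * f y - c * g y) (at y)"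
      unfolding Q_def[abs_def] by (intro DERIV_diff dUg[OF y] dUf[OF Zf(2)[OF y], folded c_def])
    have "(R has_real_derivative c * f y - c * g y + (c * (- (\<mu> y + c / y) * u y + R y) * y - c * u y) / (y * y)) (at y)"
      unfolding R_def[abs_def]
      using y0 by (auto intro!: derivative_eq_intros dQ du[OF y, unfolded R_def[abs_def]] simp: R_def)
    moreover have "c * f y - c * g y = c * (\<mu> y * u y) / y"
      using y0 W(2)[OF y] by (simp add: field_simps)
    moreover have "c * (\<mu> y * u y) / y + (c * (- (\<mu> y + c / y) * u y + R y) * y - c * u y) / (y * y)
        = c / y * R y - c * (c + 1) / y\<^sup>2 * u y"
      using y0 by (simp add: field_simps power2_eq_square)
    ultimately show ?thesis by simp
  qed
  \<comment> \<open>As \<open>y * (f y - g y) = \<mu> y * u y\<close> and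
    \<open>c = 1 + \<beta>\<close>, this says that \<open>f\<close> and \<open>g\<close> share the
    leading coefficient \<open>B\<close>.\<close>
  have small1: "((\<lambda>y. \<mu> y * u y / y powr c) \<longlongrightarrow> 0) at_top"
  proof (rule Lim_transform_eventually[OF lim_W])
    show "\<forall>\<^sub>F y in at_top. (f y - g y) / y powr \<beta> = \<mu> y * u y / y powr c"
      using eventually_ge_at_top[of Z]
    proof eventually_elim
      case (elim y)
      then show ?case using Zf(1)[OF elim] unfolding W(2)[OF elim, symmetric] beta(3)
        by (simp add: powr_add)
    qed
  qed
  have small2: "((\<lambda>y. u y / y powr (c + 1)) \<longlongrightarrow> 0) at_top"
  proof (rule Lim_transform_eventually)
    have "((\<lambda>y::real. y powr (\<beta> - 2)) \<longlongrightarrow> 0) at_top" using beta(1) by real_asymp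
    from tendsto_mult[OF tendsto_mult[OF lim_W lim_p] this]
    show "((\<lambda>y. (f y - g y) / y powr \<beta> * (p y / y powr \<beta>) * y powr (\<beta> - 2)) \<longlongrightarrow> 0) at_top" by simp
    show "\<forall>\<^sub>F y in at_top. (f y - g y) / y powr \<beta> * (p y / y powr \<beta>) * y powr (\<beta> - 2) = u y / y powr (c + 1)"
      using eventually_ge_at_top[of Z]
    proof eventually_elim
      case (elim y)
      have "y powr (c + 1) = y powr \<beta> * y\<^sup>2" "y powr (\<beta> - 2) = y powr \<beta> / y\<^sup>2"
        using Zf(1)[OF elim] by (simp_all add: beta(3) powr_add powr_diff power2_eq_square)
      then show ?case using Zf(1,3)[OF elim] unfolding W(1)[OF elim] by (simp add: field_simps)
    qed
  qed
  have fs: "fast_slow u R \<mu> c Z"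
    by unfold_locales (use Zf beta du dR small1 small2 in auto)
  interpret fast_slow u R \<mu> c Z by (rule fs)
  define S where "S y = y powr kappa1 m * exp (- (m / (B * (m + 1))) * y powr n)" for y
  have fold_S: "\<exists>D \<eta>. (\<eta> \<longlongrightarrow> 0) at_top \<and> (\<forall>\<^sub>F y in at_top. f y = g y + D * S y * (1 + \<eta> y)) \<Longrightarrow> ?thesis"
    unfolding \<beta>_def[symmetric] n_def[symmetric] g_def S_def by (simp only: mult.assoc)
  from fs show ?thesis
  proof (rule fast_slow_dichotomy)
    fix Z' assume Z': "Z \<le> Z'" "\<And>y. Z' \<le> y \<Longrightarrow> u y = 0"
    have "\<forall>\<^sub>F y in at_top. f y = g y + 0 * S y * (1 + 0)"
      using eventually_ge_at_top[of Z']
    proof eventually_elim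
      case (elim y)
      then show ?case using W(1)[of y] Z' by simp
    qed
    then show ?thesis by (intro fold_S exI[of _ 0] exI[of _ "\<lambda>_. 0"]) auto
  next
    fix Z' s assume Z': "Z \<le> Z'" and s: "s = 1 \<or> s = - 1" and pos: "\<And>y. Z' \<le> y \<Longrightarrow> 0 < s * u y"
      and ratio: "\<And>y. Z' \<le> y \<Longrightarrow> \<bar>R y / u y\<bar> \<le> c * (c + 1) / y\<^sup>2"
    \<comment> \<open>The deviation of \<mu> from its two-term expansion. Inserting
      \<open>y / g y\<close> splits it into a multiple of the exponentially small \<open>u\<close>
      and the remainder from \<open>theta_expansion\<close>, which after multiplication by
      \<open>y^2\<close> is still \<open>O(y powr (\<beta> - 1))\<close>.\<close>
    define E where "E y = y powr (n - 1) / B - T / (B * y) - \<mu> y" for y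
    have lim_E: "((\<lambda>y. y\<^sup>2 * E y) \<longlongrightarrow> 0) at_top"
    proof (rule Lim_transform_eventually)
      have "((\<lambda>y. \<bar>u Z\<bar> * exp Z * (y powr (3 - 3 * \<beta>) * exp (- y))) \<longlongrightarrow> \<bar>u Z\<bar> * exp Z * 0) at_top"
        by (intro tendsto_intros tendsto_powr_exp_0)
      then have "((\<lambda>y. y powr (3 - 3 * \<beta>) * u y) \<longlongrightarrow> 0) at_top"
      proof (rule Lim_null_comparison[rotated, OF tendsto_eq_rhs])
        show "\<forall>\<^sub>F y in at_top. norm (y powr (3 - 3 * \<beta>) * u y) \<le> \<bar>u Z\<bar> * exp Z * (y powr (3 - 3 * \<beta>) * exp (- y))"
          using eventually_ge_at_top[of Z]
        proof eventually_elim
          case (elim y)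
          have "y powr (3 - 3 * \<beta>) * \<bar>u y\<bar> \<le> y powr (3 - 3 * \<beta>) * (\<bar>u Z\<bar> * exp Z * exp (- y))"
            by (intro mult_left_mono u_exp_bound elim) simp
          then show ?case by (simp add: abs_mult mult_ac)
        qed
      qed simp
      then have 1: "((\<lambda>y. y powr (3 - 3 * \<beta>) * u y / (2 * (p y / y powr \<beta>)\<^sup>2 * (g y / y powr \<beta>))) \<longlongrightarrow>
          0 / (2 * B\<^sup>2 * B)) at_top"
        using B by (intro tendsto_intros lim_p lim_g) auto
      have 2: "((\<lambda>y::real. y powr (\<beta> - 1)) \<longlongrightarrow> 0) at_top" using beta(1) by real_asymp
      have 3: "((\<lambda>y. (y powr n)\<^sup>2 * (1 / (1 + \<theta> (y powr n)) - 1 + T / (y powr n))) \<longlongrightarrow> l) at_top"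
        by (rule filterlim_compose[OF l x_top])
      from tendsto_diff[OF 1 tendsto_mult[OF tendsto_divide[OF 2 tendsto_const[of B]] 3]]
      show "((\<lambda>y. y powr (3 - 3 * \<beta>) * u y / (2 * (p y / y powr \<beta>)\<^sup>2 * (g y / y powr \<beta>))
          - y powr (\<beta> - 1) / B * ((y powr n)\<^sup>2 * (1 / (1 + \<theta> (y powr n)) - 1 + T / (y powr n)))) \<longlongrightarrow> 0) at_top"
        using B by simp
      show "\<forall>\<^sub>F y in at_top. y powr (3 - 3 * \<beta>) * u y / (2 * (p y / y powr \<beta>)\<^sup>2 * (g y / y powr \<beta>))
          - y powr (\<beta> - 1) / B * ((y powr n)\<^sup>2 * (1 / (1 + \<theta> (y powr n)) - 1 + T / (y powr n))) = y\<^sup>2 * E y"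
        using eventually_ge_at_top[of Z]
      proof eventually_elim
        case (elim y)
        define q w where "q = y powr \<beta>" and "w = 1 + \<theta> (y powr n)"
        have pos': "0 < y" "0 < p y" "0 < g y" "0 < w" "0 < q"
          using Zf(1,3,4,6)[OF elim] by (auto simp: q_def w_def)
        have "y powr (3 * \<beta>) = q ^ 3"
          using pos' by (simp add: q_def powr_powr flip: powr_realpow) (simp add: mult.commute)
        then have powrs: "y powr (3 - 3 * \<beta>) = y ^ 3 / q ^ 3" "y powr (\<beta> - 1) = q / y" "y powr n = y\<^sup>2 / q"
            "y powr (n - 1) = y / q"
          using pos' by (simp_all add: q_def beta(2) powr_diff power2_eq_square)
        have first: "y powr (3 - 3 * \<beta>) * u y / (2 * (p y / q)\<^sup>2 * (g y / q)) = y ^ 3 * u y / (2 * (p y)\<^sup>2 * g y)"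
          unfolding powrs using pos' by (simp add: field_simps power2_eq_square power3_eq_cube)
        have gw: "g y = B * q * w" by (simp add: g_def q_def w_def)
        have second: "q / y / B * ((y\<^sup>2 / q)\<^sup>2 * (1 / w - 1 + T / (y\<^sup>2 / q))) = y\<^sup>2 * (y / g y - (y / q / B - T / (B * y)))"
          unfolding gw using pos' B by (simp add: field_simps power2_eq_square)
        have "1 / g y - 1 / p y = u y / (2 * (p y)\<^sup>2 * g y)"
        proof -
          have "1 / g y - 1 / p y = (p y - g y) / (g y * p y)" using pos' by (simp add: diff_frac_eq)
          also have "p y - g y = (f y - g y) / 2" by (simp add: p_def field_simps)
          also have "\<dots> = u y / p y / 2" by (simp only: W(1)[OF elim])
          finally show ?thesis by (simp add: power2_eq_square mult_ac)
        qed
        then have "y ^ 3 * u y / (2 * (p y)\<^sup>2 * g y) = y ^ 3 * (1 / g y - 1 / p y)" by simp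
        then have third: "y ^ 3 * u y / (2 * (p y)\<^sup>2 * g y) = y\<^sup>2 * (y / g y - \<mu> y)"
          by (simp add: \<mu>_def power3_eq_cube power2_eq_square right_diff_distrib)
        show ?case
          unfolding q_def[symmetric] w_def[symmetric] first third E_def unfolding powrs(2-4) second
          by (simp add: algebra_simps)
      qed
    qed
    have "\<forall>\<^sub>F y in at_top. \<bar>y\<^sup>2 * E y\<bar> < 1" using tendstoD[OF lim_E, of 1] by (simp add: dist_real_def)
    then obtain Z1 where Z1: "\<And>y. Z1 \<le> y \<Longrightarrow> \<bar>y\<^sup>2 * E y\<bar> < 1" by (auto simp: eventually_at_top_linorder)
    define Z2 where "Z2 = max Z1 Z'"
    have Z2: "Z \<le> y" "Z' \<le> y" "Z1 \<le> y" "1 \<le> y" if "Z2 \<le> y" for y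
      using that Z' Zf(1)[of y] by (auto simp: Z2_def)
    \<comment> \<open>The logarithm of \<open>s * u y\<close> over its predicted profile, so that
      \<open>L' = E + R / u\<close>.\<close>
    define L where "L y = ln (s * u y) + y powr n / (B * n) - T / B * ln y + c * ln y" for y
    have dL: "(L has_real_derivative E y + R y / u y) (at y)" if y: "Z2 \<le> y" for y
    proof -
      have u0: "0 < s * u y" "u y \<noteq> 0" "s \<noteq> 0" "0 < y" using pos[of y] Z2[OF y] s by auto
      have "(L has_real_derivative 1 / (s * u y) * (s * (- (\<mu> y + c / y) * u y + R y)) + n * y powr (n - 1) / (B * n)
          - T / B * (1 / y) + c * (1 / y)) (at y)"
        unfolding L_def[abs_def] using u0 B n0
        by (auto intro!: derivative_eq_intros du Z2[OF y])
      moreover have "1 / (s * u y) * (s * (- (\<mu> y + c / y) * u y + R y)) = - (\<mu> y + c / y) + R y / u y"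
        using u0 by (simp add: field_simps)
      ultimately show ?thesis using n0 B u0 by (simp add: E_def algebra_simps)
    qed
    have bound: "\<bar>E y + R y / u y\<bar> \<le> (1 + c * (c + 1)) / y\<^sup>2" if y: "Z2 \<le> y" for y
    proof -
      have "\<bar>E y\<bar> \<le> 1 / y\<^sup>2" using Z1[of y] Z2[OF y] by (simp add: abs_mult field_simps)
      then show ?thesis using ratio[of y] Z2[OF y] unfolding add_divide_distrib by linarith
    qed
    have "0 < Z2" using Z2(4)[of Z2] by simp
    then obtain l' where l': "(L \<longlongrightarrow> l') at_top"
      by (rule tendsto_of_deriv_inverse_square[OF _ dL bound]) auto
    \<comment> \<open>\<open>exp l'\<close> is the limit of \<open>s * u y\<close> over the profile;
      \<open>s\<close> restores the sign and \<open>B\<close> comes from dividing by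
      \<open>p\<close>.\<close>
    define D where "D = s * exp l' / B"
    have D0: "D \<noteq> 0" using s B by (auto simp: D_def)
    define \<eta> where "\<eta> y = (f y - g y) / (D * S y) - 1" for y
    have S0: "S y \<noteq> 0" if "0 < y" for y using that by (simp add: S_def)
    have "((\<lambda>y. exp (L y) / exp l' * (B / (p y / y powr \<beta>)) - 1) \<longlongrightarrow> exp l' / exp l' * (B / B) - 1) at_top"
      using B by (intro tendsto_intros l' lim_p) auto
    then have "((\<lambda>y. exp (L y) / exp l' * (B / (p y / y powr \<beta>)) - 1) \<longlongrightarrow> 0) at_top" using B by simp
    moreover have "\<forall>\<^sub>F y in at_top. exp (L y) / exp l' * (B / (p y / y powr \<beta>)) - 1 = \<eta> y"
      using eventually_ge_at_top[of Z2]
    proof eventually_elim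
      case (elim y)
      note y = Z2[OF elim]
      have y0: "0 < y" "0 < p y" "0 < s * u y" using y Zf(3)[OF y(1)] pos[OF y(2)] by auto
      have mB: "m / (B * (m + 1)) = 1 / (B * n)" using m by (simp add: n_def)
      have "S y = exp (kappa1 m * ln y - y powr n / (B * n))"
        using y0 unfolding S_def mB by (simp add: powr_def exp_diff exp_minus divide_inverse)
      moreover have "exp (L y) = s * u y * exp (y powr n / (B * n) - T / B * ln y + c * ln y)"
        using y0 by (simp add: L_def exp_add exp_diff)
      moreover have "y powr \<beta> = exp (\<beta> * ln y)" using y0 by (simp add: powr_def)
      ultimately have key: "exp (L y) * S y * y powr \<beta> = s * u y"
        by (simp add: kappa algebra_simps flip: exp_add)
      have ss: "s * s = 1" using s by auto
      have "\<eta> y = u y / p y / (s * exp l' / B * S y) - 1" by (simp add: \<eta>_def W(1)[OF y(1)] D_def)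
      also have "u y = s * (s * u y)" using ss by (simp flip: mult.assoc)
      also have "\<dots> = s * (exp (L y) * S y * y powr \<beta>)" by (simp only: key)
      also have "s * (exp (L y) * S y * y powr \<beta>) / p y / (s * exp l' / B * S y)
          = exp (L y) / exp l' * (B / (p y / y powr \<beta>))"
        using s B S0[OF y0(1)] y0 by (auto simp: field_simps)
      finally show ?case by simp
    qed
    ultimately have "(\<eta> \<longlongrightarrow> 0) at_top" by (rule Lim_transform_eventually)
    moreover have "\<forall>\<^sub>F y in at_top. f y = g y + D * S y * (1 + \<eta> y)"
      using eventually_gt_at_top[of 0] by eventually_elim (use D0 S0 in \<open>simp add: \<eta>_def\<close>)
    ultimately show ?thesis by (intro fold_S) blast
  qed
qed

section \<open>Growth of \<open>h\<close> and \<open>f\<close> for large arguments\<close>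

context trajectory begin

text \<open>\<open>h1 exp P\<close> is monotone, so \<open>h\<close> is eventually monotone and the asymptotics of \<open>\<Phi>\<close> can be differentiated.\<close>

lemma h_asymp: "((\<lambda>t. h t / t powr (m - 1)) \<longlongrightarrow> b * m) at_top"
proof -
  have d: "((\<lambda>t. h1 t * exp (P t)) has_real_derivative \<beta> * (h t)\<^sup>2 * exp (P t)) (at t)" for t
    by (auto intro!: derivative_eq_intros simp: algebra_simps)
  have "\<exists>T. (\<forall>t\<ge>T. 0 \<le> h1 t) \<or> (\<forall>t\<ge>T. h1 t \<le> 0)"
  proof (cases "0 \<le> \<beta>")
    case True
    have mono: "h1 s * exp (P s) \<le> h1 t * exp (P t)" if "s \<le> t" for s t
      by (rule DERIV_nonneg_imp_nondecreasing[OF that]) (use d True in \<open>auto intro!: exI\<close>)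
    show ?thesis
    proof (cases "\<exists>T. 0 \<le> h1 T")
      case True
      then obtain T where T: "0 \<le> h1 T" by blast
      have "0 \<le> h1 t" if "T \<le> t" for t
      proof -
        have "0 \<le> h1 T * exp (P T)" using T by simp
        then have "0 \<le> h1 t * exp (P t)" using mono[OF that] by (rule order_trans)
        then show ?thesis by (simp add: zero_le_mult_iff)
      qed
      then show ?thesis by blast
    qed (meson linear)
  next
    case False
    have mono: "h1 t * exp (P t) \<le> h1 s * exp (P s)" if "s \<le> t" for s t
      by (rule DERIV_nonpos_imp_nonincreasing[OF that])
         (use d False in \<open>auto intro!: exI mult_nonpos_nonneg\<close>)
    show ?thesis
    proof (cases "\<exists>T. h1 T \<le> 0")
      case True
      then obtain T where T: "h1 T \<le> 0" by blast
      have "h1 t \<le> 0" if "T \<le> t" for t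
      proof -
        have "h1 T * exp (P T) \<le> 0" using T by (simp add: mult_le_0_iff)
        then have "h1 t * exp (P t) \<le> 0" by (rule order_trans[OF mono[OF that]])
        then show ?thesis by (simp add: mult_le_0_iff)
      qed
      then show ?thesis by blast
    qed (meson linear)
  qed
  then obtain T where "(\<forall>t\<ge>T. 0 \<le> h1 t) \<or> (\<forall>t\<ge>T. h1 t \<le> 0)" by blast
  then show ?thesis
  proof
    assume T: "\<forall>t\<ge>T. 0 \<le> h1 t"
    have "h s \<le> h t" if "T \<le> s" "s \<le> t" for s t
      by (rule DERIV_nonneg_imp_nondecreasing[OF that(2)]) (use dh T that in \<open>meson order_trans\<close>)
    then show ?thesis by (rule monotone_density[OF Phi_asymp dPhi])
  next
    assume T: "\<forall>t\<ge>T. h1 t \<le> 0"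
    have "h t \<le> h s" if "T \<le> s" "s \<le> t" for s t
      by (rule DERIV_nonpos_imp_nonincreasing[OF that(2)]) (use dh T that in \<open>meson order_trans\<close>)
    then have mono: "- h s \<le> - h t" if "T \<le> s" "s \<le> t" for s t using that by simp
    \<comment> \<open>For eventually nonincreasing \<open>h\<close> the density theorem is applied
      to - \<Phi>.\<close>
    have "((\<lambda>t. - \<Phi> t / t powr m) \<longlongrightarrow> - b) at_top" using tendsto_minus[OF Phi_asymp] by simp
    then have "((\<lambda>t. - h t / t powr (m - 1)) \<longlongrightarrow> - b * m) at_top"
      by (rule monotone_density[OF _ DERIV_minus[OF dPhi] mono])
    from tendsto_minus[OF this] show ?thesis by simp
  qed
qed

text \<open>Elimination of \<open>t\<close>: \<open>m * \<beta> = m - 1\<close>, so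
  \<open>h / \<Phi> powr \<beta>\<close> has a finite limit, with the power
  \<open>1 - \<beta> = 1 / m\<close> of \<open>b\<close>.\<close>

lemma f_asymp: "((\<lambda>y. f y / y powr ((m - 1) / m)) \<longlongrightarrow> m * b powr (1 / m)) at_top"
proof -
  have "((\<lambda>t. (h t / t powr (m - 1)) / (\<Phi> t / t powr m) powr \<beta>) \<longlongrightarrow> b * m / b powr \<beta>) at_top"
    using b by (intro tendsto_intros h_asymp Phi_asymp) auto
  moreover have "b * m / b powr \<beta> = m * b powr (1 / m)"
    using b by (simp add: beta(4) powr_diff)
  ultimately have "((\<lambda>t. (h t / t powr (m - 1)) / (\<Phi> t / t powr m) powr \<beta>) \<longlongrightarrow> m * b powr (1 / m)) at_top" by simp
  moreover have "\<forall>\<^sub>F t in at_top. (h t / t powr (m - 1)) / (\<Phi> t / t powr m) powr \<beta> = h t / \<Phi> t powr \<beta>"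
    using eventually_gt_at_top[of 0]
  proof eventually_elim
    case (elim t)
    have "0 < \<Phi> t" using Phi_strict_mono[OF elim] by (simp add: Phi_0)
    moreover have "(t powr m) powr \<beta> = t powr (m - 1)" using m by (simp add: powr_powr \<beta>_def)
    ultimately show ?case using elim by (simp add: powr_divide)
  qed
  ultimately have "((\<lambda>t. h t / \<Phi> t powr \<beta>) \<longlongrightarrow> m * b powr (1 / m)) at_top" by (rule Lim_transform_eventually)
  from filterlim_compose[OF this tau_at_top]
  have "((\<lambda>y. h (\<tau> y) / \<Phi> (\<tau> y) powr \<beta>) \<longlongrightarrow> m * b powr (1 / m)) at_top" .
  moreover have "\<forall>\<^sub>F y in at_top. h (\<tau> y) / \<Phi> (\<tau> y) powr \<beta> = f y / y powr ((m - 1) / m)"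
    using eventually_gt_at_top[of "- a"] by eventually_elim (simp add: f_def \<beta>_def)
  ultimately show ?thesis by (rule Lim_transform_eventually)
qed

lemma f_unique: "cauchy_solution m a R g \<Longrightarrow> - a < y \<Longrightarrow> ereal y < R \<Longrightarrow> g y = f y"
  by (rule cauchy_solution_unique[OF m a f_cauchy f_pos])

text \<open>The series is known to solve the problem only near - a; this is why uniqueness is proved
  for an arbitrary right endpoint \<open>R\<close>.\<close>

lemma f_series:
  assumes "- a < y" "y < - a + a / 16"
  shows "f y = a\<^sup>2 * eval_fps (phi_fps m) ((y + a) / a)"
  using f_unique[OF phi_cauchy_solution[OF m a]] assms by simp

lemma f_large:
  assumes "theta_function m (m * b powr (1 / m)) \<theta>"
  shows "\<exists>D \<eta>. (\<eta> \<longlongrightarrow> 0) at_top \<and> (\<forall>\<^sub>F y in at_top.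
    f y = m * b powr (1 / m) * y powr ((m - 1) / m) * (1 + \<theta> (y powr ((m + 1) / m)))
      + D * y powr kappa1 m * exp (- (m / (m * b powr (1 / m) * (m + 1))) * y powr ((m + 1) / m)) * (1 + \<eta> y))"
proof (rule asymptotic_comparison[where Y = 0, OF m _ _ _ f_asymp assms])
  show "0 < m * b powr (1 / m)" using b m by simp
  fix y :: real assume "0 \<le> y"
  then have "- a < y" using a by simp
  then show "(f has_real_derivative deriv f y) (at y)"
    "((\<lambda>s. f s * deriv f s + s * f s) has_real_derivative (2 * m - 1) / m * f y) (at y)"
    using f_cauchy unfolding cauchy_solution_def by (simp_all add: DERIV_deriv_iff_real_differentiable)
qed

end

text \<open>Uniqueness is claimed against local solutions as well as global ones. In (iii) the
  constant \<open>D\<close> is chosen after \<theta>, since admissible choices of \<theta> may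
  differ by exponentially small terms.\<close>

theorem theorem6p2:
  fixes m b a B :: real and \<Phi> :: "real \<Rightarrow> real"
  assumes "1 / 2 < m" and "0 < b" and "0 < a"
    and "trajectory_solution m b a \<Phi>"
    and "B = m * b powr (1 / m)"
  shows "\<exists>f :: real \<Rightarrow> real.
    \<comment> \<open>\<open>f\<close> is the solution of the Cauchy problem, and it is global\<close>
    cauchy_solution m a \<infinity> f \<and>
    (\<forall>R g. cauchy_solution m a R g \<longrightarrow> (\<forall>y. - a < y \<and> ereal y < R \<longrightarrow> g y = f y)) \<and>
    (\<forall>\<tau>. - a < \<Phi> \<tau> \<and> f (\<Phi> \<tau>) = deriv \<Phi> \<tau>) \<and>
    \<comment> \<open>(i)\<close>
    (\<forall>y. - a < y \<and> y \<le> a \<longrightarrow> (a\<^sup>2 - y\<^sup>2) / 2 < f y \<and> f y < a * (y + a)) \<and>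
    (\<forall>y. a < y \<longrightarrow> 0 < f y \<and> f y < a * (y + a)) \<and>
    \<comment> \<open>(ii)\<close>
    (\<exists>r > 0. \<exists>F :: complex \<Rightarrow> complex.
       F holomorphic_on ball (of_real (- a)) r \<and>
       (\<forall>y. - a < y \<and> y < - a + r \<longrightarrow> F (of_real y) = of_real (f y)) \<and>
       (\<forall>z \<in> ball (of_real (- a)) r.
          summable (\<lambda>k. of_real (chi m (Suc k)) * (z + of_real a) ^ Suc k / of_real a ^ Suc k) \<and>
          F z = of_real a * (z + of_real a) *
            (1 + (\<Sum>k. of_real (chi m (Suc k)) * (z + of_real a) ^ Suc k / of_real a ^ Suc k)))) \<and>
    (\<forall>y > - a. 0 < f y) \<and>
    \<comment> \<open>(iii)\<close>
    (\<forall>\<theta>. theta_function m B \<theta> \<longrightarrow>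
       (\<exists>D :: real. \<exists>\<eta> :: real \<Rightarrow> real. (\<eta> \<longlongrightarrow> 0) at_top \<and>
          (\<forall>\<^sub>F y in at_top.
             f y = B * y powr ((m - 1) / m) * (1 + \<theta> (y powr ((m + 1) / m)))
                   + D * y powr kappa1 m * exp (- (m / (B * (m + 1))) * y powr ((m + 1) / m))
                     * (1 + \<eta> y))))"
proof -
  interpret trajectory m b a \<Phi> by unfold_locales (use assms in auto)
  have "- a < \<Phi> \<tau> \<and> f (\<Phi> \<tau>) = deriv \<Phi> \<tau>" for \<tau>
    using Phi_greater f_Phi by simp
  moreover have "\<exists>r > 0. \<exists>F :: complex \<Rightarrow> complex.
       F holomorphic_on ball (of_real (- a)) r \<and>
       (\<forall>y. - a < y \<and> y < - a + r \<longrightarrow> F (of_real y) = of_real (f y)) \<and>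
       (\<forall>z \<in> ball (of_real (- a)) r.
          summable (\<lambda>k. of_real (chi m (Suc k)) * (z + of_real a) ^ Suc k / of_real a ^ Suc k) \<and>
          F z = of_real a * (z + of_real a) *
            (1 + (\<Sum>k. of_real (chi m (Suc k)) * (z + of_real a) ^ Suc k / of_real a ^ Suc k)))"
    by (rule exI[of _ "a / 16"], intro conjI exI)
       (use a series_holomorphic[OF m a] f_series in auto)
  moreover have "\<forall>R g. cauchy_solution m a R g \<longrightarrow> (\<forall>y. - a < y \<and> ereal y < R \<longrightarrow> g y = f y)"
    using f_unique by blast
  moreover have "(\<forall>y. - a < y \<and> y \<le> a \<longrightarrow> (a\<^sup>2 - y\<^sup>2) / 2 < f y \<and> f y < a * (y + a)) \<and>
    (\<forall>y. a < y \<longrightarrow> 0 < f y \<and> f y < a * (y + a))"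
    using f_greater f_less f_pos a by simp
  ultimately show ?thesis
    unfolding \<open>B = m * b powr (1 / m)\<close>
    by (intro exI[of _ f] conjI f_cauchy) (use f_pos f_large in auto)
qed

end
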